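(* Let $T\in(0,\infty)$ and $u\in\mathbb{H}$. Choose \begin{align*} a_T=\;&6\langle\partial_1Y,\partial_1Y\rangle_T(\partial_1Y_T)^2+6\langle\partial_2Y,\partial_2Y\rangle_T(\partial_2Y_T)^2+2\langle\partial_2Y,\partial_2Y\rangle_T(\partial_1Y_T)^2\\ &+2\langle\partial_1Y,\partial_1Y\rangle_T(\partial_2Y_T)^2+4\langle\partial_1Y,\partial_2Y\rangle_T^2-3\langle\partial_1Y,\partial_1Y\rangle_T^2-3\langle\partial_2Y,\partial_2Y\rangle_T^2\\ &-2\langle\partial_1Y,\partial_1Y\rangle_T\langle\partial_2Y,\partial_2Y\rangle_T\\ &+8\int_0^T\!\!\int_0^s\partial_1Y_r\,d(\partial_2Y_r)\,d\langle\partial_1Y,\partial_2Y\rangle_s+8\int_0^T\!\!\int_0^s\partial_2Y_r\,d(\partial_1Y_r)\,d\langle\partial_1Y,\partial_2Y\rangle_s\\ &+8\int_0^T\!\!\int_0^s\partial_1Y_r\,d\langle\partial_2Y,\partial_2Y\rangle_r\,d(\partial_1Y_s)+8\int_0^T\!\!\int_0^s\langle\partial_2Y,\partial_2Y\rangle_r\,d(\partial_1Y_r)\,d(\partial_1Y_s)\\ &+8\int_0^T\!\!\int_0^s\partial_2Y_r\,d\langle\partial_1Y,\partial_1Y\rangle_r\,d(\partial_2Y_s)+8\int_0^T\!\!\int_0^s\langle\partial_1Y,\partial_1Y\rangle_r\,d(\partial_2Y_r)\,d(\partial_2Y_s), \end{align*} $$b_T=\begin{pmatrix}3\langle\partial_1Y,\partial_1Y\rangle_T\partial_1Y_T+2\langle\partial_1Y,\partial_2Y\rangle_T\partial_2Y_T+\langle\partial_2Y,\partial_2Y\rangle_T\partial_1Y_T\\3\langle\partial_2Y,\partial_2Y\rangle_T\partial_2Y_T+2\langle\partial_1Y,\partial_2Y\rangle_T\partial_1Y_T+\langle\partial_1Y,\partial_1Y\rangle_T\partial_2Y_T\end{pmatrix},$$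 and $c_T:\mathbb{R}^2\to\mathbb{R}$, $$c_T((x_1,x_2))=6\langle\partial_1Y,\partial_1Y\rangle_Tx_1^2+6\langle\partial_2Y,\partial_2Y\rangle_Tx_2^2+2\langle\partial_1Y,\partial_1Y\rangle_Tx_2^2+2\langle\partial_2Y,\partial_2Y\rangle_Tx_1^2+8\langle\partial_1Y,\partial_2Y\rangle_Tx_1x_2.$$ Then \begin{align*} &\int_{\mathbb{T}^2}|\nabla Y_T+\nabla Z_T(u)|^4-c_T(\nabla Z_T(u))-4b_T\cdot\nabla Z_T(u)-a_T\,dx\\ &=\int_{\mathbb{T}^2}[\![\nabla Y_T^4]\!]+4[\![\nabla Y_T^3]\!]\cdot\nabla Z_T(u)+4\nabla Y_T\cdot(\nabla Z_T(u))^3+(\nabla Z_T(u))^4\\ &\quad+\sum_{i,j,k,l\in\{1,2\}}2(\delta_{ik}\delta_{jl}+\delta_{il}\delta_{jk}+\delta_{ij}\delta_{kl})[\![\partial_iY_T\partial_jY_T]\!]\,\partial_kZ_T(u)\,\partial_lZ_T(u)\,dx. \end{align*} Moreover, if \begin{align*} \Phi_T(u):=\int_{\mathbb{T}^2}&4\nabla Y_T\cdot(\nabla Z_T(u))^3+4[\![\nabla Y_T^3]\!]\cdot\nabla Z_T(u)\\ &+\sum_{i,j,k,l\in\{1,2\}}2(\delta_{ik}\delta_{jl}+\delta_{il}\delta_{jk}+\delta_{ij}\delta_{kl})[\![\partial_iY_T\partial_jY_T]\!]\,\partial_kZ_T(u)\,\partial_lZ_T(u)\,dx, \end{align*} then the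 functional $$F_T(u):=\mathbb{E}\left[f(Y_T+Z_T(u))+\int_{\mathbb{T}^2}|\nabla Y_T+\nabla Z_T(u)|^4-c_T(\nabla Z_T(u))-4b_T\cdot\nabla Z_T(u)-a_T\,dx+\frac12\int_0^\infty\|u_s\|_{L^2}^2\,ds\right]$$ has the representation $$F_T(u)=\mathbb{E}\left[f(Y_T+Z_T(u))+\Phi_T(u)+\|\nabla Z_T(u)\|_{L^4}^4+\frac12\int_0^\infty\|u_s\|_{L^2}^2\,ds\right].$$
   Context: Setting: $\mathbb{T}^2=(\mathbb{R}/2\pi\mathbb{Z})^2$, with $dx$ normalized so that $(e^{i\langle\cdot,n\rangle})_{n\in\mathbb{Z}^2}$ is orthonormal in $L^2(\mathbb{T}^2)$. A dot over a function space denotes the subspace of zero-mean functions. For $v\in\mathbb{R}^2$ and $k\in\mathbb{N}$: $v^k=|v|^{k-1}v$ if $k$ is odd, $v^k=|v|^k$ if $k$ is even. For a symbol $h$, $h(D)$ is the Fourier multiplier with symbol $h$. $\delta_{ij}$ is the Kronecker delta. Gaussian process: Let $\Omega=C(\mathbb{R}^+;\dot H^\alpha(\mathbb{T}^2))$, $\alpha<-1$, with the Borel $\sigma$-algebra and the Wiener measure $\mathbb{P}$ such that the canonical process is $X_t(x)=\sum_{n\in\mathbb{Z}^2\setminus\{0\}}e^{i\langle x,n\rangle}B^n_t$, with $\mathbb{C}$-valued Brownian motions $B^n$ ($\mathbb{E}|B^n_t|^2=t$), $\overline{B^n}=B^{-n}$, and $B^n,B^m$ independent for $m\neq\pm n$.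 Let $\zeta\in C^\infty(\mathbb{R}_+,[0,1])$ be decreasing with $\zeta(s)=1$ for $s\le\frac12$, $\zeta(s)=0$ for $s\ge1$; set $\zeta_t(x)=\zeta\big((1+|x|^2)^{1/2}/t\big)$, $\sigma_t(x)=\big(\frac{d}{dt}\zeta_t^2(x)\big)^{1/2}$, $J_t=\frac{\sigma_t(D)}{(|D|^2+|D|^4)^{1/2}}$, and $$Y_t=\int_0^tJ_s\,dX_s=\sum_{n\in\mathbb{Z}^2\setminus\{0\}}\int_0^t\frac{\sigma_s(n)}{(|n|^2+|n|^4)^{1/2}}e^{i\langle\cdot,n\rangle}\,dB^n_s.$$ For each fixed $x\in\mathbb{T}^2$, $\langle\partial_iY,\partial_jY\rangle_t$ is the quadratic covariation at time $t$ of the martingales $\partial_iY(x),\partial_jY(x)$ (it depends neither on $x$ nor on $\omega$); stochastic integrals are It\^o integrals, taken pointwise in $x$. Drifts: $\mathcal{H}=L^2([0,\infty);\dot L^2(\mathbb{T}^2))$; $\mathbb{H}$ is the space of $\dot L^2(\mathbb{T}^2)$-valued predictable processes whose trajectories lie a.s. in $\mathcal{H}$; $Z_T(u)=\int_0^TJ_tu_t\,dt$. $f$ is a real-valued continuous function with linear growth on $\mathscr{C}^{1-\kappa}(\mathbb{T}^2)$ ($\kappa>0$ fixed; $\mathscr{C}^\alpha$ is the closure of the smooth functions in the Besov space $B^\alpha_{\infty,\infty}(\mathbb{T}^2)$). Wick powers: $[\![\nabla Y_T^4]\!]:=(\nabla Y_T)^4-a_T$, $[\![\nabla Y_T^3]\!]:=(\nabla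 Y_T)^3-b_T$ with $a_T,b_T$ the expressions displayed in the claim, and $[\![\partial_iY_T\partial_jY_T]\!]:=\partial_iY_T\partial_jY_T-\langle\partial_iY,\partial_jY\rangle_T$. *)

theory Defs
  imports "HOL-Probability.Probability"
begin

section \<open>The torus, Fourier modes and vector powers\<close>

text \<open>Functions on the torus are \<open>2\<pi>\<close>-periodic functions on the plane; the two
  coordinate indices are the elements \<open>1\<close> and \<open>2\<close> (which is \<open>0\<close>) of the type \<open>2\<close>.\<close>

definition torus :: "(real^2) measure" where
  "torus = uniform_measure lborel (cbox 0 (\<chi> i. 2 * pi))"

definition rvec :: "int^2 \<Rightarrow> real^2" where
  "rvec n = (\<chi> i. real_of_int (n $ i))"

definition periodic :: "(real^2 \<Rightarrow> real) \<Rightarrow> bool" where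
  "periodic g \<longleftrightarrow> (\<forall>x n. g (x + (2 * pi) *\<^sub>R rvec n) = g x)"

definition mode :: "int^2 \<Rightarrow> real^2 \<Rightarrow> complex" where
  "mode n x = cis (rvec n \<bullet> x)"

definition fourier_coeff :: "(real^2 \<Rightarrow> real) \<Rightarrow> int^2 \<Rightarrow> complex" where
  "fourier_coeff g n = (\<integral>x. complex_of_real (g x) * cnj (mode n x) \<partial>torus)"

text \<open>\<open>h(D)g\<close>. Only real functions \<open>g\<close> and real symbols with \<open>h(-\<xi>) = h(\<xi>)\<close> are used, for which
  the Fourier series is real; \<open>Re\<close> only adjusts the type.\<close>

definition fourier_multiplier :: "(real^2 \<Rightarrow> real) \<Rightarrow> (real^2 \<Rightarrow> real) \<Rightarrow> real^2 \<Rightarrow> real" where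
  "fourier_multiplier h g x =
     Re (\<Sum>\<^sub>\<infinity>n. complex_of_real (h (rvec n)) * fourier_coeff g n * mode n x)"

definition grad :: "(real^2 \<Rightarrow> real) \<Rightarrow> real^2 \<Rightarrow> real^2" where
  "grad g x = (\<chi> i. deriv (\<lambda>h. g (x + h *\<^sub>R axis i 1)) 0)"

text \<open>The power \<open>v\<^sup>k\<close> of a vector is a vector for odd \<open>k\<close> and a scalar for even \<open>k\<close>.\<close>

definition odd_pow :: "real^2 \<Rightarrow> nat \<Rightarrow> real^2" where
  "odd_pow v k = norm v ^ (k - 1) *\<^sub>R v"

definition even_pow :: "real^2 \<Rightarrow> nat \<Rightarrow> real" where
  "even_pow v k = norm v ^ k"

definition delta :: "2 \<Rightarrow> 2 \<Rightarrow> real" where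
  "delta i j = (if i = j then 1 else 0)"


section \<open>Function spaces\<close>

text \<open>Real zero-mean \<open>L\<^sup>2\<close> functions; equality almost everywhere is not divided out, but the Borel
  \<open>\<sigma>\<close>-algebra below is the one of the seminorm, so it does not separate a.e. equal functions.\<close>

definition l2_norm :: "(real^2 \<Rightarrow> real) \<Rightarrow> real" where
  "l2_norm v = sqrt (\<integral>x. (v x)\<^sup>2 \<partial>torus)"

definition L2_dot :: "(real^2 \<Rightarrow> real) set" where
  "L2_dot = {v. v \<in> borel_measurable borel \<and> periodic v \<and>
                integrable torus (\<lambda>x. (v x)\<^sup>2) \<and> (\<integral>x. v x \<partial>torus) = 0}"

definition L2_dot_borel :: "(real^2 \<Rightarrow> real) measure" where
  "L2_dot_borel = sigma L2_dot
     {U. U \<subseteq> L2_dot \<and> (\<forall>v\<in>U. \<exists>\<epsilon>>0. \<forall>w\<in>L2_dot. l2_norm (\<lambda>x. w x - v x) < \<epsilon> \<longrightarrow> w \<in> U)}"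

text \<open>A real distribution on the torus is represented by its family of Fourier coefficients,
  which satisfies \<open>c\<^sub>-\<^sub>n = cnj c\<^sub>n\<close>.\<close>

type_synonym distribution = "int^2 \<Rightarrow> complex"

definition real_distribution :: "distribution \<Rightarrow> bool" where
  "real_distribution c \<longleftrightarrow> (\<forall>n. c (- n) = cnj (c n))"

definition sobolev_norm :: "real \<Rightarrow> distribution \<Rightarrow> real" where
  "sobolev_norm \<alpha> c = sqrt (\<Sum>\<^sub>\<infinity>n. (1 + (norm (rvec n))\<^sup>2) powr \<alpha> * (cmod (c n))\<^sup>2)"

definition H_dot :: "real \<Rightarrow> distribution set" where
  "H_dot \<alpha> = {c. real_distribution c \<and> c 0 = 0 \<and>
     (\<lambda>n. (1 + (norm (rvec n))\<^sup>2) powr \<alpha> * (cmod (c n))\<^sup>2) summable_on UNIV}"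

definition smooth_halfline :: "(real \<Rightarrow> real) \<Rightarrow> bool" where
  "smooth_halfline g \<longleftrightarrow> (\<exists>D :: nat \<Rightarrow> real \<Rightarrow> real. D 0 = g \<and>
     (\<forall>k. \<forall>s\<ge>0. (D k has_real_derivative D (Suc k) s) (at s within {0..})))"

definition cutoff :: "(real \<Rightarrow> real) \<Rightarrow> bool" where
  "cutoff \<zeta> \<longleftrightarrow> smooth_halfline \<zeta> \<and> \<zeta> ` {0..} \<subseteq> {0..1} \<and> antimono_on {0..} \<zeta> \<and>
     (\<forall>s\<in>{0..1/2}. \<zeta> s = 1) \<and> (\<forall>s\<ge>1. \<zeta> s = 0)"

text \<open>Littlewood--Paley decomposition built from a radial cutoff \<open>\<theta>\<close>; the index is shifted, so
  that \<open>lp_symbol \<theta> j\<close> belongs to the block usually numbered \<open>j - 1\<close>. The space and its topology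
  do not depend on the choice of \<open>\<theta>\<close>.\<close>

definition lp_symbol :: "(real \<Rightarrow> real) \<Rightarrow> nat \<Rightarrow> real \<Rightarrow> real" where
  "lp_symbol \<theta> j r = (if j = 0 then \<theta> r else \<theta> (r / 2 ^ j) - \<theta> (r / 2 ^ (j - 1)))"

definition lp_block :: "(real \<Rightarrow> real) \<Rightarrow> nat \<Rightarrow> distribution \<Rightarrow> real^2 \<Rightarrow> complex" where
  "lp_block \<theta> j c x =
     (\<Sum>\<^sub>\<infinity>n. complex_of_real (lp_symbol \<theta> j (norm (rvec n))) * c n * mode n x)"

definition besov_norm :: "(real \<Rightarrow> real) \<Rightarrow> real \<Rightarrow> distribution \<Rightarrow> ennreal" where
  "besov_norm \<theta> \<beta> c =
     (SUP j. SUP x. ennreal (2 powr (\<beta> * (real j - 1)) * cmod (lp_block \<theta> j c x)))"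

definition smooth_torus :: "(real^2 \<Rightarrow> real) \<Rightarrow> bool" where
  "smooth_torus g \<longleftrightarrow> periodic g \<and> (\<exists>S. g \<in> S \<and>
     (\<forall>h\<in>S. (\<forall>x. h differentiable (at x)) \<and> (\<forall>i. (\<lambda>x. grad h x $ i) \<in> S)))"

text \<open>Closure of the smooth functions in \<open>B\<^sup>\<beta>\<close> with both further indices infinite.\<close>

definition C_besov :: "(real \<Rightarrow> real) \<Rightarrow> real \<Rightarrow> distribution set" where
  "C_besov \<theta> \<beta> = {c. real_distribution c \<and> besov_norm \<theta> \<beta> c < \<infinity> \<and>
     (\<forall>\<epsilon>>0. \<exists>g. smooth_torus g \<and> besov_norm \<theta> \<beta> (\<lambda>n. c n - fourier_coeff g n) < ennreal \<epsilon>)}"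

definition continuous_functional ::
  "(real \<Rightarrow> real) \<Rightarrow> real \<Rightarrow> (distribution \<Rightarrow> real) \<Rightarrow> bool" where
  "continuous_functional \<theta> \<beta> f \<longleftrightarrow>
     (\<forall>c\<in>C_besov \<theta> \<beta>. \<forall>\<epsilon>>0. \<exists>\<eta>>0. \<forall>d\<in>C_besov \<theta> \<beta>.
        besov_norm \<theta> \<beta> (\<lambda>n. d n - c n) < ennreal \<eta> \<longrightarrow> \<bar>f d - f c\<bar> < \<epsilon>)"

definition linear_growth ::
  "(real \<Rightarrow> real) \<Rightarrow> real \<Rightarrow> (distribution \<Rightarrow> real) \<Rightarrow> bool" where
  "linear_growth \<theta> \<beta> f \<longleftrightarrow>
     (\<exists>C. \<forall>c\<in>C_besov \<theta> \<beta>. \<bar>f c\<bar> \<le> C * (1 + enn2real (besov_norm \<theta> \<beta> c)))"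


section \<open>Martingales, Stieltjes and Ito integrals\<close>

text \<open>Time is \<open>{0..}\<close>; the values of processes and integrators at negative times are irrelevant.\<close>

definition predictable_sigma :: "(real \<Rightarrow> 'a measure) \<Rightarrow> 'a set \<Rightarrow> (real \<times> 'a) measure" where
  "predictable_sigma F \<Omega> = sigma ({0..} \<times> \<Omega>)
     ({{0} \<times> A |A. A \<in> sets (F 0)} \<union> {{s<..t} \<times> A |s t A. 0 \<le> s \<and> s < t \<and> A \<in> sets (F s)})"

definition adapted :: "(real \<Rightarrow> 'a measure) \<Rightarrow> (real \<Rightarrow> 'a \<Rightarrow> real) \<Rightarrow> bool" where
  "adapted F X \<longleftrightarrow> (\<forall>t\<ge>0. X t \<in> borel_measurable (F t))"

definition continuous_paths :: "'a measure \<Rightarrow> (real \<Rightarrow> 'a \<Rightarrow> real) \<Rightarrow> bool" where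
  "continuous_paths M X \<longleftrightarrow> (AE \<omega> in M. continuous_on {0..} (\<lambda>t. X t \<omega>))"

definition martingale ::
  "'a measure \<Rightarrow> (real \<Rightarrow> 'a measure) \<Rightarrow> (real \<Rightarrow> 'a \<Rightarrow> real) \<Rightarrow> bool" where
  "martingale M F X \<longleftrightarrow> adapted F X \<and> (\<forall>t\<ge>0. integrable M (X t)) \<and>
     (\<forall>s t. 0 \<le> s \<and> s \<le> t \<longrightarrow> (AE \<omega> in M. real_cond_exp M (F s) (X t) \<omega> = X s \<omega>))"

definition L2_martingale ::
  "'a measure \<Rightarrow> (real \<Rightarrow> 'a measure) \<Rightarrow> (real \<Rightarrow> 'a \<Rightarrow> real) \<Rightarrow> bool" where
  "L2_martingale M F X \<longleftrightarrow> martingale M F X \<and> continuous_paths M X \<and>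
     (\<forall>t\<ge>0. integrable M (\<lambda>\<omega>. (X t \<omega>)\<^sup>2))"

definition variation_sums :: "(real \<Rightarrow> real) \<Rightarrow> real \<Rightarrow> real set" where
  "variation_sums q t = {(\<Sum>i<k. \<bar>q (r (Suc i)) - q (r i)\<bar>) | k (r :: nat \<Rightarrow> real).
     mono_on {..k} r \<and> r ` {..k} \<subseteq> {0..t}}"

definition locally_bounded_variation :: "(real \<Rightarrow> real) \<Rightarrow> bool" where
  "locally_bounded_variation q \<longleftrightarrow> (\<forall>t\<ge>0. bdd_above (variation_sums q t))"

text \<open>The measure \<open>dq\<close> of a continuous nondecreasing \<open>q\<close> on \<open>{0..}\<close>, with no mass on the negative
  half line; and the Lebesgue--Stieltjes integral against a continuous \<open>q\<close> of locally bounded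
  variation \<open>V\<close>, by the decomposition \<open>q = V - (V - q)\<close>.\<close>

definition stieltjes_measure :: "(real \<Rightarrow> real) \<Rightarrow> real measure" where
  "stieltjes_measure q = interval_measure (\<lambda>t. q (max 0 t))"

definition stieltjes_integral :: "(real \<Rightarrow> real) \<Rightarrow> (real \<Rightarrow> real) \<Rightarrow> real \<Rightarrow> real" where
  "stieltjes_integral g q t =
     (LINT r:{0..t}|stieltjes_measure (\<lambda>s. Sup (variation_sums q s)). g r) -
     (LINT r:{0..t}|stieltjes_measure (\<lambda>s. Sup (variation_sums q s) - q s). g r)"

text \<open>\<open>Q\<close> is (a version of) the quadratic covariation of the continuous square integrable
  martingales \<open>N\<^sub>1\<close> and \<open>N\<^sub>2\<close>.\<close>

definition quadratic_covariation ::
  "'a measure \<Rightarrow> (real \<Rightarrow> 'a measure) \<Rightarrow> (real \<Rightarrow> 'a \<Rightarrow> real) \<Rightarrow> (real \<Rightarrow> 'a \<Rightarrow> real) \<Rightarrow>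
   (real \<Rightarrow> 'a \<Rightarrow> real) \<Rightarrow> bool" where
  "quadratic_covariation M F N1 N2 Q \<longleftrightarrow>
     L2_martingale M F N1 \<and> L2_martingale M F N2 \<and>
     adapted F Q \<and> continuous_paths M Q \<and>
     (AE \<omega> in M. Q 0 \<omega> = 0 \<and> locally_bounded_variation (\<lambda>t. Q t \<omega>)) \<and>
     martingale M F (\<lambda>t \<omega>. N1 t \<omega> * N2 t \<omega> - Q t \<omega>)"

text \<open>Simple predictable processes \<open>\<Sum>i<k. \<xi>\<^sub>i 1\<close> on \<open>{r\<^sub>i<..r\<^sub>i\<^sub>+\<^sub>1}\<close>, encoded as \<open>(k, r, \<xi>)\<close>.\<close>

type_synonym 'a simple = "nat \<times> (nat \<Rightarrow> real) \<times> (nat \<Rightarrow> 'a \<Rightarrow> real)"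

definition simple_process :: "'a measure \<Rightarrow> (real \<Rightarrow> 'a measure) \<Rightarrow> 'a simple \<Rightarrow> bool" where
  "simple_process M F = (\<lambda>(k, r, \<xi>). mono_on {..k} r \<and> 0 \<le> r 0 \<and>
     (\<forall>i<k. \<xi> i \<in> borel_measurable (F (r i)) \<and> (\<exists>C. \<forall>\<omega>\<in>space M. \<bar>\<xi> i \<omega>\<bar> \<le> C)))"

definition simple_value :: "'a simple \<Rightarrow> real \<Rightarrow> 'a \<Rightarrow> real" where
  "simple_value = (\<lambda>(k, r, \<xi>) s \<omega>. \<Sum>i<k. \<xi> i \<omega> * indicator {r i<..r (Suc i)} s)"

definition simple_integral :: "'a simple \<Rightarrow> (real \<Rightarrow> 'a \<Rightarrow> real) \<Rightarrow> real \<Rightarrow> 'a \<Rightarrow> real" where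
  "simple_integral = (\<lambda>(k, r, \<xi>) N t \<omega>.
     \<Sum>i<k. \<xi> i \<omega> * (N (min (r (Suc i)) t) \<omega> - N (min (r i) t) \<omega>))"

text \<open>\<open>I\<close> is (a continuous version of) the Ito integral process \<open>\<integral>\<^sub>0\<^sup>t H dN\<close>, where \<open>Q\<close> is the quadratic
  variation of \<open>N\<close>: the \<open>L\<^sup>2\<close> limit of the integrals of simple processes which converge to \<open>H\<close> in
  \<open>L\<^sup>2(dQ \<otimes> dM)\<close> on every \<open>[0,t]\<close>. Two versions differ on a null set only.\<close>

definition ito_integral ::
  "'a measure \<Rightarrow> (real \<Rightarrow> 'a measure) \<Rightarrow> (real \<Rightarrow> 'a \<Rightarrow> real) \<Rightarrow> (real \<Rightarrow> 'a \<Rightarrow> real) \<Rightarrow>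
   (real \<Rightarrow> 'a \<Rightarrow> real) \<Rightarrow> (real \<Rightarrow> 'a \<Rightarrow> real) \<Rightarrow> bool" where
  "ito_integral M F N Q H I \<longleftrightarrow>
     quadratic_covariation M F N N Q \<and>
     (\<exists>H'. (\<lambda>(t, \<omega>). H' t \<omega>) \<in> borel_measurable (predictable_sigma F (space M)) \<and>
           (AE \<omega> in M. \<forall>t\<ge>0. H t \<omega> = H' t \<omega>)) \<and>
     (\<exists>h :: nat \<Rightarrow> 'a simple. (\<forall>m. simple_process M F (h m)) \<and>
        (\<forall>t\<ge>0.
          (\<lambda>m. \<integral>\<^sup>+\<omega>. (\<integral>\<^sup>+s\<in>{0..t}. ennreal ((simple_value (h m) s \<omega> - H s \<omega>)\<^sup>2)
                  \<partial>stieltjes_measure (\<lambda>r. Q r \<omega>)) \<partial>M) \<longlonglongrightarrow> 0 \<and>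
          (\<lambda>m. \<integral>\<^sup>+\<omega>. ennreal ((simple_integral (h m) N t \<omega> - I t \<omega>)\<^sup>2) \<partial>M) \<longlonglongrightarrow> 0)) \<and>
     adapted F I \<and> continuous_paths M I"

text \<open>Expectation with values in the extended reals: \<open>E[X\<^sup>+] - E[X\<^sup>-]\<close>.\<close>

definition expectation_ext :: "'a measure \<Rightarrow> ('a \<Rightarrow> real) \<Rightarrow> ereal" where
  "expectation_ext M X =
     enn2ereal (\<integral>\<^sup>+\<omega>. ennreal (X \<omega>) \<partial>M) - enn2ereal (\<integral>\<^sup>+\<omega>. ennreal (- X \<omega>) \<partial>M)"


section \<open>The canonical Wiener space\<close>

text \<open>A path maps a time \<open>t \<ge> 0\<close> to the Fourier coefficients of a distribution; the values at
  negative times are fixed by extensionality. The canonical process is \<open>X\<^sub>t(\<omega>) = \<omega> t\<close>, so its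
  \<open>n\<close>-th Fourier coefficient \<open>B\<^sup>n\<^sub>t\<close> is \<open>\<omega> t n\<close>.\<close>

type_synonym path = "real \<Rightarrow> distribution"

definition path_space :: "real \<Rightarrow> path set" where
  "path_space \<alpha> = {\<omega>. \<omega> \<in> extensional {0..} \<and> (\<forall>t\<ge>0. \<omega> t \<in> H_dot \<alpha>) \<and>
     (\<forall>t\<ge>0. ((\<lambda>s. sobolev_norm \<alpha> (\<lambda>n. \<omega> s n - \<omega> t n)) \<longlongrightarrow> 0) (at t within {0..}))}"

text \<open>Borel \<open>\<sigma>\<close>-algebra of the topology of locally uniform convergence.\<close>

definition path_borel :: "real \<Rightarrow> path measure" where
  "path_borel \<alpha> = sigma (path_space \<alpha>)
     {U. U \<subseteq> path_space \<alpha> \<and> (\<forall>\<omega>\<in>U. \<exists>T>0. \<exists>\<epsilon>>0. \<forall>\<eta>\<in>path_space \<alpha>.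
        (\<forall>t\<in>{0..T}. sobolev_norm \<alpha> (\<lambda>n. \<eta> t n - \<omega> t n) < \<epsilon>) \<longrightarrow> \<eta> \<in> U)}"

text \<open>Complex Brownian motion normalised by \<open>E|W\<^sub>t|\<^sup>2 = t\<close>: real and imaginary part of an increment
  are independent and each has half of the variance.\<close>

definition complex_brownian_motion :: "'a measure \<Rightarrow> (real \<Rightarrow> 'a \<Rightarrow> complex) \<Rightarrow> bool" where
  "complex_brownian_motion P W \<longleftrightarrow>
     (AE \<omega> in P. W 0 \<omega> = 0 \<and> continuous_on {0..} (\<lambda>t. W t \<omega>)) \<and>
     (\<forall>s t. 0 \<le> s \<and> s < t \<longrightarrow>
        distributed P lborel (\<lambda>\<omega>. Re (W t \<omega> - W s \<omega>)) (normal_density 0 (sqrt ((t - s) / 2))) \<and>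
        distributed P lborel (\<lambda>\<omega>. Im (W t \<omega> - W s \<omega>)) (normal_density 0 (sqrt ((t - s) / 2))) \<and>
        prob_space.indep_var P borel (\<lambda>\<omega>. Re (W t \<omega> - W s \<omega>)) borel (\<lambda>\<omega>. Im (W t \<omega> - W s \<omega>))) \<and>
     (\<forall>k (r :: nat \<Rightarrow> real). mono_on {..k} r \<and> 0 \<le> r 0 \<longrightarrow>
        prob_space.indep_vars P (\<lambda>_. borel) (\<lambda>i \<omega>. W (r (Suc i)) \<omega> - W (r i) \<omega>) {..<k})"

text \<open>The Wiener measure. Independence of \<open>B\<^sup>n\<close> and \<open>B\<^sup>m\<close> for \<open>m \<noteq> \<plusminus>n\<close> means mutual independence of
  every family of these processes that contains no two opposite modes; \<open>B\<^sup>-\<^sup>n = cnj B\<^sup>n\<close> is part of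
  \<open>path_space\<close>.\<close>

definition wiener_measure :: "real \<Rightarrow> path measure \<Rightarrow> bool" where
  "wiener_measure \<alpha> P \<longleftrightarrow> sets P = sets (path_borel \<alpha>) \<and> prob_space P \<and>
     (\<forall>n. n \<noteq> 0 \<longrightarrow> complex_brownian_motion P (\<lambda>t \<omega>. \<omega> t n)) \<and>
     (\<forall>S. 0 \<notin> S \<and> S \<inter> uminus ` S = {} \<longrightarrow>
        prob_space.indep_vars P (\<lambda>_. Pi\<^sub>M {0..} (\<lambda>_. borel)) (\<lambda>n \<omega>. \<lambda>t\<in>{0..}. \<omega> t n) S)"

text \<open>The filtration of the canonical process, completed by the null sets.\<close>

definition wiener_filtration :: "path measure \<Rightarrow> real \<Rightarrow> path measure" where
  "wiener_filtration P t = sigma (space P)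
     ({(\<lambda>\<omega>. \<omega> s n) -` A \<inter> space P |s n A. 0 \<le> s \<and> s \<le> t \<and> A \<in> sets borel}
      \<union> null_sets (completion P))"


section \<open>The Gaussian field, the drift and the renormalisation\<close>

text \<open>For fixed frequency \<open>\<zeta>\<^sub>t\<close> vanishes for all small \<open>t > 0\<close>; this is extended to \<open>t \<le> 0\<close>, where
  division by \<open>t\<close> is meaningless.\<close>

definition zeta_t :: "(real \<Rightarrow> real) \<Rightarrow> real \<Rightarrow> real^2 \<Rightarrow> real" where
  "zeta_t \<zeta> t \<xi> = (if t > 0 then \<zeta> (sqrt (1 + (norm \<xi>)\<^sup>2) / t) else 0)"

definition sigma_t :: "(real \<Rightarrow> real) \<Rightarrow> real \<Rightarrow> real^2 \<Rightarrow> real" where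
  "sigma_t \<zeta> t \<xi> = sqrt (deriv (\<lambda>s. (zeta_t \<zeta> s \<xi>)\<^sup>2) t)"

text \<open>Symbol of \<open>J\<^sub>t\<close>; its value at frequency \<open>0\<close> (here \<open>0\<close>) is never used on zero-mean functions.\<close>

definition J_symbol :: "(real \<Rightarrow> real) \<Rightarrow> real \<Rightarrow> real^2 \<Rightarrow> real" where
  "J_symbol \<zeta> t \<xi> = sigma_t \<zeta> t \<xi> / sqrt ((norm \<xi>)\<^sup>2 + norm \<xi> ^ 4)"

text \<open>\<open>W n\<close> is the Fourier coefficient \<open>\<integral>\<^sub>0\<^sup>t \<sigma>\<^sub>s(n) (|n|\<^sup>2 + |n|\<^sup>4)\<^sup>-\<^sup>1\<^sup>/\<^sup>2 dB\<^sup>n\<^sub>s\<close> of \<open>Y\<^sub>t\<close>, integrating against real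
  and imaginary part separately; both have quadratic variation \<open>t/2\<close>.\<close>

definition Y_coefficient ::
  "(real \<Rightarrow> real) \<Rightarrow> path measure \<Rightarrow> int^2 \<Rightarrow> (real \<Rightarrow> path \<Rightarrow> complex) \<Rightarrow> bool" where
  "Y_coefficient \<zeta> P n W \<longleftrightarrow>
     ito_integral (completion P) (wiener_filtration P) (\<lambda>t \<omega>. Re (\<omega> t n)) (\<lambda>t \<omega>. t / 2)
       (\<lambda>s \<omega>. J_symbol \<zeta> s (rvec n)) (\<lambda>t \<omega>. Re (W t \<omega>)) \<and>
     ito_integral (completion P) (wiener_filtration P) (\<lambda>t \<omega>. Im (\<omega> t n)) (\<lambda>t \<omega>. t / 2)
       (\<lambda>s \<omega>. J_symbol \<zeta> s (rvec n)) (\<lambda>t \<omega>. Im (W t \<omega>))"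

text \<open>\<open>Y\<^sub>t(\<omega>)\<close> as a function on the torus. The series is almost surely real, and a finite sum for
  each \<open>t\<close>.\<close>

definition Y_field :: "(int^2 \<Rightarrow> real \<Rightarrow> path \<Rightarrow> complex) \<Rightarrow> real \<Rightarrow> path \<Rightarrow> real^2 \<Rightarrow> real" where
  "Y_field W t \<omega> x = Re (\<Sum>\<^sub>\<infinity>n\<in>UNIV - {0}. W n t \<omega> * mode n x)"

definition dY :: "(int^2 \<Rightarrow> real \<Rightarrow> path \<Rightarrow> complex) \<Rightarrow> 2 \<Rightarrow> real^2 \<Rightarrow> real \<Rightarrow> path \<Rightarrow> real" where
  "dY W i x t \<omega> = grad (Y_field W t \<omega>) x $ i"

text \<open>The space of drifts: predictable, zero-mean \<open>L\<^sup>2\<close>-valued, with paths in \<open>L\<^sup>2([0,\<infinity>))\<close> a.s.\<close>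

definition drifts :: "path measure \<Rightarrow> (real \<Rightarrow> path \<Rightarrow> real^2 \<Rightarrow> real) set" where
  "drifts P = {u. (\<lambda>(t, \<omega>). u t \<omega>) \<in>
       predictable_sigma (wiener_filtration P) (space P) \<rightarrow>\<^sub>M L2_dot_borel \<and>
     (AE \<omega> in completion P. (\<integral>\<^sup>+t\<in>{0..}. ennreal ((l2_norm (u t \<omega>))\<^sup>2) \<partial>lborel) < \<infinity>)}"

text \<open>\<open>Z\<^sub>T(u)\<close>; the integrand has frequencies bounded in terms of \<open>T\<close> only, so the Bochner integral of
  functions is the pointwise one.\<close>

definition Z_shift ::
  "(real \<Rightarrow> real) \<Rightarrow> real \<Rightarrow> (real \<Rightarrow> path \<Rightarrow> real^2 \<Rightarrow> real) \<Rightarrow> path \<Rightarrow> real^2 \<Rightarrow> real" where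
  "Z_shift \<zeta> T u \<omega> x = (LINT t:{0..T}|lborel. fourier_multiplier (J_symbol \<zeta> t) (u t \<omega>) x)"

text \<open>Below \<open>q i j\<close> is the quadratic covariation of \<open>\<partial>\<^sub>iY\<close> and \<open>\<partial>\<^sub>jY\<close>, and \<open>y\<close>, \<open>z\<close> are the values of
  \<open>\<nabla>Y\<^sub>T\<close>, \<open>\<nabla>Z\<^sub>T(u)\<close> at a point. The iterated integrals in \<open>a\<^sub>T\<close> enter through paths \<open>S\<close>, \<open>K\<close>, \<open>R\<close>
  (characterised by \<open>iterated_integrals\<close>):
  \<open>S i j s = \<integral>\<^sub>0\<^sup>s \<partial>\<^sub>iY\<^sub>r d(\<partial>\<^sub>jY\<^sub>r)\<close>,
  \<open>K i j T = \<integral>\<^sub>0\<^sup>T \<integral>\<^sub>0\<^sup>s \<partial>\<^sub>iY\<^sub>r d(q j j)\<^sub>r d(\<partial>\<^sub>iY\<^sub>s)\<close> and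
  \<open>R i j T = \<integral>\<^sub>0\<^sup>T \<integral>\<^sub>0\<^sup>s (q j j)\<^sub>r d(\<partial>\<^sub>iY\<^sub>r) d(\<partial>\<^sub>iY\<^sub>s)\<close>, the inner integral of the last one being \<open>L i j s\<close>.\<close>

type_synonym paths2 = "2 \<Rightarrow> 2 \<Rightarrow> real \<Rightarrow> real"

definition iterated_integrals ::
  "path measure \<Rightarrow> (int^2 \<Rightarrow> real \<Rightarrow> path \<Rightarrow> complex) \<Rightarrow> paths2 \<Rightarrow>
   (path \<Rightarrow> real^2 \<Rightarrow> paths2) \<Rightarrow> (path \<Rightarrow> real^2 \<Rightarrow> paths2) \<Rightarrow>
   (path \<Rightarrow> real^2 \<Rightarrow> paths2) \<Rightarrow> (path \<Rightarrow> real^2 \<Rightarrow> paths2) \<Rightarrow> bool" where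
  "iterated_integrals P W q S K L R \<longleftrightarrow> (\<forall>x i j. i \<noteq> j \<longrightarrow>
     (let ito = ito_integral (completion P) (wiener_filtration P) in
        ito (dY W j x) (\<lambda>t \<omega>. q j j t) (dY W i x) (\<lambda>t \<omega>. S \<omega> x i j t) \<and>
        ito (dY W i x) (\<lambda>t \<omega>. q i i t)
          (\<lambda>s \<omega>. stieltjes_integral (\<lambda>r. dY W i x r \<omega>) (q j j) s) (\<lambda>t \<omega>. K \<omega> x i j t) \<and>
        ito (dY W i x) (\<lambda>t \<omega>. q i i t) (\<lambda>s \<omega>. q j j s) (\<lambda>t \<omega>. L \<omega> x i j t) \<and>
        ito (dY W i x) (\<lambda>t \<omega>. q i i t) (\<lambda>s \<omega>. L \<omega> x i j s) (\<lambda>t \<omega>. R \<omega> x i j t)))"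

text \<open>The integrals above are defined up to a null set for each \<open>x\<close>; integrating in \<open>x\<close> requires
  versions that are jointly measurable in \<open>x\<close> and \<open>\<omega>\<close>.\<close>

definition jointly_measurable :: "path measure \<Rightarrow> (path \<Rightarrow> real^2 \<Rightarrow> paths2) \<Rightarrow> bool" where
  "jointly_measurable P V \<longleftrightarrow> (\<forall>i j. i \<noteq> j \<longrightarrow> (\<forall>t\<ge>0.
     (\<lambda>(x, \<omega>). V \<omega> x i j t) \<in> borel_measurable (borel \<Otimes>\<^sub>M completion P)))"

definition a_T :: "paths2 \<Rightarrow> real \<Rightarrow> paths2 \<Rightarrow> paths2 \<Rightarrow> paths2 \<Rightarrow> real^2 \<Rightarrow> real" where
  "a_T q T S K R y =
     6 * q 1 1 T * (y $ 1)\<^sup>2 + 6 * q 2 2 T * (y $ 2)\<^sup>2 + 2 * q 2 2 T * (y $ 1)\<^sup>2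
     + 2 * q 1 1 T * (y $ 2)\<^sup>2 + 4 * (q 1 2 T)\<^sup>2 - 3 * (q 1 1 T)\<^sup>2 - 3 * (q 2 2 T)\<^sup>2
     - 2 * q 1 1 T * q 2 2 T
     + 8 * stieltjes_integral (S 1 2) (q 1 2) T + 8 * stieltjes_integral (S 2 1) (q 1 2) T
     + 8 * K 1 2 T + 8 * R 1 2 T
     + 8 * K 2 1 T + 8 * R 2 1 T"

definition b_T :: "paths2 \<Rightarrow> real \<Rightarrow> real^2 \<Rightarrow> real^2" where
  "b_T q T y = vector
     [3 * q 1 1 T * y $ 1 + 2 * q 1 2 T * y $ 2 + q 2 2 T * y $ 1,
      3 * q 2 2 T * y $ 2 + 2 * q 1 2 T * y $ 1 + q 1 1 T * y $ 2]"

definition c_T :: "paths2 \<Rightarrow> real \<Rightarrow> real^2 \<Rightarrow> real" where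
  "c_T q T z = 6 * q 1 1 T * (z $ 1)\<^sup>2 + 6 * q 2 2 T * (z $ 2)\<^sup>2 + 2 * q 1 1 T * (z $ 2)\<^sup>2
     + 2 * q 2 2 T * (z $ 1)\<^sup>2 + 8 * q 1 2 T * z $ 1 * z $ 2"

definition wick4 :: "paths2 \<Rightarrow> real \<Rightarrow> paths2 \<Rightarrow> paths2 \<Rightarrow> paths2 \<Rightarrow> real^2 \<Rightarrow> real" where
  "wick4 q T S K R y = even_pow y 4 - a_T q T S K R y"

definition wick3 :: "paths2 \<Rightarrow> real \<Rightarrow> real^2 \<Rightarrow> real^2" where
  "wick3 q T y = odd_pow y 3 - b_T q T y"

definition wick2 :: "paths2 \<Rightarrow> real \<Rightarrow> real^2 \<Rightarrow> 2 \<Rightarrow> 2 \<Rightarrow> real" where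
  "wick2 q T y i j = y $ i * y $ j - q i j T"

definition wick2_term :: "paths2 \<Rightarrow> real \<Rightarrow> real^2 \<Rightarrow> real^2 \<Rightarrow> real" where
  "wick2_term q T y z = (\<Sum>i\<in>{1,2}. \<Sum>j\<in>{1,2}. \<Sum>k\<in>{1,2}. \<Sum>l\<in>{1,2}.
     2 * (delta i k * delta j l + delta i l * delta j k + delta i j * delta k l)
       * wick2 q T y i j * z $ k * z $ l)"

text \<open>The functions \<open>Yf\<close> and \<open>Zf\<close> stand for \<open>Y\<^sub>T(\<omega>)\<close> and \<open>Z\<^sub>T(u)(\<omega>)\<close>.\<close>

definition renormalised_energy ::
  "paths2 \<Rightarrow> real \<Rightarrow> (real^2 \<Rightarrow> paths2) \<Rightarrow> (real^2 \<Rightarrow> paths2) \<Rightarrow> (real^2 \<Rightarrow> paths2) \<Rightarrow>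
   (real^2 \<Rightarrow> real) \<Rightarrow> (real^2 \<Rightarrow> real) \<Rightarrow> real" where
  "renormalised_energy q T S K R Yf Zf =
     (\<integral>x. norm (grad Yf x + grad Zf x) ^ 4 - c_T q T (grad Zf x)
          - 4 * (b_T q T (grad Yf x) \<bullet> grad Zf x)
          - a_T q T (S x) (K x) (R x) (grad Yf x) \<partial>torus)"

definition Phi_T :: "paths2 \<Rightarrow> real \<Rightarrow> (real^2 \<Rightarrow> real) \<Rightarrow> (real^2 \<Rightarrow> real) \<Rightarrow> real" where
  "Phi_T q T Yf Zf =
     (\<integral>x. 4 * (grad Yf x \<bullet> odd_pow (grad Zf x) 3)
          + 4 * (wick3 q T (grad Yf x) \<bullet> grad Zf x)
          + wick2_term q T (grad Yf x) (grad Zf x) \<partial>torus)"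

definition drift_cost :: "(real \<Rightarrow> path \<Rightarrow> real^2 \<Rightarrow> real) \<Rightarrow> path \<Rightarrow> real" where
  "drift_cost u \<omega> = 1/2 * (LINT s:{0..}|lborel. (l2_norm (u s \<omega>))\<^sup>2)"

definition F_T ::
  "(real \<Rightarrow> real) \<Rightarrow> path measure \<Rightarrow> (distribution \<Rightarrow> real) \<Rightarrow> (int^2 \<Rightarrow> real \<Rightarrow> path \<Rightarrow> complex) \<Rightarrow>
   paths2 \<Rightarrow> (path \<Rightarrow> real^2 \<Rightarrow> paths2) \<Rightarrow> (path \<Rightarrow> real^2 \<Rightarrow> paths2) \<Rightarrow>
   (path \<Rightarrow> real^2 \<Rightarrow> paths2) \<Rightarrow> real \<Rightarrow> (real \<Rightarrow> path \<Rightarrow> real^2 \<Rightarrow> real) \<Rightarrow> ereal" where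
  "F_T \<zeta> P f W q S K R T u = expectation_ext (completion P) (\<lambda>\<omega>.
     f (fourier_coeff (\<lambda>x. Y_field W T \<omega> x + Z_shift \<zeta> T u \<omega> x))
     + renormalised_energy q T (S \<omega>) (K \<omega>) (R \<omega>) (Y_field W T \<omega>) (Z_shift \<zeta> T u \<omega>)
     + drift_cost u \<omega>)"

end

theory Submission
  imports Defs
begin

text \<open>The first claim is the pointwise expansion of \<open>|y + z|\<^sup>4\<close>; it only needs that the covariation is
  symmetric. The two functionals then differ by the random variable \<open>\<integral>\<lbrakk>\<nabla>Y\<^sub>T\<^sup>4\<rbrakk> dx\<close>, which is integrable with
  mean zero. Indeed, \<open>\<lambda>\<cdot>\<nabla>Y\<^sub>t(x)\<close> is a centred Gaussian variable, being an \<open>L\<^sup>2\<close> limit of sums of independent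
  Gaussian increments, and the reflection \<open>(n\<^sub>1, n\<^sub>2) \<mapsto> (-n\<^sub>1, n\<^sub>2)\<close> of the frequencies shows that
  \<open>\<langle>\<partial>\<^sub>1Y, \<partial>\<^sub>2Y\<rangle>\<close> vanishes. Hence the fourth moment of \<open>\<nabla>Y\<^sub>T(x)\<close> is a polynomial in the two remaining
  covariations, while the iterated integrals in \<open>a\<^sub>T\<close> are zero or Ito integrals of mean zero, with second
  moments bounded uniformly in \<open>x\<close>, so that Fubini applies.

  The expectations are extended and neither side need be integrable. To subtract the mean-zero
  term one needs measurability of the rest: \<open>Y\<^sub>T\<close> and \<open>Z\<^sub>T(u)\<close> are trigonometric polynomials with
  frequencies bounded by \<open>T\<close>, so that \<open>f\<close> acts on finitely many measurable Fourier coefficients.\<close>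

section \<open>Square integrable functions\<close>

text \<open>The definition of an Ito integral provides only some approximating sequence of simple
  processes; their coefficients may be random, so their integrals need not be Gaussian. Gaussianity
  has to be read off from a chosen sequence, left-endpoint steps on uniform grids, and the link
  between the two is an estimate of the distance between a given Ito integral and the integral of an
  arbitrary simple process. It rests on the quadratic variations being deterministic,
  \<open>t / 2\<close> for the real and imaginary parts of the modes and \<open>q i i\<close> for
  the gradient: the measure dQ \<otimes> dM is then a product, and the second moments of weighted
  increments factorise. Squared norms are kept as extended nonnegative integrals, so that estimates
  can be stated before integrability is known. Their constants are not sharp, since only finiteness
  and uniformity in the point of the torus matter. No Ito formula is needed, because only the mean
  of the Wick power at the final time enters.\<close>

abbreviation msq :: "'a measure \<Rightarrow> ('a \<Rightarrow> real) \<Rightarrow> ennreal" where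
  "msq M f \<equiv> \<integral>\<^sup>+x. ennreal ((f x)\<^sup>2) \<partial>M"

definition sq_int :: "'a measure \<Rightarrow> ('a \<Rightarrow> real) \<Rightarrow> bool" where
  "sq_int M f \<longleftrightarrow> f \<in> borel_measurable M \<and> integrable M (\<lambda>x. (f x)\<^sup>2)"

lemma sq_intD:
  assumes "sq_int M f" shows "f \<in> borel_measurable M" "integrable M (\<lambda>x. (f x)\<^sup>2)"
  using assms by (auto simp: sq_int_def)

lemma sq_int_mult_integrable:
  assumes "sq_int M f" "sq_int M g" shows "integrable M (\<lambda>x. f x * g x)"
proof (rule Bochner_Integration.integrable_bound)
  show "integrable M (\<lambda>x. (f x)\<^sup>2 + (g x)\<^sup>2)"
    using assms by (auto simp: sq_int_def)
  show "(\<lambda>x. f x * g x) \<in> borel_measurable M"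
    using assms by (auto simp: sq_int_def)
  show "AE x in M. norm (f x * g x) \<le> norm ((f x)\<^sup>2 + (g x)\<^sup>2)"
  proof (rule AE_I2)
    fix x
    have "0 \<le> (\<bar>f x\<bar> - \<bar>g x\<bar>)\<^sup>2" "0 \<le> (f x)\<^sup>2" "0 \<le> (g x)\<^sup>2" by auto
    then have "2 * (\<bar>f x\<bar> * \<bar>g x\<bar>) \<le> (f x)\<^sup>2 + (g x)\<^sup>2" by (simp add: power2_diff)
    moreover have "0 \<le> \<bar>f x\<bar> * \<bar>g x\<bar>" by simp
    ultimately show "norm (f x * g x) \<le> norm ((f x)\<^sup>2 + (g x)\<^sup>2)"
      unfolding real_norm_def abs_mult by linarith
  qed
qed

lemma sq_int_add:
  assumes "sq_int M f" "sq_int M g" shows "sq_int M (\<lambda>x. f x + g x)"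
  using assms sq_int_mult_integrable[OF assms]
  by (auto simp: sq_int_def power2_sum mult.assoc)

lemma sq_int_cmult:
  assumes "sq_int M f" shows "sq_int M (\<lambda>x. c * f x)"
  using assms by (auto simp: sq_int_def power_mult_distrib)

lemma sq_int_diff:
  assumes "sq_int M f" "sq_int M g" shows "sq_int M (\<lambda>x. f x - g x)"
  using sq_int_add[OF assms(1) sq_int_cmult[OF assms(2), of "-1"]] by simp

lemma sq_int_sum:
  assumes "\<And>i. i \<in> I \<Longrightarrow> sq_int M (f i)" shows "sq_int M (\<lambda>x. \<Sum>i\<in>I. f i x)"
  using assms
proof (induction I rule: infinite_finite_induct)
  case (insert i I)
  then show ?case using sq_int_add[of M "f i" "\<lambda>x. \<Sum>i\<in>I. f i x"] by simp
qed (simp_all add: sq_int_def)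

lemma integral_double_sum:
  fixes f :: "'i \<Rightarrow> 'i \<Rightarrow> 'a \<Rightarrow> real"
  assumes "\<And>i j. i \<in> I \<Longrightarrow> j \<in> I \<Longrightarrow> integrable M (f i j)"
  shows "(\<integral>x. (\<Sum>i\<in>I. \<Sum>j\<in>I. f i j x) \<partial>M) = (\<Sum>i\<in>I. \<Sum>j\<in>I. \<integral>x. f i j x \<partial>M)"
  using assms by (simp add: Bochner_Integration.integral_sum)

lemma sq_int_bounded_mult:
  assumes "sq_int M f" "g \<in> borel_measurable M" "\<And>x. x \<in> space M \<Longrightarrow> \<bar>g x\<bar> \<le> C"
  shows "sq_int M (\<lambda>x. g x * f x)"
  unfolding sq_int_def
proof
  show m: "(\<lambda>x. g x * f x) \<in> borel_measurable M" using assms by (auto simp: sq_int_def)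
  show "integrable M (\<lambda>x. (g x * f x)\<^sup>2)"
  proof (rule Bochner_Integration.integrable_bound)
    show "integrable M (\<lambda>x. C\<^sup>2 * (f x)\<^sup>2)" using assms by (auto simp: sq_int_def)
    show "(\<lambda>x. (g x * f x)\<^sup>2) \<in> borel_measurable M" using m by simp
    show "AE x in M. norm ((g x * f x)\<^sup>2) \<le> norm (C\<^sup>2 * (f x)\<^sup>2)"
    proof (rule AE_I2)
      fix x assume "x \<in> space M"
      then have "(g x)\<^sup>2 \<le> C\<^sup>2" using assms(3) by (simp add: abs_le_square_iff[symmetric])
        (use assms(3) in fastforce)
      then show "norm ((g x * f x)\<^sup>2) \<le> norm (C\<^sup>2 * (f x)\<^sup>2)"
        by (simp add: power_mult_distrib mult_right_mono)
    qed
  qed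
qed

lemma (in finite_measure) sq_int_integrable:
  assumes "sq_int M f" shows "integrable M f"
  using sq_int_mult_integrable[OF assms, of "\<lambda>_. 1"] by (simp add: sq_int_def)

text \<open>Nonnegativity of the integral of \<open>(f x + r * g x)\<^sup>2\<close> for every real
  \<open>r\<close>: this quadratic in \<open>r\<close> is evaluated at its minimiser, and if its
  leading coefficient vanishes, its linear coefficient must vanish too.\<close>

lemma Cauchy_Schwarz_integral:
  assumes "sq_int M f" "sq_int M g"
  shows "(\<integral>x. f x * g x \<partial>M)\<^sup>2 \<le> (\<integral>x. (f x)\<^sup>2 \<partial>M) * (\<integral>x. (g x)\<^sup>2 \<partial>M)"
proof -
  let ?a = "\<integral>x. (f x)\<^sup>2 \<partial>M" and ?b = "\<integral>x. f x * g x \<partial>M" and ?c = "\<integral>x. (g x)\<^sup>2 \<partial>M"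
  note [simp] = sq_intD[OF assms(1)] sq_intD[OF assms(2)] sq_int_mult_integrable[OF assms]
  have a: "0 \<le> ?a" and c: "0 \<le> ?c" by auto
  have q: "0 \<le> ?a + 2 * r * ?b + r\<^sup>2 * ?c" for r
  proof -
    have "0 \<le> (\<integral>x. (f x + r * g x)\<^sup>2 \<partial>M)" by auto
    also have "\<dots> = (\<integral>x. (f x)\<^sup>2 + (2 * r) * (f x * g x) + r\<^sup>2 * (g x)\<^sup>2 \<partial>M)"
      by (intro Bochner_Integration.integral_cong) (auto simp: power2_eq_square algebra_simps)
    also have "\<dots> = ?a + 2 * r * ?b + r\<^sup>2 * ?c" by simp
    finally show ?thesis .
  qed
  show ?thesis
  proof (cases "?c = 0")
    case True
    have "?b = 0"
    proof (rule ccontr)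
      assume b: "?b \<noteq> 0"
      \<comment> \<open>This \<open>r\<close> would give the affine function
        \<open>?a + 2 * r * ?b\<close> the value -1.\<close>
      have "0 \<le> ?a + 2 * (- (?a + 1) / (2 * ?b)) * ?b" using q[of "- (?a + 1) / (2 * ?b)"] True by simp
      also have "2 * (- (?a + 1) / (2 * ?b)) * ?b = - (?a + 1)" using b by simp
      finally show False by simp
    qed
    then show ?thesis using True by simp
  next
    case False
    then have "0 < ?c" using c by linarith
    then show ?thesis using q[of "- ?b / ?c"]
      by (simp add: field_simps power2_eq_square)
  qed
qed

text \<open>The factors 2 stem from \<open>(a + b)\<^sup>2 \<le> 2 a\<^sup>2 + 2 b\<^sup>2\<close>, which replaces Minkowski's inequality.\<close>

lemma nn_sq_triangle:
  assumes [measurable]: "f \<in> borel_measurable A" "g \<in> borel_measurable A"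
  shows "(\<integral>\<^sup>+x. ennreal ((f x + g x)\<^sup>2) \<partial>A) \<le> 2 * (\<integral>\<^sup>+x. ennreal ((f x)\<^sup>2) \<partial>A) + 2 * (\<integral>\<^sup>+x. ennreal ((g x)\<^sup>2) \<partial>A)"
proof -
  have "(\<integral>\<^sup>+x. ennreal ((f x + g x)\<^sup>2) \<partial>A) \<le> (\<integral>\<^sup>+x. 2 * ennreal ((f x)\<^sup>2) + 2 * ennreal ((g x)\<^sup>2) \<partial>A)"
  proof (rule nn_integral_mono)
    fix x
    have "(f x + g x)\<^sup>2 \<le> 2 * (f x)\<^sup>2 + 2 * (g x)\<^sup>2"
      using zero_le_power2[of "f x - g x"] by (simp add: power2_eq_square algebra_simps)
    then have "ennreal ((f x + g x)\<^sup>2) \<le> ennreal (2 * (f x)\<^sup>2 + 2 * (g x)\<^sup>2)" by (rule ennreal_leI)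
    then show "ennreal ((f x + g x)\<^sup>2) \<le> 2 * ennreal ((f x)\<^sup>2) + 2 * ennreal ((g x)\<^sup>2)"
      by (simp add: ennreal_plus ennreal_mult)
  qed
  then show ?thesis by (simp add: nn_integral_add nn_integral_cmult)
qed

section \<open>Ito integrals of martingales with deterministic quadratic variation\<close>

locale filtered_prob_space = prob_space M for M :: "'a measure" +
  fixes F :: "real \<Rightarrow> 'a measure"
  assumes subalg: "0 \<le> t \<Longrightarrow> subalgebra M (F t)"
    and filt_mono: "0 \<le> s \<Longrightarrow> s \<le> t \<Longrightarrow> subalgebra (F t) (F s)"
begin

lemma F_measurable_mono: "0 \<le> s \<Longrightarrow> s \<le> t \<Longrightarrow> f \<in> borel_measurable (F s) \<Longrightarrow> f \<in> borel_measurable (F t)"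
  using measurable_from_subalg[OF filt_mono] by blast

lemma F_measurable: "0 \<le> s \<Longrightarrow> f \<in> borel_measurable (F s) \<Longrightarrow> f \<in> borel_measurable M"
  using measurable_from_subalg[OF subalg] by blast

text \<open>Conditional expectations occur only here; from now on the martingale property is an
  identity of integrals against weights known at the earlier time.\<close>

lemma martingale_integral_mult:
  assumes "martingale M F X" "0 \<le> s" "s \<le> t" "A \<in> borel_measurable (F s)"
    "integrable M (\<lambda>x. A x * X t x)"
  shows "(\<integral>x. A x * X t x \<partial>M) = (\<integral>x. A x * X s x \<partial>M)"
proof -
  interpret finite_measure_subalgebra M "F s"
    using subalg assms(2) by unfold_locales auto
  have "(\<integral>x. A x * X t x \<partial>M) = (\<integral>x. A x * real_cond_exp M (F s) (X t) x \<partial>M)"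
    using assms by (intro real_cond_exp_intg(2)[symmetric])
      (auto simp: martingale_def intro: borel_measurable_integrable)
  also have "\<dots> = (\<integral>x. A x * X s x \<partial>M)"
  proof (rule integral_cong_AE)
    have X: "X s \<in> borel_measurable M"
      using assms(1,2) by (auto simp: martingale_def)
    have A: "A \<in> borel_measurable M" using F_measurable assms(2,4) by blast
    show "(\<lambda>x. A x * real_cond_exp M (F s) (X t) x) \<in> borel_measurable M" using A by auto
    show "(\<lambda>x. A x * X s x) \<in> borel_measurable M" using A X by auto
    show "AE x in M. A x * real_cond_exp M (F s) (X t) x = A x * X s x"
    proof -
      have "AE x in M. real_cond_exp M (F s) (X t) x = X s x"
        using assms(1,2,3) by (auto simp: martingale_def)
      then show ?thesis by eventually_elim simp
    qed
  qed
  finally show ?thesis .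
qed

lemma L2_martingale_sq_int: "L2_martingale M F N \<Longrightarrow> 0 \<le> t \<Longrightarrow> sq_int M (N t)"
  by (auto simp: L2_martingale_def martingale_def sq_int_def)

text \<open>Square integrability of the weight suffices, so \<open>A\<close> may itself contain
  earlier increments of the martingale.\<close>

lemma L2_martingale_orth:
  assumes "L2_martingale M F N" "0 \<le> s" "s \<le> t" "A \<in> borel_measurable (F s)" "sq_int M A"
  shows "(\<integral>x. A x * (N t x - N s x) \<partial>M) = 0"
proof -
  have "integrable M (\<lambda>x. A x * N t x)" "integrable M (\<lambda>x. A x * N s x)"
    using L2_martingale_sq_int[OF assms(1)] assms by (auto intro!: sq_int_mult_integrable)
  then show ?thesis
    using martingale_integral_mult[of N s t A] assms
    by (simp add: right_diff_distrib L2_martingale_def)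
qed

text \<open>The generators of the predictable sets are rectangles with measurable sides, so
  predictability implies joint measurability. Extension by 0 to negative times makes Fubini
  available with measures on the whole line.\<close>

lemma predictable_joint:
  fixes G :: "real \<times> 'a \<Rightarrow> 'b::{topological_space, zero}"
  assumes "G \<in> borel_measurable (predictable_sigma F (space M))"
  shows "(\<lambda>x. if x \<in> {0..} \<times> space M then G x else 0) \<in> borel_measurable (borel \<Otimes>\<^sub>M M)"
proof -
  let ?R = "restrict_space (borel \<Otimes>\<^sub>M M) ({0..} \<times> space M)"
  have sF: "sets (F s) \<subseteq> sets M" if "0 \<le> s" for s using subalg[OF that] by (auto simp: subalgebra_def)
  have S: "({0..} :: real set) \<times> space M \<in> sets (borel \<Otimes>\<^sub>M M)" by (rule pair_measureI) auto
  let ?G = "{{0::real} \<times> A |A. A \<in> sets (F 0)} \<union> {{s<..t} \<times> A |s t A. 0 \<le> s \<and> s < t \<and> A \<in> sets (F s)}"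
  have gen: "y \<in> sets (borel \<Otimes>\<^sub>M M) \<and> y \<subseteq> {0..} \<times> space M" if "y \<in> ?G" for y
  proof -
    have "\<exists>B A. y = B \<times> A \<and> B \<in> sets borel \<and> B \<subseteq> {0..} \<and> A \<in> sets M"
      using that
    proof (elim UnE CollectE exE conjE)
      fix A assume "y = {0} \<times> A" "A \<in> sets (F 0)"
      then show ?thesis using sF[of 0] by (intro exI[of _ "{0}"] exI[of _ A]) auto
    next
      fix s t A assume "y = {s<..t} \<times> A" "0 \<le> s" "A \<in> sets (F s)"
      then show ?thesis using sF[of s] by (intro exI[of _ "{s<..t}"] exI[of _ A]) auto
    qed
    then obtain B A where y: "y = B \<times> A" "B \<in> sets borel" "B \<subseteq> {0..}" "A \<in> sets M" by blast
    show ?thesis unfolding y(1)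
      using y(2-) sets.sets_into_space[OF y(4)] by (intro conjI pair_measureI Sigma_mono) auto
  qed
  have "(\<lambda>x. x) \<in> measurable ?R (predictable_sigma F (space M))"
    unfolding predictable_sigma_def
  proof (rule measurable_measure_of)
    show "?G \<subseteq> Pow ({0..} \<times> space M)" using gen by (meson PowI subsetI)
    show "(\<lambda>x. x) \<in> space ?R \<rightarrow> {0..} \<times> space M" by (auto simp: space_restrict_space)
    fix y assume "y \<in> ?G"
    then have "y \<in> sets (borel \<Otimes>\<^sub>M M) \<and> y \<subseteq> {0..} \<times> space M" by (rule gen)
    moreover from this have "(\<lambda>x. x) -` y \<inter> space ?R = y"
      by (auto simp: space_restrict_space space_pair_measure)
    ultimately show "(\<lambda>x. x) -` y \<inter> space ?R \<in> sets ?R"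
      using S sets_restrict_space_iff[of "{0..} \<times> space M" "borel \<Otimes>\<^sub>M M" y]
      by (simp add: sets.Int)
  qed
  from measurable_compose[OF this assms] have "G \<in> borel_measurable ?R" .
  moreover have "({0..} :: real set) \<times> space M \<inter> space (borel \<Otimes>\<^sub>M M) \<in> sets (borel \<Otimes>\<^sub>M M)"
    using S by (rule sets.Int) simp
  ultimately show ?thesis by (subst (asm) measurable_restrict_space_iff[where c=0]) simp_all
qed

end

text \<open>\<open>Q\<close> does not depend on the path: its Stieltjes measure is a fixed measure
  on the line, and its product with \<open>M\<close> can be treated by Fubini.\<close>

locale martingale_det_qv = filtered_prob_space M F for M :: "'a measure" and F +
  fixes N :: "real \<Rightarrow> 'a \<Rightarrow> real" and Q :: "real \<Rightarrow> real"
  assumes qv: "quadratic_covariation M F N N (\<lambda>t x. Q t)"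
begin

section \<open>Moments of increments and the measure of the quadratic variation\<close>

lemma L2m: "L2_martingale M F N" using qv by (simp add: quadratic_covariation_def)

lemma N_sq_int: "0 \<le> t \<Longrightarrow> sq_int M (N t)" by (rule L2_martingale_sq_int[OF L2m])

lemma N_adapted: "0 \<le> s \<Longrightarrow> s \<le> t \<Longrightarrow> N s \<in> borel_measurable (F t)"
  using L2m F_measurable_mono by (auto simp: L2_martingale_def martingale_def adapted_def)

lemma incr_sq_int: "0 \<le> s \<Longrightarrow> 0 \<le> t \<Longrightarrow> sq_int M (\<lambda>x. N t x - N s x)"
  by (intro sq_int_diff N_sq_int) auto

lemma Q_cont: "continuous_on {0..} Q"
  using qv by (auto simp: quadratic_covariation_def continuous_paths_def)

lemma Q_0: "Q 0 = 0"
  using qv by (auto simp: quadratic_covariation_def)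

text \<open>After expanding the square, the cross term is removed by orthogonality of the increment
  to \<open>A x * N s x\<close>, and the martingale property of \<open>N\<^sup>2 - Q\<close> gives
  the rest. The weight factors out because \<open>Q\<close> is deterministic.\<close>

lemma incr_second_moment:
  assumes "0 \<le> s" "s \<le> t" "A \<in> borel_measurable (F s)" "\<And>x. x \<in> space M \<Longrightarrow> \<bar>A x\<bar> \<le> C"
  shows "(\<integral>x. A x * (N t x - N s x)\<^sup>2 \<partial>M) = (\<integral>x. A x \<partial>M) * (Q t - Q s)"
proof -
  have A[measurable]: "A \<in> borel_measurable M" using F_measurable assms by blast
  have sA: "sq_int M (\<lambda>x. A x * N r x)" if "0 \<le> r" for r
    using sq_int_bounded_mult[OF N_sq_int[OF that] A assms(4)] .
  have Ai: "integrable M A"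
    using assms(4) by (intro integrable_const_bound[where B=C]) auto
  have i2: "integrable M (\<lambda>x. A x * (N r x)\<^sup>2)" if "0 \<le> r" for r
    using sq_int_mult_integrable[OF sA[OF that] N_sq_int[OF that]] by (simp add: power2_eq_square mult.assoc)
  have i3: "integrable M (\<lambda>x. A x * N s x * N t x)"
    using sq_int_mult_integrable[OF sA N_sq_int] assms by auto
  have t: "0 \<le> t" using assms by simp
  have "martingale M F (\<lambda>t x. N t x * N t x - Q t)"
    using qv by (auto simp: quadratic_covariation_def)
  from martingale_integral_mult[OF this assms(1-3)]
  have m: "(\<integral>x. A x * (N t x)\<^sup>2 \<partial>M) - Q t * (\<integral>x. A x \<partial>M) = (\<integral>x. A x * (N s x)\<^sup>2 \<partial>M) - Q s * (\<integral>x. A x \<partial>M)"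
    using i2[OF t] i2[OF assms(1)] Ai
    by (simp add: power2_eq_square right_diff_distrib mult.commute[of _ "Q _"])
  have o: "(\<integral>x. (A x * N s x) * (N t x - N s x) \<partial>M) = 0"
    using assms sA by (intro L2_martingale_orth[OF L2m]) (auto intro!: borel_measurable_times N_adapted)
  then have o': "(\<integral>x. A x * N s x * N t x \<partial>M) = (\<integral>x. A x * (N s x)\<^sup>2 \<partial>M)"
    using i3 i2[OF assms(1)] by (simp add: right_diff_distrib power2_eq_square mult.assoc)
  have "(\<integral>x. A x * (N t x - N s x)\<^sup>2 \<partial>M)
     = (\<integral>x. A x * (N t x)\<^sup>2 - 2 * (A x * N s x * N t x) + A x * (N s x)\<^sup>2 \<partial>M)"
    by (intro Bochner_Integration.integral_cong) (auto simp: power2_eq_square algebra_simps)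
  also have "\<dots> = (\<integral>x. A x * (N t x)\<^sup>2 \<partial>M) - 2 * (\<integral>x. A x * (N s x)\<^sup>2 \<partial>M) + (\<integral>x. A x * (N s x)\<^sup>2 \<partial>M)"
    using i2[OF t] i2[OF assms(1)] i3 o' by simp
  also have "\<dots> = (\<integral>x. A x \<partial>M) * (Q t - Q s)" using m by (simp add: algebra_simps)
  finally show ?thesis .
qed

lemma Q_mono: "0 \<le> s \<Longrightarrow> s \<le> t \<Longrightarrow> Q s \<le> Q t"
proof -
  assume st: "0 \<le> s" "s \<le> t"
  have "0 \<le> (\<integral>x. 1 * (N t x - N s x)\<^sup>2 \<partial>M)" by simp
  also have "\<dots> = (\<integral>x. 1 \<partial>M) * (Q t - Q s)"
    by (rule incr_second_moment[OF st, where C=1]) auto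
  finally show ?thesis by (simp add: prob_space)
qed

lemma Q_nonneg: "0 \<le> t \<Longrightarrow> 0 \<le> Q t" using Q_mono[of 0 t] Q_0 by simp

text \<open>Only the overlap of the two time intervals contributes; \<open>max c (min b d)\<close>
  is its right end, or \<open>c\<close> if it is empty.\<close>

lemma cross_moment_le:
  assumes ab: "0 \<le> a" "a \<le> b" and cd: "c \<le> d" and ac: "a \<le> c"
    and \<xi>: "\<xi> \<in> borel_measurable (F a)" "\<And>x. x \<in> space M \<Longrightarrow> \<bar>\<xi> x\<bar> \<le> C"
    and \<eta>: "\<eta> \<in> borel_measurable (F c)" "\<And>x. x \<in> space M \<Longrightarrow> \<bar>\<eta> x\<bar> \<le> C'"
  shows "(\<integral>x. (\<xi> x * (N b x - N a x)) * (\<eta> x * (N d x - N c x)) \<partial>M)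
    = (\<integral>x. \<xi> x * \<eta> x \<partial>M) * (Q (max c (min b d)) - Q c)"
proof -
  have c0: "0 \<le> c" using ab ac by simp
  let ?p = "\<lambda>x. \<xi> x * \<eta> x"
  have pb: "\<bar>?p x\<bar> \<le> C * C'" if "x \<in> space M" for x
    unfolding abs_mult using \<xi>(2)[OF that] \<eta>(2)[OF that] by (intro mult_mono) auto
  have \<xi>c: "\<xi> \<in> borel_measurable (F c)" using F_measurable_mono ab ac \<xi> by blast
  have pc: "?p \<in> borel_measurable (F c)" using \<xi>c \<eta> by auto
  have pM: "?p \<in> borel_measurable M" using F_measurable c0 pc by blast
  have sp: "sq_int M (\<lambda>x. ?p x * (N t x - N s x))" if "0 \<le> s" "0 \<le> t" for s t
    using sq_int_bounded_mult[OF incr_sq_int[OF that] pM pb] .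
  have z: "(\<integral>x. (?p x * (N t x - N s x)) * (N t' x - N s' x) \<partial>M) = 0"
    if "0 \<le> s" "s \<le> t" "t \<le> s'" "s' \<le> t'" "c \<le> s'" for s t s' t'
  proof (rule L2_martingale_orth[OF L2m])
    show "(\<lambda>x. ?p x * (N t x - N s x)) \<in> borel_measurable (F s')"
      using that F_measurable_mono[OF c0 that(5) pc]
      by (auto intro!: borel_measurable_times borel_measurable_diff N_adapted)
  qed (use that sp in auto)
  have I: "integrable M (\<lambda>x. (?p x * (N t x - N s x)) * (N t' x - N s' x))"
    if "0 \<le> s" "0 \<le> t" "0 \<le> s'" "0 \<le> t'" for s t s' t'
    using sq_int_mult_integrable[OF sp incr_sq_int] that by auto
  have rw: "(\<integral>x. (\<xi> x * (N b x - N a x)) * (\<eta> x * (N d x - N c x)) \<partial>M)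
    = (\<integral>x. (?p x * (N b x - N a x)) * (N d x - N c x) \<partial>M)"
    by (intro Bochner_Integration.integral_cong) (auto simp: algebra_simps)
  show ?thesis
  proof (cases "b \<le> c")
    case True
    then show ?thesis using rw z[of a b c d] ab cd by (simp add: max_def min_def)
  next
    case False
    define e where "e = min b d"
    have e: "c \<le> e" "e \<le> b" "e \<le> d" using False cd by (auto simp: e_def)
    have z1: "(\<integral>x. (?p x * (N c x - N a x)) * (N d x - N c x) \<partial>M) = 0"
      using z[of a c c d] ab ac cd by simp
    have z2: "(\<integral>x. (?p x * (N e x - N c x)) * (N d x - N e x) \<partial>M) = 0"
      using z[of c e e d] c0 e by simp
    have z3: "(\<integral>x. (?p x * (N b x - N e x)) * (N d x - N c x) \<partial>M) = 0"
    proof -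
      have "(\<integral>x. (?p x * (N b x - N e x)) * (N d x - N c x) \<partial>M)
         = (\<integral>x. (?p x * (N d x - N c x)) * (N b x - N e x) \<partial>M)"
        by (intro Bochner_Integration.integral_cong) (auto simp: algebra_simps)
      also have "\<dots> = 0"
      proof (cases "b \<le> d")
        case True then show ?thesis by (simp add: e_def)
      next
        case F: False
        then have "e = d" by (simp add: e_def)
        then show ?thesis using z[of c d d b] c0 e F cd by simp
      qed
      finally show ?thesis .
    qed
    \<comment> \<open>Both intervals are cut at \<open>c\<close> and \<open>e\<close>. In the first
      three products one increment begins after everything else has ended, so they vanish by
      orthogonality.\<close>
    have "(\<integral>x. (?p x * (N b x - N a x)) * (N d x - N c x) \<partial>M)
      = (\<integral>x. (?p x * (N c x - N a x)) * (N d x - N c x)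
            + (?p x * (N b x - N e x)) * (N d x - N c x)
            + (?p x * (N e x - N c x)) * (N d x - N e x)
            + (?p x * (N e x - N c x)) * (N e x - N c x) \<partial>M)"
      by (intro Bochner_Integration.integral_cong) (auto simp: algebra_simps)
    also have "\<dots> = (\<integral>x. (?p x * (N e x - N c x)) * (N e x - N c x) \<partial>M)"
      using z1 z2 z3 I ab c0 e by (subst Bochner_Integration.integral_add | simp)+
    also have "\<dots> = (\<integral>x. ?p x * (N e x - N c x)\<^sup>2 \<partial>M)"
      by (simp add: power2_eq_square mult.assoc)
    also have "\<dots> = (\<integral>x. ?p x \<partial>M) * (Q e - Q c)"
      using incr_second_moment[OF c0 e(1) pc pb] .
    finally show ?thesis using rw e by (simp add: e_def[symmetric])
  qed
qed

lemma cross_moment: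
  assumes ab: "0 \<le> a" "a \<le> b" and cd: "0 \<le> c" "c \<le> d"
    and \<xi>: "\<xi> \<in> borel_measurable (F a)" "\<And>x. x \<in> space M \<Longrightarrow> \<bar>\<xi> x\<bar> \<le> C"
    and \<eta>: "\<eta> \<in> borel_measurable (F c)" "\<And>x. x \<in> space M \<Longrightarrow> \<bar>\<eta> x\<bar> \<le> C'"
  shows "(\<integral>x. (\<xi> x * (N b x - N a x)) * (\<eta> x * (N d x - N c x)) \<partial>M)
    = (\<integral>x. \<xi> x * \<eta> x \<partial>M) * (Q (max (max a c) (min b d)) - Q (max a c))"
proof (cases "a \<le> c")
  case True
  then show ?thesis using cross_moment_le[OF ab cd(2) True \<xi> \<eta>] by (simp add: max_absorb2)
next
  case False
  then have "c \<le> a" by simp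
  from cross_moment_le[OF cd ab(2) this \<eta> \<xi>] show ?thesis
    using \<open>c \<le> a\<close> by (simp add: max_absorb1 mult.commute min.commute)
qed

abbreviation \<mu> :: "real measure" where "\<mu> \<equiv> stieltjes_measure Q"

lemma sets_\<mu>[measurable_cong, simp]: "sets \<mu> = sets borel" by (simp add: stieltjes_measure_def)
lemma space_\<mu>[simp]: "space \<mu> = UNIV" by (simp add: stieltjes_measure_def)

lemma Qm_mono: "s \<le> t \<Longrightarrow> Q (max 0 s) \<le> Q (max 0 t)" by (rule Q_mono) auto

lemma Qm_cont: "continuous_on UNIV (\<lambda>t. Q (max 0 t))"
  by (rule continuous_on_compose2[OF Q_cont]) (auto intro!: continuous_intros)

lemma Qm_cont_right: "continuous (at_right a) (\<lambda>t. Q (max 0 t))"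
  using Qm_cont by (meson UNIV_I continuous_at_imp_continuous_at_within continuous_on_eq_continuous_at open_UNIV)

lemma emeasure_\<mu>_Ioc: "0 \<le> a \<Longrightarrow> a \<le> b \<Longrightarrow> emeasure \<mu> {a<..b} = ennreal (Q b - Q a)"
  unfolding stieltjes_measure_def
  by (subst emeasure_interval_measure_Ioc[OF _ Qm_mono Qm_cont_right]) auto

lemma measure_\<mu>_Ioc: "0 \<le> a \<Longrightarrow> a \<le> b \<Longrightarrow> measure \<mu> {a<..b} = Q b - Q a"
  using emeasure_\<mu>_Ioc[of a b] Q_mono[of a b] by (simp add: measure_def)

lemma sigma_finite_\<mu>: "sigma_finite_measure \<mu>"
  unfolding stieltjes_measure_def
  by (rule sigma_finite_interval_measure[OF Qm_mono Qm_cont_right])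

lemma emeasure_\<mu>_Icc: "0 \<le> t \<Longrightarrow> emeasure \<mu> {0..t} = ennreal (Q t)"
  unfolding stieltjes_measure_def
  by (subst emeasure_interval_measure_Icc[OF _ Qm_mono Qm_cont]) (auto simp: Q_0)

text \<open>The intervals need not be disjoint, so that the isometry applies to differences of simple
  processes.\<close>

lemma ito_isometry:
  assumes "finite I" and ab: "\<And>i. i \<in> I \<Longrightarrow> 0 \<le> a i" "\<And>i. i \<in> I \<Longrightarrow> a i \<le> b i"
    and \<xi>: "\<And>i. i \<in> I \<Longrightarrow> \<xi> i \<in> borel_measurable (F (a i))"
       "\<And>i x. i \<in> I \<Longrightarrow> x \<in> space M \<Longrightarrow> \<bar>\<xi> i x\<bar> \<le> C i"
  shows "msq M (\<lambda>x. \<Sum>i\<in>I. \<xi> i x * (N (b i) x - N (a i) x))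
    = (\<integral>\<^sup>+x. (\<integral>\<^sup>+s. ennreal ((\<Sum>i\<in>I. \<xi> i x * indicator {a i<..b i} s)\<^sup>2) \<partial>\<mu>) \<partial>M)"
proof -
  \<comment> \<open>The dQ-mass of the overlap of the two intervals. Both sides of the isometry
    expand to the same double sum of the means of
    \<open>\<xi> i x * \<xi> j x * v i j\<close>.\<close>
  define v where "v i j = Q (max (max (a i) (a j)) (min (b i) (b j))) - Q (max (a i) (a j))" for i j
  have \<xi>M: "\<xi> i \<in> borel_measurable M" if "i \<in> I" for i using F_measurable ab \<xi> that by blast
  have si: "sq_int M (\<lambda>x. \<xi> i x * (N (b i) x - N (a i) x))" if "i \<in> I" for i
    using that ab[OF that] by (intro sq_int_bounded_mult[OF incr_sq_int \<xi>M \<xi>(2)]) auto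
  have s1: "sq_int M (\<xi> i)" if "i \<in> I" for i
    using sq_int_bounded_mult[OF _ \<xi>M[OF that] \<xi>(2)[OF that], of "\<lambda>_. 1"] by (simp add: sq_int_def)
  have ij: "integrable M (\<lambda>x. \<xi> i x * \<xi> j x * v i j)" if "i \<in> I" "j \<in> I" for i j
    using sq_int_mult_integrable[OF s1[OF that(1)] s1[OF that(2)]] by simp
  have inner: "(\<integral>\<^sup>+s. ennreal ((\<Sum>i\<in>I. \<xi> i x * indicator {a i<..b i} s)\<^sup>2) \<partial>\<mu>)
      = ennreal (\<Sum>i\<in>I. \<Sum>j\<in>I. \<xi> i x * \<xi> j x * v i j)"
    and inner_nn: "0 \<le> (\<Sum>i\<in>I. \<Sum>j\<in>I. \<xi> i x * \<xi> j x * v i j)" for x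
  proof -
    let ?A = "\<lambda>i j. {max (a i) (a j)<..max (max (a i) (a j)) (min (b i) (b j))}"
    have e: "(\<Sum>i\<in>I. \<xi> i x * indicator {a i<..b i} s)\<^sup>2
      = (\<Sum>i\<in>I. \<Sum>j\<in>I. \<xi> i x * \<xi> j x * indicator (?A i j) s)" for s :: real
      unfolding power2_eq_square sum_product
      by (intro sum.cong refl) (auto simp: indicator_def)
    have f: "integrable \<mu> (\<lambda>s. \<xi> i x * \<xi> j x * indicator (?A i j) s :: real)"
      and g: "(\<integral>s. \<xi> i x * \<xi> j x * indicator (?A i j) s \<partial>\<mu>) = \<xi> i x * \<xi> j x * v i j"
      if "i \<in> I" "j \<in> I" for i j
    proof -
      have le: "0 \<le> max (a i) (a j)" "max (a i) (a j) \<le> max (max (a i) (a j)) (min (b i) (b j))"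
        using ab that by (auto simp: le_max_iff_disj)
      then have "emeasure \<mu> (?A i j) < \<infinity>" by (subst emeasure_\<mu>_Ioc) auto
      then show "integrable \<mu> (\<lambda>s. \<xi> i x * \<xi> j x * indicator (?A i j) s :: real)"
        by (intro integrable_mult_right integrable_real_indicator) auto
      show "(\<integral>s. \<xi> i x * \<xi> j x * indicator (?A i j) s \<partial>\<mu>) = \<xi> i x * \<xi> j x * v i j"
        using measure_\<mu>_Ioc[OF le] by (simp add: v_def)
    qed
    have h: "integrable \<mu> (\<lambda>s. (\<Sum>i\<in>I. \<xi> i x * indicator {a i<..b i} s)\<^sup>2)"
      unfolding e by (intro Bochner_Integration.integrable_sum f)
    have k: "(\<integral>s. (\<Sum>i\<in>I. \<xi> i x * indicator {a i<..b i} s)\<^sup>2 \<partial>\<mu>) = (\<Sum>i\<in>I. \<Sum>j\<in>I. \<xi> i x * \<xi> j x * v i j)"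
      unfolding e
      by (subst Bochner_Integration.integral_sum, (intro Bochner_Integration.integrable_sum f; assumption),
         intro sum.cong refl, subst Bochner_Integration.integral_sum, intro f, assumption+, intro sum.cong refl g, assumption+)
    show "(\<integral>\<^sup>+s. ennreal ((\<Sum>i\<in>I. \<xi> i x * indicator {a i<..b i} s)\<^sup>2) \<partial>\<mu>)
      = ennreal (\<Sum>i\<in>I. \<Sum>j\<in>I. \<xi> i x * \<xi> j x * v i j)"
      using nn_integral_eq_integral[OF h] k by simp
    show "0 \<le> (\<Sum>i\<in>I. \<Sum>j\<in>I. \<xi> i x * \<xi> j x * v i j)"
      unfolding k[symmetric] by (intro integral_nonneg_AE) auto
  qed
  have "msq M (\<lambda>x. \<Sum>i\<in>I. \<xi> i x * (N (b i) x - N (a i) x))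
     = ennreal (\<integral>x. (\<Sum>i\<in>I. \<xi> i x * (N (b i) x - N (a i) x))\<^sup>2 \<partial>M)"
    using sq_int_sum[of I M "\<lambda>i x. \<xi> i x * (N (b i) x - N (a i) x)"] si
    by (intro nn_integral_eq_integral) (auto simp: sq_int_def)
  also have "(\<integral>x. (\<Sum>i\<in>I. \<xi> i x * (N (b i) x - N (a i) x))\<^sup>2 \<partial>M)
     = (\<Sum>i\<in>I. \<Sum>j\<in>I. (\<integral>x. (\<xi> i x * (N (b i) x - N (a i) x)) * (\<xi> j x * (N (b j) x - N (a j) x)) \<partial>M))"
    unfolding power2_eq_square sum_product
    by (rule integral_double_sum) (intro sq_int_mult_integrable si)
  also have "\<dots> = (\<Sum>i\<in>I. \<Sum>j\<in>I. (\<integral>x. \<xi> i x * \<xi> j x * v i j \<partial>M))"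
    by (intro sum.cong refl, subst cross_moment[OF ab ab \<xi> \<xi>]) (auto simp: v_def)
  also have "\<dots> = (\<integral>x. (\<Sum>i\<in>I. \<Sum>j\<in>I. \<xi> i x * \<xi> j x * v i j) \<partial>M)"
    using ij by (rule integral_double_sum[symmetric])
  also have "ennreal \<dots> = (\<integral>\<^sup>+x. ennreal (\<Sum>i\<in>I. \<Sum>j\<in>I. \<xi> i x * \<xi> j x * v i j) \<partial>M)"
    using ij inner_nn by (intro nn_integral_eq_integral[symmetric] Bochner_Integration.integrable_sum) auto
  finally show ?thesis by (simp add: inner)
qed

section \<open>Integrals of simple processes\<close>

lemma simple_processD:
  assumes "simple_process M F (k, r, \<xi>)"
  shows "i \<le> k \<Longrightarrow> 0 \<le> r i" "i < k \<Longrightarrow> r i \<le> r (Suc i)"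
    "i < k \<Longrightarrow> \<xi> i \<in> borel_measurable (F (r i))"
    "i < k \<Longrightarrow> \<exists>C. \<forall>x\<in>space M. \<bar>\<xi> i x\<bar> \<le> C"
    "i < k \<Longrightarrow> \<xi> i \<in> borel_measurable M"
proof -
  have m: "r i \<le> r j" if "i \<le> j" "j \<le> k" for i j
    using assms that by (auto simp: simple_process_def mono_on_def)
  have 0: "0 \<le> r 0" using assms by (simp add: simple_process_def)
  show 1: "0 \<le> r i" if "i \<le> k" for i using m[of 0 i] 0 that by simp
  show "r i \<le> r (Suc i)" if "i < k" using m that by simp
  show 2: "\<xi> i \<in> borel_measurable (F (r i))" if "i < k" using assms that by (simp add: simple_process_def)
  show "\<exists>C. \<forall>x\<in>space M. \<bar>\<xi> i x\<bar> \<le> C" if "i < k" using assms that by (simp add: simple_process_def)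
  show "\<xi> i \<in> borel_measurable M" if "i < k" using F_measurable[OF 1 2] that by simp
qed

abbreviation msq2 :: "real \<Rightarrow> (real \<Rightarrow> 'a \<Rightarrow> real) \<Rightarrow> ennreal" where
  "msq2 t f \<equiv> \<integral>\<^sup>+x. (\<integral>\<^sup>+s\<in>{0..t}. ennreal ((f s x)\<^sup>2) \<partial>\<mu>) \<partial>M"

text \<open>The disjoint union of the two index sets turns the difference into one sum over possibly
  overlapping intervals, so no common refinement of the partitions has to be formed.\<close>

lemma simple_diff_isometry:
  assumes g: "simple_process M F g" and h: "simple_process M F h" and t: "0 \<le> t"
  shows "msq M (\<lambda>x. simple_integral g N t x - simple_integral h N t x)
    = msq2 t (\<lambda>s x. simple_value g s x - simple_value h s x)"
proof -
  obtain k r \<xi> where ge: "g = (k, r, \<xi>)" by (cases g)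
  obtain k' r' \<xi>' where he: "h = (k', r', \<xi>')" by (cases h)
  note r = simple_processD(1)[OF g[unfolded ge]] and r' = simple_processD(1)[OF h[unfolded he]]
  note rS = simple_processD(2)[OF g[unfolded ge]] and rS' = simple_processD(2)[OF h[unfolded he]]
  have "\<forall>i. \<exists>C. i < k \<longrightarrow> (\<forall>x\<in>space M. \<bar>\<xi> i x\<bar> \<le> C)"
    using g unfolding ge simple_process_def by auto
  then obtain C where C: "\<And>i x. i < k \<Longrightarrow> x \<in> space M \<Longrightarrow> \<bar>\<xi> i x\<bar> \<le> C i" by metis
  have "\<forall>i. \<exists>C. i < k' \<longrightarrow> (\<forall>x\<in>space M. \<bar>\<xi>' i x\<bar> \<le> C)"
    using h unfolding he simple_process_def by auto
  then obtain C' where C': "\<And>i x. i < k' \<Longrightarrow> x \<in> space M \<Longrightarrow> \<bar>\<xi>' i x\<bar> \<le> C' i" by metis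
  have m: "\<xi> i \<in> borel_measurable (F (r i))" if "i < k" for i
    using g that unfolding ge simple_process_def by auto
  have m': "\<xi>' i \<in> borel_measurable (F (r' i))" if "i < k'" for i
    using h that unfolding he simple_process_def by auto
  define I where "I = {..<k} <+> {..<k'}"
  define a where "a = case_sum (\<lambda>i. min (r i) t) (\<lambda>i. min (r' i) t)"
  define b where "b = case_sum (\<lambda>i. min (r (Suc i)) t) (\<lambda>i. min (r' (Suc i)) t)"
  \<comment> \<open>If \<open>r i > t\<close>, the interval cut at \<open>t\<close> is empty and
    starts at \<open>t\<close>, when \<open>\<xi> i\<close> need not be known yet; the coefficient 0
    restores adaptedness without changing the sum.\<close>
  define c where "c = case_sum (\<lambda>i x. if r i \<le> t then \<xi> i x else 0)
     (\<lambda>i x. - (if r' i \<le> t then \<xi>' i x else 0))"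
  have iso: "msq M (\<lambda>x. \<Sum>i\<in>I. c i x * (N (b i) x - N (a i) x))
    = (\<integral>\<^sup>+x. (\<integral>\<^sup>+s. ennreal ((\<Sum>i\<in>I. c i x * indicator {a i<..b i} s)\<^sup>2) \<partial>\<mu>) \<partial>M)"
  proof (rule ito_isometry)
    show "finite I" by (auto simp: I_def)
    show "0 \<le> a i" if "i \<in> I" for i using that t r r' by (auto simp: I_def a_def)
    show "a i \<le> b i" if "i \<in> I" for i using that rS rS' by (auto simp: I_def a_def b_def min_le_iff_disj)
    show "c i \<in> borel_measurable (F (a i))" if "i \<in> I" for i
      using that m m' by (auto simp: I_def a_def c_def min_def)
    show "\<bar>c i x\<bar> \<le> case_sum (\<lambda>i. \<bar>C i\<bar>) (\<lambda>i. \<bar>C' i\<bar>) i" if "i \<in> I" "x \<in> space M" for i x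
      using that C C' by (fastforce simp: I_def c_def intro: order_trans[OF _ abs_ge_self])
  qed
  have sI: "(\<Sum>i\<in>I. f i) = (\<Sum>i<k. f (Inl i)) + (\<Sum>i<k'. f (Inr i))" for f :: "_ \<Rightarrow> real"
    unfolding I_def by (simp add: sum.Plus)
  have e1: "(\<Sum>i\<in>I. c i x * (N (b i) x - N (a i) x)) = simple_integral g N t x - simple_integral h N t x" for x
    unfolding sI ge he simple_integral_def prod.case
    unfolding diff_conv_add_uminus[of "sum _ _"] sum_negf[symmetric]
    using rS rS' by (intro arg_cong2[where f="(+)"] sum.cong refl) (force simp: c_def a_def b_def min_def)+
  have ind: "indicator {min p t<..min p' t} s = (indicator {p<..p'} s * indicator {0..t} s :: real)"
    if "0 \<le> p" for p p' s
    using that by (auto simp: indicator_def)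
  have e2: "(\<Sum>i\<in>I. c i x * indicator {a i<..b i} s) = (simple_value g s x - simple_value h s x) * indicator {0..t} s" for x s
    unfolding sI ge he simple_value_def prod.case
    unfolding diff_conv_add_uminus[of "sum _ _"] sum_negf[symmetric] distrib_right sum_distrib_right
    using r r' by (intro arg_cong2[where f="(+)"] sum.cong refl)
      (auto simp: c_def a_def b_def indicator_def dest: less_imp_le order_trans)
  have "ennreal (((simple_value g s x - simple_value h s x) * indicator {0..t} s)\<^sup>2)
      = ennreal ((simple_value g s x - simple_value h s x)\<^sup>2) * indicator {0..t} s" for s x
    by (simp add: indicator_def)
  then show ?thesis using iso unfolding e1 e2 by simp
qed

lemma simple_process_zero: "simple_process M F (0, (\<lambda>_. 0), \<xi>)"
  by (simp add: simple_process_def mono_on_def)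

lemma simple_term:
  assumes g: "simple_process M F (k, r, \<xi>)" and t: "0 \<le> t" and i: "i < k"
  shows "sq_int M (\<lambda>x. \<xi> i x * (N (min (r (Suc i)) t) x - N (min (r i) t) x))"
    "(\<integral>x. \<xi> i x * (N (min (r (Suc i)) t) x - N (min (r i) t) x) \<partial>M) = 0"
proof -
  have r: "0 \<le> r i" and rS: "r i \<le> r (Suc i)" and m: "\<xi> i \<in> borel_measurable (F (r i))"
    using simple_processD[OF g] i by auto
  obtain C where C: "\<And>x. x \<in> space M \<Longrightarrow> \<bar>\<xi> i x\<bar> \<le> C"
    using simple_processD(4)[OF g i] by blast
  have mM: "\<xi> i \<in> borel_measurable M" using F_measurable[OF r m] .
  show "sq_int M (\<lambda>x. \<xi> i x * (N (min (r (Suc i)) t) x - N (min (r i) t) x))"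
    using r rS t by (intro sq_int_bounded_mult[OF incr_sq_int mM C]) auto
  show "(\<integral>x. \<xi> i x * (N (min (r (Suc i)) t) x - N (min (r i) t) x) \<partial>M) = 0"
  proof (cases "r i \<le> t")
    case True
    have "sq_int M (\<xi> i)"
      using sq_int_bounded_mult[OF _ mM C, of "\<lambda>_. 1"] by (simp add: sq_int_def)
    then show ?thesis using r rS True m
      by (intro L2_martingale_orth[OF L2m]) (auto simp: min_def)
  next
    case False
    then show ?thesis using rS by (simp add: min_def)
  qed
qed

lemma simple_integral_sq_int:
  assumes "simple_process M F g" and "0 \<le> t"
  shows "sq_int M (simple_integral g N t)"
proof -
  obtain k r \<xi> where ge: "g = (k, r, \<xi>)" by (cases g)
  show ?thesis unfolding ge simple_integral_def prod.case
    by (intro sq_int_sum simple_term(1)[OF assms(1)[unfolded ge] assms(2)]) simp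
qed

lemma simple_integral_mean:
  assumes "simple_process M F g" and "0 \<le> t"
  shows "(\<integral>x. simple_integral g N t x \<partial>M) = 0"
proof -
  obtain k r \<xi> where ge: "g = (k, r, \<xi>)" by (cases g)
  note st = simple_term[OF assms(1)[unfolded ge] assms(2)]
  show ?thesis unfolding ge simple_integral_def
    using st sq_int_integrable[OF st(1)] by (simp add: Bochner_Integration.integral_sum)
qed

lemma simple_value_joint:
  assumes "simple_process M F g"
  shows "(\<lambda>(s, x). simple_value g s x) \<in> borel_measurable (borel \<Otimes>\<^sub>M M)"
proof -
  obtain k r \<xi> where ge: "g = (k, r, \<xi>)" by (cases g)
  have m[measurable]: "\<xi> i \<in> borel_measurable M" if "i \<in> {..<k}" for i
    using simple_processD(5)[OF assms[unfolded ge]] that by simp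
  have "(\<lambda>p. \<Sum>i<k. \<xi> i (snd p) * indicator {r i<..r (Suc i)} (fst p)) \<in> borel_measurable (borel \<Otimes>\<^sub>M M)"
    by measurable
  then show ?thesis by (simp add: ge simple_value_def case_prod_beta')
qed

section \<open>Distance, second moment and mean of Ito integrals\<close>

lemma nn_sq_triangle2:
  assumes f: "(\<lambda>(s, x). f s x) \<in> borel_measurable (borel \<Otimes>\<^sub>M M)"
    and g: "(\<lambda>(s, x). g s x) \<in> borel_measurable (borel \<Otimes>\<^sub>M M)"
  shows "msq2 t (\<lambda>s x. f s x + g s x)
    \<le> 2 * (msq2 t f)
     + 2 * (msq2 t g)"
proof -
  interpret \<mu>: sigma_finite_measure \<mu> by (rule sigma_finite_\<mu>)
  interpret ps: pair_sigma_finite \<mu> M ..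
  have f'[measurable]: "(\<lambda>(s, x). f s x) \<in> borel_measurable (\<mu> \<Otimes>\<^sub>M M)"
    and g'[measurable]: "(\<lambda>(s, x). g s x) \<in> borel_measurable (\<mu> \<Otimes>\<^sub>M M)"
    using f g by (simp_all cong: measurable_cong_sets sets_pair_measure_cong)
  have e: "msq2 t h
      = (\<integral>\<^sup>+p. ennreal ((indicator {0..t} (fst p) * h (fst p) (snd p))\<^sup>2) \<partial>(\<mu> \<Otimes>\<^sub>M M))"
    if [measurable]: "(\<lambda>(s, x). h s x) \<in> borel_measurable (\<mu> \<Otimes>\<^sub>M M)" for h
  proof -
    have "msq2 t h
      = (\<integral>\<^sup>+x. (\<integral>\<^sup>+s. (\<lambda>p. ennreal ((indicator {0..t} (fst p) * h (fst p) (snd p))\<^sup>2)) (s, x) \<partial>\<mu>) \<partial>M)"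
      by (intro nn_integral_cong) (auto simp: indicator_def)
    also have "\<dots> = (\<integral>\<^sup>+p. ennreal ((indicator {0..t} (fst p) * h (fst p) (snd p))\<^sup>2) \<partial>(\<mu> \<Otimes>\<^sub>M M))"
      by (rule ps.nn_integral_snd) measurable
    finally show ?thesis .
  qed
  show ?thesis
    using nn_sq_triangle[of "\<lambda>p. indicator {0..t} (fst p) * f (fst p) (snd p)" "\<mu> \<Otimes>\<^sub>M M"
        "\<lambda>p. indicator {0..t} (fst p) * g (fst p) (snd p)"]
    by (simp add: e distrib_left)
qed

text \<open>An integrand is only indistinguishable from a predictable process and need not be
  jointly measurable itself. Fubini arguments run on the version \<open>H'\<close>.\<close>

lemma ito_predictable_version:
  assumes "ito_integral M F N (\<lambda>t x. Q t) H I"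
  obtains H' where "(\<lambda>(s, x). H' s x) \<in> borel_measurable (borel \<Otimes>\<^sub>M M)"
    "AE x in M. \<forall>t\<ge>0. H t x = H' t x"
proof -
  obtain G where G: "(\<lambda>(t, x). G t x) \<in> borel_measurable (predictable_sigma F (space M))"
    "AE x in M. \<forall>t\<ge>0. H t x = G t x"
    using assms by (auto simp: ito_integral_def)
  define H' where "H' t x = (if (t, x) \<in> {0..} \<times> space M then G t x else 0)" for t x
  show ?thesis
  proof
    show "(\<lambda>(s, x). H' s x) \<in> borel_measurable (borel \<Otimes>\<^sub>M M)"
      using predictable_joint[OF G(1)] unfolding H'_def case_prod_beta' by simp
    show "AE x in M. \<forall>t\<ge>0. H t x = H' t x"
      using G(2) AE_space by eventually_elim (auto simp: H'_def)
  qed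
qed

text \<open>On the right the original \<open>H\<close> may appear: at each fixed time it agrees
  almost surely with \<open>H'\<close>, and the joint measurability has been used up by the
  exchange.\<close>

lemma predictable_Fubini:
  assumes H': "(\<lambda>(s, x). H' s x) \<in> borel_measurable (borel \<Otimes>\<^sub>M M)"
    "AE x in M. \<forall>t\<ge>0. H t x = H' t x"
  shows "msq2 t H'
     = (\<integral>\<^sup>+s\<in>{0..t}. msq M (H s) \<partial>\<mu>)"
proof -
  interpret \<mu>: sigma_finite_measure \<mu> by (rule sigma_finite_\<mu>)
  interpret ps: pair_sigma_finite \<mu> M ..
  have [measurable]: "(\<lambda>(s, x). H' s x) \<in> borel_measurable (\<mu> \<Otimes>\<^sub>M M)"
    using H' by (simp_all cong: measurable_cong_sets sets_pair_measure_cong)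
  have "msq2 t H'
     = (\<integral>\<^sup>+s. (\<integral>\<^sup>+x. ennreal ((H' s x)\<^sup>2) * indicator {0..t} s \<partial>M) \<partial>\<mu>)"
    by (rule ps.Fubini') measurable
  also have "\<dots> = (\<integral>\<^sup>+s\<in>{0..t}. msq M (H s) \<partial>\<mu>)"
  proof (intro nn_integral_cong)
    fix s
    show "(\<integral>\<^sup>+x. ennreal ((H' s x)\<^sup>2) * indicator {0..t} s \<partial>M) = (msq M (H s)) * indicator {0..t} s"
    proof (cases "s \<in> {0..t}")
      case True
      have "msq M (H' s) = msq M (H s)"
        using H'(2) by (intro nn_integral_cong_AE, eventually_elim) (use True in auto)
      then show ?thesis using True by simp
    qed simp
  qed
  finally show ?thesis .
qed

lemma ito_measurable:
  assumes "ito_integral M F N (\<lambda>t x. Q t) H I" "0 \<le> t"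
  shows "I t \<in> borel_measurable M"
  using assms F_measurable by (auto simp: ito_integral_def adapted_def)

text \<open>The path from \<open>g\<close> to \<open>I\<close> leads through the unknown sequence
  \<open>h\<close> of the definition: \<open>g\<close> is compared with \<open>h m\<close> by the
  isometry, and \<open>h m\<close> tends both to \<open>H\<close> and, after integration, to
  \<open>I\<close>. Two applications of
  \<open>(a + b)\<^sup>2 \<le> 2 a\<^sup>2 + 2 b\<^sup>2\<close> produce the factor 4.\<close>

lemma ito_distance:
  assumes ito: "ito_integral M F N (\<lambda>t x. Q t) H I" and t: "0 \<le> t" and g: "simple_process M F g"
  shows "msq M (\<lambda>x. simple_integral g N t x - I t x)
    \<le> 4 * (msq2 t (\<lambda>s x. simple_value g s x - H s x))"
proof -
  obtain h where h: "\<And>m::nat. simple_process M F (h m)"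
    and hH: "(\<lambda>m. \<integral>\<^sup>+x. (\<integral>\<^sup>+s\<in>{0..t}. ennreal ((simple_value (h m) s x - H s x)\<^sup>2) \<partial>\<mu>) \<partial>M) \<longlonglongrightarrow> 0"
    and hI: "(\<lambda>m. msq M (\<lambda>x. simple_integral (h m) N t x - I t x)) \<longlonglongrightarrow> 0"
    using ito t by (auto simp: ito_integral_def)
  obtain H' where H': "(\<lambda>(s, x). H' s x) \<in> borel_measurable (borel \<Otimes>\<^sub>M M)"
    "AE x in M. \<forall>t\<ge>0. H t x = H' t x"
    using ito_predictable_version[OF ito] .
  let ?d = "\<lambda>k s x. simple_value k s x - H' s x"
  define D where "D k = msq2 t (\<lambda>s x. ?d k s x)" for k
  have eq: "msq2 t (\<lambda>s x. simple_value k s x - H s x) = D k" for k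
    unfolding D_def
    using H'(2) by (intro nn_integral_cong_AE, eventually_elim) (auto intro!: nn_integral_cong simp: indicator_def)
  have dm: "(\<lambda>(s, x). ?d k s x) \<in> borel_measurable (borel \<Otimes>\<^sub>M M)"
    and dm': "(\<lambda>(s, x). - ?d k s x) \<in> borel_measurable (borel \<Otimes>\<^sub>M M)"
    if "simple_process M F k" for k
    using borel_measurable_diff[OF simple_value_joint[OF that] H'(1)]
      borel_measurable_diff[OF H'(1) simple_value_joint[OF that]] by (simp_all add: case_prod_beta')
  have le: "msq M (\<lambda>x. simple_integral g N t x - I t x)
     \<le> 2 * (2 * D g + 2 * D (h m)) + 2 * (msq M (\<lambda>x. simple_integral (h m) N t x - I t x))" for m
  proof -
    have "msq M (\<lambda>x. simple_integral g N t x - simple_integral (h m) N t x)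
      = msq2 t (\<lambda>s x. ?d g s x + - ?d (h m) s x)"
      using simple_diff_isometry[OF g h t] by simp
    also have "\<dots> \<le> 2 * D g + 2 * D (h m)"
      using nn_sq_triangle2[OF dm[OF g] dm'[OF h[of m]], of t] by (simp add: D_def power2_commute)
    finally have 1: "msq M (\<lambda>x. simple_integral g N t x - simple_integral (h m) N t x)
      \<le> 2 * D g + 2 * D (h m)" .
    have "msq M (\<lambda>x. simple_integral g N t x - I t x)
      \<le> 2 * (msq M (\<lambda>x. simple_integral g N t x - simple_integral (h m) N t x))
       + 2 * (msq M (\<lambda>x. simple_integral (h m) N t x - I t x))"
      using nn_sq_triangle[of "\<lambda>x. simple_integral g N t x - simple_integral (h m) N t x" M "\<lambda>x. simple_integral (h m) N t x - I t x"]
        sq_intD(1)[OF simple_integral_sq_int[OF g t]] sq_intD(1)[OF simple_integral_sq_int[OF h t]] ito_measurable[OF ito t]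
      by simp
    with 1 show ?thesis by (meson add_right_mono mult_left_mono order_trans zero_le)
  qed
  have "(\<lambda>m. 2 * (2 * D g + 2 * D (h m)) + 2 * (msq M (\<lambda>x. simple_integral (h m) N t x - I t x)))
     \<longlonglongrightarrow> 2 * (2 * D g + 2 * 0) + 2 * 0"
    using hH hI unfolding eq by (intro tendsto_intros ennreal_tendsto_cmult) auto
  then have "msq M (\<lambda>x. simple_integral g N t x - I t x) \<le> 2 * (2 * D g + 2 * 0) + 2 * 0"
    by (rule tendsto_lowerbound) (use le in auto)
  then show ?thesis unfolding eq by (simp add: mult.assoc[symmetric])
qed

text \<open>This frees the Ito integral from the sequence in its definition: every approximation of
  the integrand by simple processes computes it.\<close>

lemma ito_approximation:
  assumes ito: "ito_integral M F N (\<lambda>t x. Q t) H I" and t: "0 \<le> t"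
    and g: "\<And>m::nat. simple_process M F (g m)"
    and gH: "(\<lambda>m. \<integral>\<^sup>+x. (\<integral>\<^sup>+s\<in>{0..t}. ennreal ((simple_value (g m) s x - H s x)\<^sup>2) \<partial>\<mu>) \<partial>M) \<longlonglongrightarrow> 0"
  shows "(\<lambda>m. msq M (\<lambda>x. simple_integral (g m) N t x - I t x)) \<longlonglongrightarrow> 0"
proof -
  have lim: "(\<lambda>m. 4 * (msq2 t (\<lambda>s x. simple_value (g m) s x - H s x))) \<longlonglongrightarrow> 4 * 0"
    by (intro ennreal_tendsto_cmult gH) simp
  show ?thesis
    by (rule tendsto_sandwich[OF _ _ tendsto_const[of 0] lim[simplified]]) (use ito_distance[OF ito t g] in auto)
qed

lemma ito_second_moment:
  assumes ito: "ito_integral M F N (\<lambda>t x. Q t) H I" and t: "0 \<le> t"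
  shows "msq M (I t) \<le> 4 * (\<integral>\<^sup>+s\<in>{0..t}. msq M (H s) \<partial>\<mu>)"
proof -
  obtain H' where H': "(\<lambda>(s, x). H' s x) \<in> borel_measurable (borel \<Otimes>\<^sub>M M)"
    "AE x in M. \<forall>t\<ge>0. H t x = H' t x"
    using ito_predictable_version[OF ito] .
  \<comment> \<open>The zero simple process is inserted into the distance estimate.\<close>
  have "msq M (I t) \<le> 4 * (msq2 t H)"
    using ito_distance[OF ito t simple_process_zero] by (simp add: simple_integral_def simple_value_def)
  also have "msq2 t H
     = msq2 t H'"
    using H'(2) by (intro nn_integral_cong_AE, eventually_elim) (auto intro!: nn_integral_cong simp: indicator_def)
  also have "\<dots> = (\<integral>\<^sup>+s\<in>{0..t}. msq M (H s) \<partial>\<mu>)"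
    by (rule predictable_Fubini[OF H'])
  finally show ?thesis .
qed

text \<open>Integrals of simple processes have mean zero, and by Cauchy-Schwarz against the constant
  1 the mean is continuous in \<open>L\<^sup>2\<close>.\<close>

lemma ito_mean:
  assumes ito: "ito_integral M F N (\<lambda>t x. Q t) H I" and t: "0 \<le> t" and I: "sq_int M (I t)"
  shows "(\<integral>x. I t x \<partial>M) = 0"
proof -
  obtain h where h: "\<And>m::nat. simple_process M F (h m)"
    and hI: "(\<lambda>m. msq M (\<lambda>x. simple_integral (h m) N t x - I t x)) \<longlonglongrightarrow> 0"
    using ito t by (auto simp: ito_integral_def)
  have le: "ennreal ((\<integral>x. I t x \<partial>M)\<^sup>2) \<le> msq M (\<lambda>x. simple_integral (h m) N t x - I t x)" for m
  proof -
    note s = simple_integral_sq_int[OF h t, of m]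
    have d: "sq_int M (\<lambda>x. simple_integral (h m) N t x - I t x)" by (rule sq_int_diff[OF s I])
    have "(\<integral>x. I t x \<partial>M)\<^sup>2 = (\<integral>x. (simple_integral (h m) N t x - I t x) * 1 \<partial>M)\<^sup>2"
      using sq_int_integrable[OF s] sq_int_integrable[OF I] simple_integral_mean[OF h t] by simp
    also have "\<dots> \<le> (\<integral>x. (simple_integral (h m) N t x - I t x)\<^sup>2 \<partial>M) * (\<integral>x. 1\<^sup>2 \<partial>M)"
      using d by (intro Cauchy_Schwarz_integral) (auto simp: sq_int_def)
    finally show ?thesis using sq_intD(2)[OF d]
      by (subst nn_integral_eq_integral) (auto simp: prob_space intro!: ennreal_leI)
  qed
  have "ennreal ((\<integral>x. I t x \<partial>M)\<^sup>2) \<le> 0"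
    using le by (intro tendsto_lowerbound[OF hI]) auto
  then show ?thesis by simp
qed

end

section \<open>Centred Gaussian variables\<close>

text \<open>Described by the characteristic function and not by a density, so that variance 0 is
  included and independent sums and \<open>L\<^sup>2\<close> limits stay in the class without case
  distinctions.\<close>

definition centred_gaussian :: "'a measure \<Rightarrow> ('a \<Rightarrow> real) \<Rightarrow> real \<Rightarrow> bool" where
  "centred_gaussian M X v \<longleftrightarrow> X \<in> borel_measurable M \<and> 0 \<le> v \<and>
     (\<forall>t. (CLINT x|M. iexp (t * X x)) = complex_of_real (exp (- v * t\<^sup>2 / 2)))"

text \<open>The hypotheses on Brownian motion concern \<open>P\<close>, whereas the Ito integrals
  live on its completion.\<close>

lemma centred_gaussian_completion:
  assumes "centred_gaussian M X v" shows "centred_gaussian (completion M) X v"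
proof -
  have [measurable]: "X \<in> borel_measurable M" using assms by (simp add: centred_gaussian_def)
  have e: "(CLINT x|completion M. iexp (t * X x)) = (CLINT x|M. iexp (t * X x))" for t
    by (rule integral_completion) measurable
  show ?thesis using assms measurable_completion[of X M borel] unfolding centred_gaussian_def e by blast
qed

lemma centred_gaussian_cmult:
  assumes "centred_gaussian M X v" shows "centred_gaussian M (\<lambda>x. a * X x) (a\<^sup>2 * v)"
  unfolding centred_gaussian_def
proof (intro conjI allI)
  show "(\<lambda>x. a * X x) \<in> borel_measurable M" "0 \<le> a\<^sup>2 * v"
    using assms by (auto simp: centred_gaussian_def)
  fix t
  have "(CLINT x|M. iexp (t * (a * X x))) = (CLINT x|M. iexp ((t * a) * X x))"
    by (simp add: mult.assoc)
  also have "\<dots> = complex_of_real (exp (- v * (t * a)\<^sup>2 / 2))"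
    using assms unfolding centred_gaussian_def by blast
  also have "- v * (t * a)\<^sup>2 / 2 = - (a\<^sup>2 * v) * t\<^sup>2 / 2"
    by (simp add: power_mult_distrib)
  finally show "(CLINT x|M. iexp (t * (a * X x))) = complex_of_real (exp (- (a\<^sup>2 * v) * t\<^sup>2 / 2))" .
qed

context prob_space
begin

lemma centred_gaussian_normal:
  assumes X: "distributed M lborel X (normal_density 0 \<sigma>)" and \<sigma>: "0 < \<sigma>"
  shows "centred_gaussian M X (\<sigma>\<^sup>2)"
proof -
  have m: "X \<in> borel_measurable M" using distributed_measurable[OF X] by simp
  have "distributed M lborel (\<lambda>x. (X x - 0) / \<sigma>) std_normal_density"
    using X normal_standard_normal_convert[OF \<sigma>, of X 0] by simp
  then have d: "distr M lborel (\<lambda>x. X x / \<sigma>) = std_normal_distribution"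
    using distributed_distr_eq_density by fastforce
  have "centred_gaussian M (\<lambda>x. X x / \<sigma>) 1"
    unfolding centred_gaussian_def
  proof (intro conjI allI)
    show "(\<lambda>x. X x / \<sigma>) \<in> borel_measurable M" using m by simp
    fix t
    have "(CLINT x|M. iexp (t * (X x / \<sigma>))) = char (distr M lborel (\<lambda>x. X x / \<sigma>)) t"
      unfolding char_def using m by (subst integral_distr) auto
    also have "\<dots> = complex_of_real (exp (- 1 * t\<^sup>2 / 2))"
      unfolding d char_std_normal_distribution by simp
    finally show "(CLINT x|M. iexp (t * (X x / \<sigma>))) = complex_of_real (exp (- 1 * t\<^sup>2 / 2))" .
  qed simp
  from centred_gaussian_cmult[OF this, of \<sigma>] show ?thesis using \<sigma> by simp
qed

lemma char_distr_integral:
  "X \<in> borel_measurable M \<Longrightarrow> char (distr M borel X) t = (CLINT x|M. iexp (t * X x))"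
  unfolding char_def by (subst integral_distr) auto

lemma centred_gaussian_sum:
  assumes "indep_vars (\<lambda>_. borel) X I" and g: "\<And>i. i \<in> I \<Longrightarrow> centred_gaussian M (X i) (v i)"
  shows "centred_gaussian M (\<lambda>x. \<Sum>i\<in>I. X i x) (\<Sum>i\<in>I. v i)"
proof (cases "finite I")
  \<comment> \<open>A sum over an infinite set is 0 by convention, which is Gaussian of variance
    0.\<close>
  case False then show ?thesis by (simp add: centred_gaussian_def prob_space)
next
  case True
  have m: "X i \<in> borel_measurable M" and v: "0 \<le> v i" if "i \<in> I" for i
    using g[OF that] by (auto simp: centred_gaussian_def)
  have ms: "(\<lambda>x. \<Sum>i\<in>I. X i x) \<in> borel_measurable M" using m by simp
  have "(CLINT x|M. iexp (t * (\<Sum>i\<in>I. X i x))) = complex_of_real (exp (- (\<Sum>i\<in>I. v i) * t\<^sup>2 / 2))" for t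
  proof -
    have "(CLINT x|M. iexp (t * (\<Sum>i\<in>I. X i x))) = (\<Prod>i\<in>I. char (distr M borel (X i)) t)"
      using char_distr_sum[OF assms(1)] char_distr_integral[OF ms] by simp
    also have "\<dots> = (\<Prod>i\<in>I. complex_of_real (exp (- v i * t\<^sup>2 / 2)))"
      using g m by (intro prod.cong refl) (auto simp: char_distr_integral centred_gaussian_def)
    also have "\<dots> = complex_of_real (exp (\<Sum>i\<in>I. - v i * t\<^sup>2 / 2))"
      using True by (simp add: exp_sum)
    also have "(\<Sum>i\<in>I. - v i * t\<^sup>2 / 2) = - (\<Sum>i\<in>I. v i) * t\<^sup>2 / 2"
      by (simp add: sum_distrib_right sum_divide_distrib sum_negf)
    finally show ?thesis .
  qed
  then show ?thesis using ms v by (auto simp: centred_gaussian_def intro: sum_nonneg)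
qed

lemma centred_gaussian_add:
  assumes "indep_var borel X borel Y" and "centred_gaussian M X v" "centred_gaussian M Y w"
  shows "centred_gaussian M (\<lambda>x. X x + Y x) (v + w)"
proof -
  have m[measurable]: "X \<in> borel_measurable M" "Y \<in> borel_measurable M" using assms by (auto simp: centred_gaussian_def)
  have "(CLINT x|M. iexp (t * (X x + Y x))) = complex_of_real (exp (- (v + w) * t\<^sup>2 / 2))" for t
  proof -
    have "(CLINT x|M. iexp (t * (X x + Y x))) = char (distr M borel X) t * char (distr M borel Y) t"
      using char_distr_add[OF assms(1)] char_distr_integral[of "\<lambda>x. X x + Y x"] by simp
    also have "\<dots> = complex_of_real (exp (- v * t\<^sup>2 / 2) * exp (- w * t\<^sup>2 / 2))"
      using assms by (simp add: char_distr_integral centred_gaussian_def)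
    also have "exp (- v * t\<^sup>2 / 2) * exp (- w * t\<^sup>2 / 2) = exp (- (v + w) * t\<^sup>2 / 2)"
      by (simp add: exp_add[symmetric] algebra_simps add_divide_distrib diff_divide_distrib)
    finally show ?thesis .
  qed
  then show ?thesis using m assms by (auto simp: centred_gaussian_def)
qed

lemma real_distribution_distr_real:
  "X \<in> borel_measurable M \<Longrightarrow> Distribution_Functions.real_distribution (distr M borel X)"
  by (auto simp: Distribution_Functions.real_distribution_def real_distribution_axioms_def prob_space_distr)

text \<open>Levy's uniqueness theorem identifies the law: a point mass at 0 if the variance
  vanishes, and a scaled standard normal law otherwise.\<close>

lemma centred_gaussian_moments:
  assumes X: "centred_gaussian M X v"
  shows "integrable M (\<lambda>x. (X x)\<^sup>2)" "(\<integral>x. (X x)\<^sup>2 \<partial>M) = v"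
    "integrable M (\<lambda>x. (X x) ^ 4)" "(\<integral>x. (X x) ^ 4 \<partial>M) = 3 * v\<^sup>2"
proof -
  have m[measurable]: "X \<in> borel_measurable M" and v: "0 \<le> v" using X by (auto simp: centred_gaussian_def)
  have "integrable M (\<lambda>x. (X x)\<^sup>2) \<and> (\<integral>x. (X x)\<^sup>2 \<partial>M) = v \<and>
    integrable M (\<lambda>x. (X x) ^ 4) \<and> (\<integral>x. (X x) ^ 4 \<partial>M) = 3 * v\<^sup>2"
  proof (cases "v = 0")
    case True
    have D: "distr M borel X = return borel 0"
    proof (rule Levy_uniqueness)
      show "Distribution_Functions.real_distribution (distr M borel X)" using m by (rule real_distribution_distr_real)
      show "Distribution_Functions.real_distribution (return borel 0)"
        by (auto simp: Distribution_Functions.real_distribution_def real_distribution_axioms_def prob_space_return)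
      show "char (distr M borel X) = char (return borel 0)"
      proof
        fix t
        show "char (distr M borel X) t = char (return borel 0) t"
          using X True unfolding char_distr_integral[OF m] by (simp add: char_def integral_return centred_gaussian_def)
      qed
    qed
    have "AE x in distr M borel X. x = 0" unfolding D by (subst AE_return) auto
    then have ae: "AE x in M. X x = 0" by (subst (asm) AE_distr_iff) auto
    have e: "integrable M (\<lambda>x. (X x) ^ k) \<and> (\<integral>x. (X x) ^ k \<partial>M) = 0" if "0 < k" for k
    proof -
      have ae': "AE x in M. X x ^ k = 0" using ae by eventually_elim (use that in simp)
      show ?thesis
        using integrable_cong_AE[OF _ _ ae'] integral_cong_AE[OF _ _ ae'] by simp
    qed
    show ?thesis using e[of 2] e[of 4] True by simp
  next
    case False
    with v have v: "0 < v" by simp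
    define s where "s = sqrt v"
    have s: "0 < s" "s\<^sup>2 = v" using v by (auto simp: s_def)
    have s4: "s ^ 4 = v\<^sup>2" using s(2) by (metis power_even_eq numeral_Bit0 mult_2 mult.commute power2_eq_square power_mult)
    define Y where "Y x = (1 / s) * X x" for x
    have Y: "centred_gaussian M Y 1"
      using centred_gaussian_cmult[OF X, of "1 / s"] s v by (simp add: Y_def[abs_def] power_divide)
    then have mY[measurable]: "Y \<in> borel_measurable M" by (simp add: centred_gaussian_def)
    have d: "distr M borel Y = std_normal_distribution"
    proof (rule Levy_uniqueness)
      show "Distribution_Functions.real_distribution (distr M borel Y)" using mY by (rule real_distribution_distr_real)
      show "char (distr M borel Y) = char std_normal_distribution"
        using Y unfolding char_std_normal_distribution
        by (auto simp: fun_eq_iff char_distr_integral[OF mY] centred_gaussian_def)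
    qed (rule real_dist_normal_dist)
    have k: "integrable M (\<lambda>x. (Y x) ^ (2 * k)) \<and> (\<integral>x. (Y x) ^ (2 * k) \<partial>M) = fact (2 * k) / (2^k * fact k)" for k
    proof
      have "integrable (distr M borel Y) (\<lambda>x. x ^ (2 * k))"
        unfolding d by (rule std_normal_distribution_even_moments)
      then show "integrable M (\<lambda>x. (Y x) ^ (2 * k))" by (subst (asm) integrable_distr_eq) auto
      have "(\<integral>x. (Y x) ^ (2 * k) \<partial>M) = (\<integral>x. x ^ (2 * k) \<partial>distr M borel Y)"
        by (subst integral_distr) auto
      then show "(\<integral>x. (Y x) ^ (2 * k) \<partial>M) = fact (2 * k) / (2^k * fact k)"
        unfolding d by (simp add: std_normal_distribution_even_moments)
    qed
    have XY: "X x = s * Y x" for x using s by (simp add: Y_def)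
    \<comment> \<open>Needed for 4! / (2^2 * 2!) = 3, the fourth moment of the standard normal
      law.\<close>
    have "fact 4 = (24::real)" by (simp add: fact_numeral)
    then show ?thesis using k[of 1] k[of 2] s s4 by (simp add: XY power_mult_distrib)
  qed
  then show "integrable M (\<lambda>x. (X x)\<^sup>2)" "(\<integral>x. (X x)\<^sup>2 \<partial>M) = v"
    "integrable M (\<lambda>x. (X x) ^ 4)" "(\<integral>x. (X x) ^ 4 \<partial>M) = 3 * v\<^sup>2" by auto
qed

lemma norm_iexp_diff_le: "cmod (iexp a - iexp b) \<le> \<bar>a - b\<bar>"
proof -
  have "iexp a - iexp b = iexp b * (iexp (a - b) - 1)"
    by (simp add: algebra_simps exp_diff)
  moreover have "cmod (iexp (a - b) - 1) \<le> \<bar>a - b\<bar>"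
    using iexp_approx1[of "a - b" 0] by simp
  ultimately show ?thesis by (simp add: norm_mult)
qed

text \<open>Second moments converge in \<open>L\<^sup>2\<close>, and so do characteristic functions,
  because \<open>iexp\<close> is Lipschitz. Convergence of the variances is recorded separately: it
  is what later allows variances of different limits to be compared through their
  approximations.\<close>

lemma centred_gaussian_limit:
  assumes X: "\<And>m. centred_gaussian M (X m) (v m)" and Y: "sq_int M Y"
    and lim: "(\<lambda>m. msq M (\<lambda>x. X m x - Y x)) \<longlonglongrightarrow> 0"
  shows "v \<longlonglongrightarrow> (\<integral>x. (Y x)\<^sup>2 \<partial>M)" "centred_gaussian M Y (\<integral>x. (Y x)\<^sup>2 \<partial>M)"
proof -
  have sX: "sq_int M (X m)" for m
    using X[of m] centred_gaussian_moments[OF X[of m]] by (auto simp: sq_int_def centred_gaussian_def)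
  define d where "d m x = X m x - Y x" for m x
  have sd: "sq_int M (d m)" for m unfolding d_def by (rule sq_int_diff[OF sX Y])
  define e where "e m = (\<integral>x. (d m x)\<^sup>2 \<partial>M)" for m
  have "msq M (\<lambda>x. X m x - Y x) = ennreal (e m)" for m
    unfolding e_def d_def[symmetric] using sq_intD[OF sd] by (intro nn_integral_eq_integral) auto
  moreover have e0: "0 \<le> e m" for m by (simp add: e_def)
  ultimately have e: "e \<longlonglongrightarrow> 0"
    using lim tendsto_ennreal_iff[of e sequentially 0] by simp
  have se: "(\<lambda>m. sqrt (e m)) \<longlonglongrightarrow> 0" using tendsto_real_sqrt[OF e] by simp
  let ?w = "\<integral>x. (Y x)\<^sup>2 \<partial>M"
  have vm: "v m = ?w + 2 * (\<integral>x. Y x * d m x \<partial>M) + e m" for m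
  proof -
    have "v m = (\<integral>x. (X m x)\<^sup>2 \<partial>M)" using centred_gaussian_moments[OF X[of m]] by simp
    also have "\<dots> = (\<integral>x. (Y x)\<^sup>2 + 2 * (Y x * d m x) + (d m x)\<^sup>2 \<partial>M)"
      by (intro Bochner_Integration.integral_cong) (auto simp: d_def power2_eq_square algebra_simps)
    also have "\<dots> = ?w + 2 * (\<integral>x. Y x * d m x \<partial>M) + e m"
      using sq_intD[OF sd[of m]] sq_intD[OF Y] sq_int_mult_integrable[OF Y sd[of m]] by (simp add: e_def)
    finally show ?thesis .
  qed
  have "\<bar>\<integral>x. Y x * d m x \<partial>M\<bar> \<le> sqrt ?w * sqrt (e m)" for m
    using real_sqrt_le_mono[OF Cauchy_Schwarz_integral[OF Y sd[of m]]]
    by (simp add: real_sqrt_mult e_def)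
  then have "(\<lambda>m. \<integral>x. Y x * d m x \<partial>M) \<longlonglongrightarrow> 0"
    by (intro Lim_null_comparison[OF _ tendsto_mult_right_zero[OF se, of "sqrt ?w"]]) auto
  from tendsto_add[OF tendsto_add[OF tendsto_const[of ?w] tendsto_mult_right_zero[OF this, of 2]] e]
  show v: "v \<longlonglongrightarrow> ?w" unfolding vm[abs_def] by simp
  show "centred_gaussian M Y ?w"
    unfolding centred_gaussian_def
  proof (intro conjI allI)
    show mY[measurable]: "Y \<in> borel_measurable M" using sq_intD[OF Y] by simp
    fix t
    have mX[measurable]: "X m \<in> borel_measurable M" for m using sq_intD[OF sX] by simp
    have i: "integrable M (\<lambda>x. iexp (t * Z x))" if [measurable]: "Z \<in> borel_measurable M" for Z
      by (rule integrable_const_bound[where B=1]) auto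
    have le: "cmod ((CLINT x|M. iexp (t * X m x)) - (CLINT x|M. iexp (t * Y x))) \<le> \<bar>t\<bar> * sqrt (e m)" for m
    proof -
      have "cmod ((CLINT x|M. iexp (t * X m x)) - (CLINT x|M. iexp (t * Y x)))
        = cmod (CLINT x|M. iexp (t * X m x) - iexp (t * Y x))"
        by (subst Bochner_Integration.integral_diff[OF i[OF mX] i[OF mY]]) simp
      also have "\<dots> \<le> (\<integral>x. cmod (iexp (t * X m x) - iexp (t * Y x)) \<partial>M)"
        by (rule integral_norm_bound)
      also have "\<dots> \<le> (\<integral>x. \<bar>t\<bar> * \<bar>d m x\<bar> \<partial>M)"
      proof (rule integral_mono)
        show "integrable M (\<lambda>x. cmod (iexp (t * X m x) - iexp (t * Y x)))"
          using i[OF mX] i[OF mY] by (intro integrable_norm Bochner_Integration.integrable_diff)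
        show "integrable M (\<lambda>x. \<bar>t\<bar> * \<bar>d m x\<bar>)" using sq_int_integrable[OF sd[of m]] by simp
        show "cmod (iexp (t * X m x) - iexp (t * Y x)) \<le> \<bar>t\<bar> * \<bar>d m x\<bar>" for x
          using norm_iexp_diff_le[of "t * X m x" "t * Y x"]
          by (simp add: d_def abs_mult[symmetric] right_diff_distrib)
      qed
      also have "\<dots> = \<bar>t\<bar> * (\<integral>x. \<bar>d m x\<bar> * 1 \<partial>M)" by simp
      also have "(\<integral>x. \<bar>d m x\<bar> * 1 \<partial>M) \<le> sqrt (e m)"
        using Cauchy_Schwarz_integral[of M "\<lambda>x. \<bar>d m x\<bar>" "\<lambda>_. 1"] sq_intD[OF sd[of m]]
        by (intro real_le_rsqrt) (auto simp: sq_int_def e_def prob_space)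
      finally show ?thesis by (simp add: mult_left_mono)
    qed
    have "(\<lambda>m. (CLINT x|M. iexp (t * X m x)) - (CLINT x|M. iexp (t * Y x))) \<longlonglongrightarrow> 0"
      using le by (intro Lim_null_comparison[OF _ tendsto_mult_right_zero[OF se, of "\<bar>t\<bar>"]]) auto
    then have "(\<lambda>m. (CLINT x|M. iexp (t * X m x))) \<longlonglongrightarrow> (CLINT x|M. iexp (t * Y x))"
      by (rule LIM_zero_cancel)
    moreover have "(CLINT x|M. iexp (t * X m x)) = complex_of_real (exp (- v m * t\<^sup>2 / 2))" for m
      using X[of m] by (simp add: centred_gaussian_def)
    moreover have "(\<lambda>m. complex_of_real (exp (- v m * t\<^sup>2 / 2))) \<longlonglongrightarrow> complex_of_real (exp (- ?w * t\<^sup>2 / 2))"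
      by (intro tendsto_intros v) simp
    ultimately show "(CLINT x|M. iexp (t * Y x)) = complex_of_real (exp (- ?w * t\<^sup>2 / 2))"
      using LIMSEQ_unique by auto
  qed simp
qed

end

section \<open>Fourier modes\<close>

lemma rvec_simps [simp]:
  "rvec 0 = 0" "rvec (- n) = - rvec n" "rvec (m + n) = rvec m + rvec n" "rvec (m - n) = rvec m - rvec n"
  by (simp_all add: rvec_def vec_eq_iff)

lemma rvec_nth [simp]: "rvec n $ i = of_int (n $ i)"
  by (simp add: rvec_def)

lemma rvec_eq_0_iff [simp]: "rvec n = 0 \<longleftrightarrow> n = 0"
  by (simp add: rvec_def vec_eq_iff)

lemma inner_rvec_rvec: "rvec m \<bullet> rvec n = of_int (\<Sum>i\<in>UNIV. m $ i * n $ i)"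
  by (simp add: inner_vec_def)

lemma cmod_mode [simp]: "cmod (mode n x) = 1"
  by (simp add: mode_def)

lemma mode_uminus: "mode (- n) x = cnj (mode n x)"
  by (simp add: mode_def cis_cnj)

lemma mode_mult_cnj: "mode n x * cnj (mode m x) = mode (n - m) x"
  by (simp add: mode_def cis_cnj cis_mult inner_diff_left)

lemma mode_0 [simp]: "mode 0 x = 1"
  by (simp add: mode_def)

lemma cis_2pi_int: "cis (2 * pi * of_int k) = 1"
  by (metis cis_multiple_2pi Ints_of_int)

lemma mode_periodic: "mode n (x + (2 * pi) *\<^sub>R rvec m) = mode n x"
proof -
  have "mode n (x + (2 * pi) *\<^sub>R rvec m) = mode n x * cis (2 * pi * (rvec n \<bullet> rvec m))"
    by (simp add: mode_def cis_mult inner_add_right)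
  also have "cis (2 * pi * (rvec n \<bullet> rvec m)) = 1"
    unfolding inner_rvec_rvec by (rule cis_2pi_int)
  finally show ?thesis by simp
qed

lemma continuous_on_mode [continuous_intros]: "continuous_on A (mode n)"
  unfolding mode_def cis_conv_exp by (intro continuous_intros)

lemma mode_measurable [measurable]: "mode n \<in> borel_measurable borel"
  by (intro borel_measurable_continuous_onI continuous_on_mode)

lemma finite_rvec_ball: "finite {n :: int^2. norm (rvec n) \<le> R}"
proof (rule finite_subset)
  let ?I = "{- \<lceil>R\<rceil>..\<lceil>R\<rceil>}"
  show "{n :: int^2. norm (rvec n) \<le> R} \<subseteq> (\<lambda>(a, b). vector [a, b]) ` (?I \<times> ?I)"
  proof
    fix n :: "int^2" assume n: "n \<in> {n. norm (rvec n) \<le> R}"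
    have "n $ i \<in> ?I" for i
    proof -
      have "\<bar>of_int (n $ i)\<bar> \<le> R"
        using component_le_norm_cart[of "rvec n" i] n by simp
      then have "\<bar>n $ i\<bar> \<le> \<lceil>R\<rceil>" by linarith
      then show ?thesis by auto
    qed
    moreover have "n = vector [n $ 1, n $ 2]" by (simp add: vec_eq_iff forall_2)
    ultimately show "n \<in> (\<lambda>(a, b). vector [a, b]) ` (?I \<times> ?I)" by (auto intro!: image_eqI[of _ _ "(n $ 1, n $ 2)"])
  qed
qed auto

section \<open>The torus\<close>

lemma emeasure_lborel_torus_box: "emeasure lborel (cbox (0 :: real^2) (\<chi> i. 2 * pi)) = ennreal ((2 * pi)\<^sup>2)"
proof -
  have "(\<Prod>b\<in>Basis. ((\<chi> i. 2 * pi) - 0 :: real^2) \<bullet> b) = (\<Prod>b\<in>(Basis :: (real^2) set). 2 * pi)"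
    by (intro prod.cong refl) (auto simp: Basis_vec_def inner_axis)
  also have "\<dots> = (2 * pi)\<^sup>2" by simp
  finally show ?thesis by (subst emeasure_lborel_cbox) (auto simp: Basis_vec_def inner_axis)
qed

lemma sets_torus [simp, measurable_cong]: "sets torus = sets borel"
  by (simp add: torus_def)

lemma space_torus [simp]: "space torus = UNIV"
  by (simp add: torus_def)

interpretation torus: prob_space torus
  unfolding torus_def
  by (rule prob_space_uniform_measure) (simp_all add: emeasure_lborel_torus_box)

lemma torus_density:
  "torus = density lborel (\<lambda>x. ennreal (indicator (cbox 0 (\<chi> i. 2 * pi)) x / (2 * pi)\<^sup>2))"
  unfolding torus_def uniform_measure_def emeasure_lborel_torus_box
  by (intro arg_cong2[where f=density] refl ext)
    (auto simp: indicator_def divide_ennreal[symmetric] simp flip: ennreal_1)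

lemma AE_torus_box: "AE x in torus. x \<in> cbox 0 (\<chi> i. 2 * pi)"
  unfolding torus_def by (rule AE_uniform_measureI) auto

text \<open>The measure \<open>torus\<close> is carried by a compact box, on which a continuous
  function is bounded.\<close>

lemma torus_integrable_continuous:
  fixes f :: "real^2 \<Rightarrow> 'b::{banach, second_countable_topology}"
  assumes "continuous_on UNIV f"
  shows "integrable torus f"
proof -
  have "bounded (f ` cbox 0 (\<chi> i. 2 * pi))"
    using assms by (intro compact_imp_bounded compact_continuous_image) (auto intro: continuous_on_subset)
  then obtain B where "\<And>x. x \<in> cbox 0 (\<chi> i. 2 * pi) \<Longrightarrow> norm (f x) \<le> B"
    unfolding bounded_iff by blast
  then have "AE x in torus. norm (f x) \<le> B" using AE_torus_box by auto
  moreover have "f \<in> borel_measurable torus"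
    using borel_measurable_continuous_onI[OF assms] by simp
  ultimately show ?thesis by (rule torus.integrable_const_bound)
qed

lemma integral_cis_period:
  assumes "k \<noteq> 0"
  shows "(\<integral>t. indicator {0..2 * pi} t *\<^sub>R cis (of_int k * t) \<partial>lborel) = 0"
proof -
  let ?F = "\<lambda>t. cis (of_int k * t) / (\<i> * of_int k)"
  have "(\<integral>t. indicator {0..2 * pi} t *\<^sub>R cis (of_int k * t) \<partial>lborel) = ?F (2 * pi) - ?F 0"
  proof (rule integral_FTC_Icc)
    fix t :: real
    have "((\<lambda>t. exp (\<i> * of_int k * of_real t) / (\<i> * of_int k)) has_vector_derivative
       (\<i> * of_int k) * exp (\<i> * of_int k * of_real t) / (\<i> * of_int k)) (at t within {0..2 * pi})"
      by (rule has_vector_derivative_real_field) (auto intro!: derivative_eq_intros)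
    then show "(?F has_vector_derivative cis (of_int k * t)) (at t within {0..2 * pi})"
      using assms by (simp add: cis_conv_exp mult.assoc)
  qed (auto simp: cis_conv_exp intro!: continuous_intros)
  also have "\<dots> = 0" using cis_2pi_int[of k] by (simp add: mult.commute mult.left_commute)
  finally show ?thesis .
qed

text \<open>The mode is a product of functions of the single coordinates, and a coordinate in which
  \<open>k\<close> does not vanish contributes the integral of \<open>cis\<close> over full
  periods.\<close>

lemma integral_mode_torus: "(\<integral>x. mode k x \<partial>torus) = (if k = 0 then 1 else 0)"
proof (cases "k = 0")
  case True
  then show ?thesis using torus.prob_space by simp
next
  case False
  then obtain i where i: "k $ i \<noteq> 0" by (auto simp: vec_eq_iff)
  let ?A = "cbox (0 :: real^2) (\<chi> i. 2 * pi)"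
  define g where "g b t = indicator {0..2 * pi} t *\<^sub>R cis ((rvec k \<bullet> b) * t)" for b :: "real^2" and t :: real
  have gi: "integrable lborel (g b)" for b
    unfolding g_def cis_conv_exp by (intro borel_integrable_compact continuous_intros compact_Icc)
  have gm[measurable]: "g b \<in> borel_measurable borel" for b using borel_measurable_integrable[OF gi] by simp
  have prod: "indicator ?A x *\<^sub>R mode k x = (\<Prod>b\<in>Basis. g b (x \<bullet> b))" for x
  proof -
    have "indicator ?A x = (\<Prod>b\<in>Basis. indicator {0..2 * pi} (x \<bullet> b) :: complex)"
    proof (cases "x \<in> ?A")
      case True
      then have "\<And>b. b \<in> Basis \<Longrightarrow> x \<bullet> b \<in> {0..2*pi}"
        by (auto simp: mem_box Basis_vec_def inner_axis)
      then show ?thesis using True by simp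
    next
      case False
      then obtain i where "x $ i \<notin> {0..2*pi}" by (auto simp: mem_box_cart)
      then have "axis i 1 \<in> (Basis :: (real^2) set)" "x \<bullet> axis i 1 \<notin> {0..2*pi}"
        by (auto simp: Basis_vec_def inner_axis)
      then obtain b where "b \<in> Basis" "x \<bullet> b \<notin> {0..2*pi}" by blast
      then have "\<exists>b\<in>Basis. indicator {0..2 * pi} (x \<bullet> b) = (0::complex)" by (intro bexI[of _ b]) auto
      then have "(\<Prod>b\<in>Basis. indicator {0..2 * pi} (x \<bullet> b) :: complex) = 0"
        by (simp add: prod_zero_iff)
      then show ?thesis using False by simp
    qed
    moreover have "mode k x = (\<Prod>b\<in>Basis. cis ((rvec k \<bullet> b) * (x \<bullet> b)))"
      unfolding mode_def by (subst euclidean_inner) (simp add: cis_conv_exp sum_distrib_left exp_sum)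
    moreover have "g b t = indicator {0..2 * pi} t * cis ((rvec k \<bullet> b) * t)" for b t
      by (simp add: g_def indicator_def)
    moreover have "indicator ?A x *\<^sub>R mode k x = indicator ?A x * mode k x"
      by (simp add: indicator_def)
    ultimately show ?thesis by (simp only: prod.distrib)
  qed
  interpret P: product_sigma_finite "\<lambda>_::real^2. lborel :: real measure" ..
  have "(\<integral>x. indicator ?A x *\<^sub>R mode k x \<partial>lborel) = (\<integral>x. (\<Prod>b\<in>Basis. g b (x \<bullet> b)) \<partial>(lborel :: (real^2) measure))"
    by (simp add: prod)
  \<comment> \<open>Lebesgue measure on the plane is the image of the product measure under the
    coordinate map, so the integral becomes one to which the product rule applies.\<close>
  also have "\<dots> = (\<integral>f. (\<Prod>b\<in>Basis. g b ((\<Sum>b\<in>Basis. f b *\<^sub>R b) \<bullet> b)) \<partial>(\<Pi>\<^sub>M b\<in>(Basis :: (real^2) set). lborel))"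
    by (subst lborel_eq) (rule integral_distr, auto)
  also have "\<dots> = (\<integral>f. (\<Prod>b\<in>Basis. g b (f b)) \<partial>(\<Pi>\<^sub>M b\<in>(Basis :: (real^2) set). lborel))"
    by (intro Bochner_Integration.integral_cong prod.cong refl) (simp add: inner_sum_left inner_Basis if_distrib cong: if_cong)
  also have "\<dots> = (\<Prod>b\<in>Basis. \<integral>t. g b t \<partial>lborel)"
    by (rule P.product_integral_prod) (auto intro: gi)
  also have "\<dots> = 0"
  proof (rule prod_zero)
    have "(\<integral>t. g (axis i 1) t \<partial>lborel) = 0"
      using integral_cis_period[OF i] by (simp add: g_def inner_axis)
    then show "\<exists>b\<in>Basis. (\<integral>t. g b t \<partial>lborel) = 0"
      by (intro bexI[of _ "axis i 1"]) (auto simp: Basis_vec_def)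
  qed simp
  finally have z: "(\<integral>x. indicator ?A x *\<^sub>R mode k x \<partial>lborel) = 0" .
  have "(\<integral>x. mode k x \<partial>torus) = (\<integral>x. (indicator ?A x / (2 * pi)\<^sup>2) *\<^sub>R mode k x \<partial>lborel)"
    unfolding torus_density by (rule integral_density) auto
  also have "\<dots> = (\<integral>x. (1 / (2 * pi)\<^sup>2) *\<^sub>R (indicator ?A x *\<^sub>R mode k x) \<partial>lborel)"
    by (intro Bochner_Integration.integral_cong) auto
  also have "\<dots> = 0" by (subst integral_scaleR_right) (simp add: z)
  finally show ?thesis using False by simp
qed

section \<open>Trigonometric polynomials\<close>

definition trig_poly :: "(int^2) set \<Rightarrow> (int^2 \<Rightarrow> complex) \<Rightarrow> real^2 \<Rightarrow> real" where
  "trig_poly N c x = Re (\<Sum>n\<in>N. c n * mode n x)"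

lemma continuous_on_trig_poly [continuous_intros]: "continuous_on A (trig_poly N c)"
  unfolding trig_poly_def by (intro continuous_intros)

lemma trig_poly_add: "trig_poly N c x + trig_poly N d x = trig_poly N (\<lambda>n. c n + d n) x"
  by (simp add: trig_poly_def sum.distrib distrib_right)

lemma periodic_trig_poly: "periodic (trig_poly N c)"
  by (simp add: periodic_def trig_poly_def mode_periodic)

lemma has_derivative_mode:
  "(mode n has_derivative (\<lambda>h. \<i> * of_real (rvec n \<bullet> h) * mode n x)) (at x)"
proof -
  have "((\<lambda>x. exp (\<i> * complex_of_real (rvec n \<bullet> x))) has_derivative
      (\<lambda>h. \<i> * complex_of_real (rvec n \<bullet> h) * exp (\<i> * complex_of_real (rvec n \<bullet> x)))) (at x)"
  proof -
    have 1: "((\<lambda>x. \<i> * complex_of_real (rvec n \<bullet> x)) has_derivative (\<lambda>h. \<i> * complex_of_real (rvec n \<bullet> h))) (at x)"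
      by (intro has_derivative_mult_right has_derivative_of_real has_derivative_inner_right has_derivative_ident)
    have 2: "(exp has_derivative (*) (exp (\<i> * complex_of_real (rvec n \<bullet> x)))) (at (\<i> * complex_of_real (rvec n \<bullet> x)))"
      using DERIV_exp by (simp add: has_field_derivative_def)
    from has_derivative_compose[OF 1 2] show ?thesis by (simp add: mult.commute)
  qed
  then show ?thesis by (simp add: mode_def[abs_def] cis_conv_exp)
qed

lemma has_derivative_trig_poly:
  "(trig_poly N c has_derivative (\<lambda>h. Re (\<Sum>n\<in>N. c n * (\<i> * of_real (rvec n \<bullet> h) * mode n x)))) (at x)"
  unfolding trig_poly_def[abs_def]
  by (intro has_derivative_Re has_derivative_sum has_derivative_mult_right has_derivative_mode)

lemma grad_trig_poly: "grad (trig_poly N c) x $ i = trig_poly N (\<lambda>n. \<i> * of_int (n $ i) * c n) x"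
proof -
  have "((\<lambda>h. trig_poly N c (x + h *\<^sub>R axis i 1)) has_derivative
      (\<lambda>h. Re (\<Sum>n\<in>N. c n * (\<i> * of_real (rvec n \<bullet> (h *\<^sub>R axis i 1)) * mode n x)))) (at 0)"
    by (rule has_derivative_compose[where g="trig_poly N c" and f="\<lambda>h. x + h *\<^sub>R axis i 1", unfolded o_def])
      (auto intro!: derivative_eq_intros has_derivative_trig_poly[THEN has_derivative_eq_rhs])
  moreover have "(\<lambda>h. Re (\<Sum>n\<in>N. c n * (\<i> * of_real (rvec n \<bullet> (h *\<^sub>R axis i 1)) * mode n x)))
    = (*) (trig_poly N (\<lambda>n. \<i> * of_int (n $ i) * c n) x)"
    by (auto simp: trig_poly_def inner_axis sum_distrib_left fun_eq_iff algebra_simps intro!: sum.cong)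
  ultimately have "((\<lambda>h. trig_poly N c (x + h *\<^sub>R axis i 1)) has_field_derivative
      trig_poly N (\<lambda>n. \<i> * of_int (n $ i) * c n) x) (at 0)"
    by (simp add: has_field_derivative_def)
  then show ?thesis unfolding grad_def by (simp add: DERIV_imp_deriv)
qed

lemma continuous_on_grad_trig_poly [continuous_intros]: "continuous_on A (grad (trig_poly N c))"
proof -
  have "grad (trig_poly N c) = (\<lambda>x. \<chi> i. trig_poly N (\<lambda>n. \<i> * of_int (n $ i) * c n) x)"
    by (auto simp: vec_eq_iff grad_trig_poly)
  then show ?thesis by (auto intro!: continuous_intros)
qed

lemma smooth_torus_trig_poly: "smooth_torus (trig_poly N c)"
  unfolding smooth_torus_def
proof (intro conjI exI)
  \<comment> \<open>For a fixed set of frequencies the trigonometric polynomials are closed under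
    partial derivatives, so their range serves as the witness in
    \<open>smooth_torus\<close>.\<close>
  show "trig_poly N c \<in> range (trig_poly N)" by simp
  show "\<forall>h\<in>range (trig_poly N). (\<forall>x. h differentiable at x) \<and> (\<forall>i. (\<lambda>x. grad h x $ i) \<in> range (trig_poly N))"
    using has_derivative_trig_poly by (auto simp: differentiable_def grad_trig_poly[abs_def])
qed (rule periodic_trig_poly)

text \<open>Taking the real part averages a sum with its conjugate, so the coefficients come out
  symmetrised.\<close>

lemma fourier_coeff_trig_poly:
  assumes "finite N"
  shows "fourier_coeff (trig_poly N c) m
     = ((if m \<in> N then c m else 0) + cnj (if - m \<in> N then c (- m) else 0)) / 2"
proof -
  have e: "complex_of_real (trig_poly N c x) * cnj (mode m x)
     = (\<Sum>n\<in>N. c n / 2 * mode (n - m) x + cnj (c n) / 2 * mode (- n - m) x)" for x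
  proof -
    have r: "complex_of_real (Re z) = (z + cnj z) / 2" for z by (simp add: complex_eq_iff)
    have "complex_of_real (trig_poly N c x) = (\<Sum>n\<in>N. c n / 2 * mode n x + cnj (c n) / 2 * mode (- n) x)"
      unfolding trig_poly_def r
      by (simp add: mode_uminus sum.distrib sum_divide_distrib[symmetric] add_divide_distrib)
    then show ?thesis
      by (simp add: sum_distrib_right mode_mult_cnj[symmetric] mode_uminus distrib_right mult.assoc)
  qed
  have iff: "- n - m = 0 \<longleftrightarrow> n = - m" for n :: "int^2"
    by (simp add: vec_eq_iff forall_2) linarith
  have i: "integrable torus (\<lambda>x. a * mode n x)" for a n
    by (intro torus_integrable_continuous continuous_intros)
  have "fourier_coeff (trig_poly N c) m
     = (\<Sum>n\<in>N. c n / 2 * (\<integral>x. mode (n - m) x \<partial>torus) + cnj (c n) / 2 * (\<integral>x. mode (- n - m) x \<partial>torus))"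
    unfolding fourier_coeff_def e using i
    by (subst Bochner_Integration.integral_sum) (auto intro!: Bochner_Integration.integrable_add)
  also have "\<dots> = (\<Sum>n\<in>N. (if n = m then c n / 2 else 0)) + (\<Sum>n\<in>N. if n = - m then cnj (c n) / 2 else 0)"
  proof -
    have "c n / 2 * (\<integral>x. mode (n - m) x \<partial>torus) = (if n = m then c n / 2 else 0)"
      "cnj (c n) / 2 * (\<integral>x. mode (- n - m) x \<partial>torus) = (if n = - m then cnj (c n) / 2 else 0)" for n
      by (simp_all only: integral_mode_torus iff) simp_all
    then show ?thesis by (simp only: sum.distrib)
  qed
  also have "\<dots> = ((if m \<in> N then c m else 0) + cnj (if - m \<in> N then c (- m) else 0)) / 2"
    using assms by (simp only: sum.delta) (simp add: add_divide_distrib)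
  finally show ?thesis .
qed

section \<open>The cutoff and the symbol of the multiplier\<close>

text \<open>The only doubtful point is where the formula for positive times meets the extension by
  0. Since \<open>\<zeta>\<close> vanishes from 1 on, the function is 0 on the whole half line below
  \<open>sqrt (1 + (norm \<xi>)\<^sup>2)\<close>, which is positive; so two overlapping open half
  lines cover all times.\<close>

lemma zeta_t_sq_derivative:
  assumes "cutoff \<zeta>"
  obtains G where "\<And>s. ((\<lambda>s. (zeta_t \<zeta> s \<xi>)\<^sup>2) has_real_derivative G s) (at s)"
    "continuous_on UNIV G" "\<And>s. s < sqrt (1 + (norm \<xi>)\<^sup>2) \<Longrightarrow> G s = 0"
proof -
  define c where "c = sqrt (1 + (norm \<xi>)\<^sup>2)"
  have c: "0 < c" unfolding c_def by (intro real_sqrt_gt_zero add_pos_nonneg) auto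
  obtain D where D: "D 0 = \<zeta>" "\<And>k s. 0 \<le> s \<Longrightarrow> (D k has_real_derivative D (Suc k) s) (at s within {0..})"
    using assms unfolding cutoff_def smooth_halfline_def by (elim conjE exE) simp
  have D': "(D k has_real_derivative D (Suc k) s) (at s)" if "0 < s" for k s
  proof -
    have "(D k has_real_derivative D (Suc k) s) (at s within {0<..})"
      by (rule DERIV_subset[OF D(2)]) (use that in auto)
    then show ?thesis using that at_within_open[of s "{0<..}"] by simp
  qed
  have \<zeta>0: "\<zeta> s = 0" if "1 \<le> s" for s using assms that by (auto simp: cutoff_def)
  define G where "G s = (if 0 < s then 2 * \<zeta> (c / s) * (D 1 (c / s) * (- c / s\<^sup>2)) else 0)" for s
  have G0: "G s = 0" if "s < c" for s
    using \<zeta>0[of "c / s"] that by (auto simp: G_def)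
  have "((\<lambda>s. (zeta_t \<zeta> s \<xi>)\<^sup>2) has_real_derivative G s) (at s)" for s
  proof (cases "0 < s")
    case True
    have 1: "((\<lambda>s. c / s) has_real_derivative (- c / s\<^sup>2)) (at s)"
      using True by (auto intro!: derivative_eq_intros simp: power2_eq_square)
    have 2: "(\<zeta> has_real_derivative D 1 (c / s)) (at (c / s))"
      using D'[of "c / s" 0] True c D(1) by simp
    have "((\<lambda>s. (\<zeta> (c / s))\<^sup>2) has_real_derivative G s) (at s)"
      using DERIV_power[OF DERIV_chain2[OF 2 1], of 2] True by (simp add: G_def mult_ac)
    then show ?thesis
      by (rule has_field_derivative_transform_within_open[where S="{0<..}"])
        (use True in \<open>auto simp: zeta_t_def c_def\<close>)
  next
    case False
    have "((\<lambda>s. 0) has_real_derivative 0) (at s)" by simp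
    then have "((\<lambda>s. (zeta_t \<zeta> s \<xi>)\<^sup>2) has_real_derivative 0) (at s)"
      by (rule has_field_derivative_transform_within_open[where S="{..<c}"])
        (use False c \<zeta>0 in \<open>auto simp: zeta_t_def c_def[symmetric]\<close>)
    then show ?thesis using False by (simp add: G_def)
  qed
  moreover have "continuous_on ({0<..} \<union> {..<c}) G"
  proof (rule continuous_on_open_Un)
    have cD: "continuous_on {0<..} (D k)" for k
      using D' by (intro continuous_at_imp_continuous_on ballI) (auto intro: DERIV_isCont)
    have 1: "continuous_on {0<..} (\<lambda>s. c / s)" by (intro continuous_intros) auto
    have 2: "(\<lambda>s. c / s) ` {0<..} \<subseteq> {0<..}" using c by auto
    have "continuous_on {0<..} (\<lambda>s. \<zeta> (c / s))" "continuous_on {0<..} (\<lambda>s. D 1 (c / s))"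
      using continuous_on_compose2[OF cD 1 2, of 0] continuous_on_compose2[OF cD 1 2, of 1] D(1) by simp_all
    then have "continuous_on {0<..} (\<lambda>s. 2 * \<zeta> (c / s) * (D 1 (c / s) * (- c / s\<^sup>2)))"
      by (intro continuous_on_mult continuous_on_const continuous_on_divide continuous_on_power continuous_on_id) auto
    then show "continuous_on {0<..} G" by (rule continuous_on_eq) (simp add: G_def)
    have "continuous_on {..<c} (\<lambda>_. 0)" by simp
    then show "continuous_on {..<c} G" by (rule continuous_on_eq) (simp add: G0)
  qed auto
  moreover have "{0<..} \<union> {..<c} = UNIV" using c by auto
  ultimately show thesis using that G0 by (auto simp: c_def)
qed

lemma sigma_t_eq:
  assumes "cutoff \<zeta>"
  shows continuous_sigma_t: "continuous_on UNIV (\<lambda>t. sigma_t \<zeta> t \<xi>)"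
    and sigma_t_eq_0: "t < sqrt (1 + (norm \<xi>)\<^sup>2) \<Longrightarrow> sigma_t \<zeta> t \<xi> = 0"
proof -
  obtain G where G: "\<And>s. ((\<lambda>s. (zeta_t \<zeta> s \<xi>)\<^sup>2) has_real_derivative G s) (at s)"
    "continuous_on UNIV G" "\<And>s. s < sqrt (1 + (norm \<xi>)\<^sup>2) \<Longrightarrow> G s = 0"
    by (rule zeta_t_sq_derivative[OF assms, where \<xi>=\<xi>]) (rule that)
  have "sigma_t \<zeta> t \<xi> = sqrt (G t)" for t
    using DERIV_imp_deriv[OF G(1)[of t]] by (simp add: sigma_t_def)
  then show "continuous_on UNIV (\<lambda>t. sigma_t \<zeta> t \<xi>)"
    "t < sqrt (1 + (norm \<xi>)\<^sup>2) \<Longrightarrow> sigma_t \<zeta> t \<xi> = 0"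
    using G by (auto intro!: continuous_intros)
qed

lemma J_symbol_0 [simp]: "J_symbol \<zeta> t 0 = 0"
  by (simp add: J_symbol_def)

lemma J_symbol_cong_norm: "norm \<xi> = norm \<eta> \<Longrightarrow> J_symbol \<zeta> t \<xi> = J_symbol \<zeta> t \<eta>"
  by (simp only: J_symbol_def sigma_t_def zeta_t_def)

lemma continuous_J_symbol: "cutoff \<zeta> \<Longrightarrow> continuous_on A (\<lambda>t. J_symbol \<zeta> t \<xi>)"
  using continuous_sigma_t[of \<zeta> \<xi>] unfolding J_symbol_def divide_inverse
  by (intro continuous_on_mult continuous_on_const) (auto intro: continuous_on_subset)

lemma J_symbol_eq_0: "cutoff \<zeta> \<Longrightarrow> t < sqrt (1 + (norm \<xi>)\<^sup>2) \<Longrightarrow> J_symbol \<zeta> t \<xi> = 0"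
  by (simp add: J_symbol_def sigma_t_eq_0)

text \<open>Outside this finite set the symbol of J vanishes at all times up to \<open>T\<close>.
  The zero mode is left out because \<open>Y_field\<close> omits it and \<open>J_symbol\<close> is 0
  there.\<close>

definition low_modes :: "real \<Rightarrow> (int^2) set" where
  "low_modes T = {n. n \<noteq> 0 \<and> sqrt (1 + (norm (rvec n))\<^sup>2) \<le> T}"

lemma finite_low_modes: "finite (low_modes T)"
proof (rule finite_subset[OF _ finite_rvec_ball[of T]])
  have "norm (rvec n) \<le> sqrt (1 + (norm (rvec n))\<^sup>2)" for n by (rule real_le_rsqrt) simp
  then show "low_modes T \<subseteq> {n. norm (rvec n) \<le> T}"
    by (auto simp: low_modes_def intro: order_trans)
qed

lemma low_modes_simps [simp]:
  "0 \<notin> low_modes T" "- n \<in> low_modes T \<longleftrightarrow> n \<in> low_modes T"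
  by (simp_all add: low_modes_def)

lemma J_symbol_eq_0_high:
  "cutoff \<zeta> \<Longrightarrow> t \<le> T \<Longrightarrow> n \<notin> low_modes T \<Longrightarrow> J_symbol \<zeta> t (rvec n) = 0"
  by (cases "n = 0") (auto simp: low_modes_def intro: J_symbol_eq_0)

section \<open>Continuous functionals of trigonometric polynomials\<close>

lemma lp_symbol_le_1:
  assumes "cutoff \<theta>" "0 \<le> r" shows "\<bar>lp_symbol \<theta> j r\<bar> \<le> 1"
proof -
  have "0 \<le> \<theta> s \<and> \<theta> s \<le> 1" if "0 \<le> s" for s
    using assms(1) that unfolding cutoff_def by (metis atLeastAtMost_iff atLeast_iff imageI subsetD)
  then have "\<theta> (r / 2 ^ k) \<in> {0..1}" for k using assms(2) by simp
  from this[of j] this[of "j - 1"] this[of 0] show ?thesis by (auto simp: lp_symbol_def)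
qed

text \<open>For \<open>j > k\<close> both scales \<open>j\<close> and \<open>j - 1\<close> are at
  least \<open>k\<close>, so both cutoffs are in the region where \<open>\<theta>\<close> is 1 and
  their difference vanishes.\<close>

lemma lp_symbol_eq_0:
  assumes "cutoff \<theta>" "0 \<le> r" "r / 2 ^ k \<le> 1 / 2" "k < j" shows "lp_symbol \<theta> j r = 0"
proof -
  have 1: "\<theta> s = 1" if "0 \<le> s" "s \<le> 1 / 2" for s using assms(1) that by (simp add: cutoff_def)
  have "r / 2 ^ i \<le> 1 / 2" if "k \<le> i" for i
    using assms(2,3) that by (smt (verit) divide_left_mono mult_pos_pos power_increasing zero_less_power)
  from this[of j] this[of "j - 1"] show ?thesis using assms by (simp add: lp_symbol_def 1)
qed

text \<open>Only finitely many Littlewood-Paley blocks meet a finite set of frequencies, so on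
  distributions supported there every Besov norm is dominated by the sum of the absolute values of
  the coefficients.\<close>

lemma besov_norm_finite_support:
  assumes \<theta>: "cutoff \<theta>" and N: "finite N"
  obtains C where "0 \<le> C" "\<And>c. (\<And>n. n \<notin> N \<Longrightarrow> c n = 0) \<Longrightarrow> besov_norm \<theta> \<beta> c \<le> ennreal (C * (\<Sum>n\<in>N. cmod (c n)))"
proof -
  define R where "R = (\<Sum>n\<in>N. norm (rvec n))"
  have R: "norm (rvec n) \<le> R" if "n \<in> N" for n
    unfolding R_def using N that by (intro member_le_sum) auto
  obtain k where k: "2 * R < 2 ^ k" using real_arch_pow[of 2 "2 * R"] by auto
  have R2: "norm (rvec n) / 2 ^ k \<le> 1 / 2" if "n \<in> N" for n
    using R[OF that] k by (simp add: field_simps)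
  define C where "C = (\<Sum>j\<le>k. 2 powr (\<beta> * (real j - 1)))"
  have C: "0 \<le> C" unfolding C_def by (intro sum_nonneg) auto
  have "besov_norm \<theta> \<beta> c \<le> ennreal (C * (\<Sum>n\<in>N. cmod (c n)))" if c: "\<And>n. n \<notin> N \<Longrightarrow> c n = 0" for c
    unfolding besov_norm_def
  proof (intro SUP_least ennreal_leI)
    fix j x
    have b: "lp_block \<theta> j c x = (\<Sum>n\<in>N. of_real (lp_symbol \<theta> j (norm (rvec n))) * c n * mode n x)"
    proof -
      have "lp_block \<theta> j c x = (\<Sum>\<^sub>\<infinity>n\<in>N. of_real (lp_symbol \<theta> j (norm (rvec n))) * c n * mode n x)"
        unfolding lp_block_def using c by (intro infsum_cong_neutral) auto
      then show ?thesis using N by simp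
    qed
    show "2 powr (\<beta> * (real j - 1)) * cmod (lp_block \<theta> j c x) \<le> C * (\<Sum>n\<in>N. cmod (c n))"
    proof (cases "j \<le> k")
      case True
      have "cmod (lp_block \<theta> j c x) \<le> (\<Sum>n\<in>N. cmod (c n))"
        unfolding b using lp_symbol_le_1[OF \<theta>]
        by (intro sum_norm_le) (auto simp: norm_mult intro: mult_left_le_one_le)
      moreover have "2 powr (\<beta> * (real j - 1)) \<le> C"
        unfolding C_def using True by (intro member_le_sum) auto
      ultimately show ?thesis using C by (intro mult_mono) auto
    next
      case False
      then have "lp_block \<theta> j c x = 0" unfolding b using lp_symbol_eq_0[OF \<theta> _ R2]
        by (intro sum.neutral) auto
      then show ?thesis using C by (simp add: sum_nonneg)
    qed
  qed
  with C show thesis by (rule that)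
qed

lemma fourier_coeff_trig_poly_outside:
  assumes "finite N" "n \<notin> N \<union> uminus ` N" shows "fourier_coeff (trig_poly N c) n = 0"
proof -
  have "n \<notin> N" "- n \<notin> N" using assms(2) by (auto simp: image_iff)
  then show ?thesis using assms(1) by (simp add: fourier_coeff_trig_poly)
qed

lemma trig_poly_in_C_besov:
  assumes "cutoff \<theta>" "finite N" shows "fourier_coeff (trig_poly N c) \<in> C_besov \<theta> \<beta>"
proof -
  have N: "finite (N \<union> uminus ` N)" using assms by simp
  obtain C where C: "0 \<le> C" "\<And>c. (\<And>n. n \<notin> N \<union> uminus ` N \<Longrightarrow> c n = 0) \<Longrightarrow>
      besov_norm \<theta> \<beta> c \<le> ennreal (C * (\<Sum>n\<in>N \<union> uminus ` N. cmod (c n)))"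
    using besov_norm_finite_support[OF assms(1) N] by blast
  have "besov_norm \<theta> \<beta> (fourier_coeff (trig_poly N c)) < \<infinity>"
    using C(2)[of "fourier_coeff (trig_poly N c)"] fourier_coeff_trig_poly_outside[OF assms(2)]
    by (auto simp: less_top[symmetric] top_unique)
  moreover have "real_distribution (fourier_coeff (trig_poly N c))"
    by (simp add: real_distribution_def fourier_coeff_trig_poly assms(2) add.commute)
  moreover have "besov_norm \<theta> \<beta> (\<lambda>n. 0) = 0"
    using C(2)[of "\<lambda>_. 0"] by simp
  then have "\<exists>g. smooth_torus g \<and> besov_norm \<theta> \<beta> (\<lambda>n. fourier_coeff (trig_poly N c) n - fourier_coeff g n) < ennreal \<epsilon>"
    if "0 < \<epsilon>" for \<epsilon>
    \<comment> \<open>A trigonometric polynomial is smooth and approximates itself.\<close>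
    using that by (intro exI[of _ "trig_poly N c"]) (simp add: smooth_torus_trig_poly)
  ultimately show ?thesis by (simp add: C_besov_def)
qed

text \<open>Since \<open>f\<close> is only defined on distributions, its measurability is obtained
  through coefficients: restricted to a finite set of frequencies it is continuous for the product
  topology, by the Besov bound for finite support.\<close>

lemma continuous_functional_measurable:
  assumes f: "continuous_functional \<theta> \<beta> f" and \<theta>: "cutoff \<theta>" and N: "finite N"
  shows "(\<lambda>c. f (fourier_coeff (trig_poly N c))) \<in> borel_measurable borel"
proof (rule borel_measurable_continuous_onI)
  let ?M = "N \<union> uminus ` N"
  have M: "finite ?M" using N by simp
  obtain C where C: "0 \<le> C" "\<And>c. (\<And>n. n \<notin> ?M \<Longrightarrow> c n = 0) \<Longrightarrow>
      besov_norm \<theta> \<beta> c \<le> ennreal (C * (\<Sum>n\<in>?M. cmod (c n)))"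
    using besov_norm_finite_support[OF \<theta> M] by blast
  let ?h = "\<lambda>c. fourier_coeff (trig_poly N c)"
  have h: "continuous_on UNIV (\<lambda>d. ?h d n)" for n
    unfolding fourier_coeff_trig_poly[OF N]
    by (cases "n \<in> N"; cases "- n \<in> N") (auto intro!: continuous_intros continuous_on_product_coordinates)
  show "continuous_on UNIV (\<lambda>c. f (?h c))"
    unfolding continuous_on_def
  proof (intro ballI tendstoI)
    fix c :: "int^2 \<Rightarrow> complex" and \<epsilon> :: real assume \<epsilon>: "0 < \<epsilon>"
    obtain \<eta> where \<eta>: "0 < \<eta>" "\<And>d. d \<in> C_besov \<theta> \<beta> \<Longrightarrow>
        besov_norm \<theta> \<beta> (\<lambda>n. d n - ?h c n) < ennreal \<eta> \<Longrightarrow> \<bar>f d - f (?h c)\<bar> < \<epsilon>"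
      using f \<epsilon> trig_poly_in_C_besov[OF \<theta> N] unfolding continuous_functional_def by meson
    let ?s = "\<lambda>d. C * (\<Sum>n\<in>?M. cmod (?h d n - ?h c n))"
    have "continuous_on UNIV ?s" by (intro continuous_intros h)
    then have "(?s \<longlongrightarrow> ?s c) (at c)" unfolding continuous_on_def by blast
    then have "eventually (\<lambda>d. ?s d < \<eta>) (at c)"
      using \<eta>(1) by (intro order_tendstoD(2)[where a=\<eta> and y="?s c"]) auto
    then show "eventually (\<lambda>d. dist (f (?h d)) (f (?h c)) < \<epsilon>) (at c within UNIV)"
    proof eventually_elim
      case (elim d)
      have "besov_norm \<theta> \<beta> (\<lambda>n. ?h d n - ?h c n) \<le> ennreal (?s d)"
        using fourier_coeff_trig_poly_outside[OF N] by (intro C(2)) auto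
      also have "\<dots> < ennreal \<eta>" using elim C(1) by (intro ennreal_lessI \<eta>(1)) auto
      finally show ?case using \<eta>(2)[OF trig_poly_in_C_besov[OF \<theta> N]] by (simp add: dist_real_def)
    qed
  qed
qed

section \<open>Measurable functionals on the space of square integrable functions\<close>

lemma borel_measurable_torus [simp]: "borel_measurable torus = borel_measurable borel"
  by (rule measurable_cong_sets) simp_all

lemma L2_dot_sq_int: "v \<in> L2_dot \<Longrightarrow> sq_int torus v"
  by (simp add: L2_dot_def sq_int_def)

lemma l2_norm_nonneg [simp]: "0 \<le> l2_norm v"
  by (simp add: l2_norm_def)

lemma l2_norm_triangle:
  assumes "sq_int torus v" "sq_int torus w"
  shows "l2_norm (\<lambda>x. v x + w x) \<le> l2_norm v + l2_norm w"
proof -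
  note [simp] = sq_intD[OF assms(1)] sq_intD[OF assms(2)] sq_int_mult_integrable[OF assms]
  have sq: "(l2_norm g)\<^sup>2 = (\<integral>x. (g x)\<^sup>2 \<partial>torus)" for g by (simp add: l2_norm_def)
  have "\<bar>\<integral>x. v x * w x \<partial>torus\<bar> \<le> l2_norm v * l2_norm w"
    using real_sqrt_le_mono[OF Cauchy_Schwarz_integral[OF assms]] by (simp add: real_sqrt_mult l2_norm_def)
  moreover have "(\<integral>x. (v x + w x)\<^sup>2 \<partial>torus) = (\<integral>x. (v x)\<^sup>2 + 2 * (v x * w x) + (w x)\<^sup>2 \<partial>torus)"
    by (intro Bochner_Integration.integral_cong) (auto simp: power2_eq_square algebra_simps)
  ultimately have "(l2_norm (\<lambda>x. v x + w x))\<^sup>2 \<le> (l2_norm v + l2_norm w)\<^sup>2"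
    by (simp add: sq power2_sum)
  then show ?thesis by (rule power2_le_imp_le) simp
qed

lemma integral_abs_le_l2_norm:
  assumes "sq_int torus v" shows "(\<integral>x. \<bar>v x\<bar> \<partial>torus) \<le> l2_norm v"
proof -
  have "(\<integral>x. \<bar>v x\<bar> * 1 \<partial>torus)\<^sup>2 \<le> (\<integral>x. \<bar>v x\<bar>\<^sup>2 \<partial>torus) * (\<integral>x. 1\<^sup>2 \<partial>torus)"
    using assms by (intro Cauchy_Schwarz_integral) (auto simp: sq_int_def)
  then show ?thesis
    unfolding l2_norm_def using torus.prob_space by (intro real_le_rsqrt) simp
qed

lemma fourier_coeff_integrable:
  assumes "sq_int torus v" shows "integrable torus (\<lambda>x. complex_of_real (v x) * cnj (mode n x))"
proof (rule Bochner_Integration.integrable_bound)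
  show "integrable torus v" using torus.sq_int_integrable[OF assms] .
  show "(\<lambda>x. complex_of_real (v x) * cnj (mode n x)) \<in> borel_measurable torus"
    using sq_intD(1)[OF assms] by (simp flip: mode_uminus)
qed (simp add: norm_mult)

lemma cmod_fourier_coeff_le:
  assumes "sq_int torus v" shows "cmod (fourier_coeff v n) \<le> l2_norm v"
proof -
  have "cmod (fourier_coeff v n) \<le> (\<integral>x. cmod (complex_of_real (v x) * cnj (mode n x)) \<partial>torus)"
    unfolding fourier_coeff_def by (rule integral_norm_bound)
  also have "\<dots> \<le> l2_norm v" using integral_abs_le_l2_norm[OF assms] by (simp add: norm_mult)
  finally show ?thesis .
qed

lemma fourier_coeff_diff:
  assumes "sq_int torus v" "sq_int torus w"
  shows "fourier_coeff (\<lambda>x. v x - w x) n = fourier_coeff v n - fourier_coeff w n"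
  unfolding fourier_coeff_def
  using fourier_coeff_integrable[OF assms(1)] fourier_coeff_integrable[OF assms(2)]
  by (simp add: left_diff_distrib)

text \<open>Preimages of open sets under a 1-Lipschitz map are open for the seminorm, hence among
  the generators of the sigma algebra.\<close>

lemma L2_dot_borel_measurableI:
  fixes \<Phi> :: "(real^2 \<Rightarrow> real) \<Rightarrow> 'b::metric_space"
  assumes "\<And>v w. v \<in> L2_dot \<Longrightarrow> w \<in> L2_dot \<Longrightarrow> dist (\<Phi> w) (\<Phi> v) \<le> l2_norm (\<lambda>x. w x - v x)"
  shows "\<Phi> \<in> borel_measurable L2_dot_borel"
proof (rule borel_measurableI)
  fix S :: "'b set" assume S: "open S"
  let ?G = "{U. U \<subseteq> L2_dot \<and> (\<forall>v\<in>U. \<exists>\<epsilon>>0. \<forall>w\<in>L2_dot. l2_norm (\<lambda>x. w x - v x) < \<epsilon> \<longrightarrow> w \<in> U)}"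
  have "\<Phi> -` S \<inter> L2_dot \<in> ?G"
  proof (intro CollectI conjI ballI)
    fix v assume v: "v \<in> \<Phi> -` S \<inter> L2_dot"
    then obtain \<epsilon> where "0 < \<epsilon>" "\<And>y. dist y (\<Phi> v) < \<epsilon> \<Longrightarrow> y \<in> S"
      using S unfolding open_dist by auto
    then show "\<exists>\<epsilon>>0. \<forall>w\<in>L2_dot. l2_norm (\<lambda>x. w x - v x) < \<epsilon> \<longrightarrow> w \<in> \<Phi> -` S \<inter> L2_dot"
      using assms v by (intro exI[of _ \<epsilon>]) (auto intro: le_less_trans)
  qed simp
  moreover have "?G \<subseteq> Pow L2_dot" by auto
  ultimately show "\<Phi> -` S \<inter> space L2_dot_borel \<in> sets L2_dot_borel"
    unfolding L2_dot_borel_def by (simp add: space_measure_of_conv sigma_sets.Basic)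
qed

lemma space_L2_dot_borel: "space L2_dot_borel = L2_dot"
  by (simp add: L2_dot_borel_def space_measure_of_conv)

lemma fourier_coeff_L2_dot_measurable: "(\<lambda>v. fourier_coeff v n) \<in> borel_measurable L2_dot_borel"
  using cmod_fourier_coeff_le[OF sq_int_diff] L2_dot_sq_int
  by (intro L2_dot_borel_measurableI) (simp add: dist_norm fourier_coeff_diff[symmetric])

lemma l2_norm_L2_dot_measurable: "l2_norm \<in> borel_measurable L2_dot_borel"
proof (rule L2_dot_borel_measurableI)
  fix v w assume "v \<in> L2_dot" "w \<in> L2_dot"
  then have s: "sq_int torus v" "sq_int torus w" by (auto intro: L2_dot_sq_int)
  have "l2_norm w \<le> l2_norm v + l2_norm (\<lambda>x. w x - v x)"
    using l2_norm_triangle[OF s(1) sq_int_diff[OF s(2,1)]] by simp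
  moreover have "l2_norm v \<le> l2_norm w + l2_norm (\<lambda>x. v x - w x)"
    using l2_norm_triangle[OF s(2) sq_int_diff[OF s]] by simp
  moreover have "l2_norm (\<lambda>x. v x - w x) = l2_norm (\<lambda>x. w x - v x)"
    by (simp add: l2_norm_def power2_commute)
  ultimately show "dist (l2_norm w) (l2_norm v) \<le> l2_norm (\<lambda>x. w x - v x)"
    by (simp add: dist_real_def)
qed

section \<open>The Gaussian field\<close>

definition L2_conv :: "'a measure \<Rightarrow> (nat \<Rightarrow> 'a \<Rightarrow> real) \<Rightarrow> ('a \<Rightarrow> real) \<Rightarrow> bool" where
  "L2_conv M X Y \<longleftrightarrow> (\<forall>m. X m \<in> borel_measurable M) \<and> Y \<in> borel_measurable M \<and>
     (\<lambda>m. msq M (\<lambda>\<omega>. X m \<omega> - Y \<omega>)) \<longlonglongrightarrow> 0"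

lemma L2_conv_add:
  assumes "L2_conv M X Y" "L2_conv M X' Y'"
  shows "L2_conv M (\<lambda>m \<omega>. X m \<omega> + X' m \<omega>) (\<lambda>\<omega>. Y \<omega> + Y' \<omega>)"
proof -
  have [measurable]: "X m \<in> borel_measurable M" "X' m \<in> borel_measurable M" "Y \<in> borel_measurable M" "Y' \<in> borel_measurable M" for m
    using assms by (auto simp: L2_conv_def)
  have le: "msq M (\<lambda>\<omega>. X m \<omega> + X' m \<omega> - (Y \<omega> + Y' \<omega>))
    \<le> 2 * (msq M (\<lambda>\<omega>. X m \<omega> - Y \<omega>)) + 2 * (msq M (\<lambda>\<omega>. X' m \<omega> - Y' \<omega>))" for m
    using nn_sq_triangle[of "\<lambda>\<omega>. X m \<omega> - Y \<omega>" M "\<lambda>\<omega>. X' m \<omega> - Y' \<omega>"] by (simp add: algebra_simps)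
  have lim: "(\<lambda>m. 2 * (msq M (\<lambda>\<omega>. X m \<omega> - Y \<omega>)) + 2 * (msq M (\<lambda>\<omega>. X' m \<omega> - Y' \<omega>))) \<longlonglongrightarrow> 2 * 0 + 2 * 0"
    using assms unfolding L2_conv_def by (intro tendsto_add ennreal_tendsto_cmult) auto
  have "(\<lambda>m. msq M (\<lambda>\<omega>. X m \<omega> + X' m \<omega> - (Y \<omega> + Y' \<omega>))) \<longlonglongrightarrow> 0"
    by (rule tendsto_sandwich[OF _ _ tendsto_const[of 0] lim[simplified]]) (use le in auto)
  then show ?thesis unfolding L2_conv_def by simp
qed

lemma L2_conv_cmult:
  assumes "L2_conv M X Y"
  shows "L2_conv M (\<lambda>m \<omega>. a * X m \<omega>) (\<lambda>\<omega>. a * Y \<omega>)"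
proof -
  have [measurable]: "X m \<in> borel_measurable M" "Y \<in> borel_measurable M" for m
    using assms by (auto simp: L2_conv_def)
  have "msq M (\<lambda>\<omega>. a * X m \<omega> - a * Y \<omega>) = ennreal (a\<^sup>2) * (msq M (\<lambda>\<omega>. X m \<omega> - Y \<omega>))" for m
    by (subst nn_integral_cmult[symmetric])
      (auto simp: ennreal_mult[symmetric] power_mult_distrib[symmetric] right_diff_distrib)
  moreover have "(\<lambda>m. ennreal (a\<^sup>2) * (msq M (\<lambda>\<omega>. X m \<omega> - Y \<omega>))) \<longlonglongrightarrow> ennreal (a\<^sup>2) * 0"
    using assms unfolding L2_conv_def by (intro ennreal_tendsto_cmult) auto
  ultimately show ?thesis unfolding L2_conv_def by simp
qed

lemma L2_conv_sum:
  assumes "\<And>i. i \<in> I \<Longrightarrow> L2_conv M (X i) (Y i)"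
  shows "L2_conv M (\<lambda>m \<omega>. \<Sum>i\<in>I. X i m \<omega>) (\<lambda>\<omega>. \<Sum>i\<in>I. Y i \<omega>)"
  using assms
proof (induction I rule: infinite_finite_induct)
  case (insert i I)
  then show ?case using L2_conv_add[of M "X i" "Y i"] by simp
qed (simp_all add: L2_conv_def)

text \<open>One representative of each pair of opposite modes: independence of the Brownian motions
  holds only for families without opposite modes.\<close>

definition half_modes :: "real \<Rightarrow> (int^2) set" where
  "half_modes t = {n \<in> low_modes t. 0 < n $ 1 \<or> (n $ 1 = 0 \<and> 0 < n $ 2)}"

lemma half_modes_disjoint: "half_modes t \<inter> uminus ` half_modes t = {}"
  by (auto simp: half_modes_def)

lemma finite_half_modes: "finite (half_modes t)"
  using finite_low_modes by (simp add: half_modes_def)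

lemma half_modes_nonzero: "0 \<notin> half_modes t"
  by (simp add: half_modes_def)

lemma sum_half_modes:
  fixes g :: "int^2 \<Rightarrow> 'b::comm_monoid_add"
  shows "(\<Sum>n\<in>low_modes t. g n) = (\<Sum>n\<in>half_modes t. g n + g (- n))"
proof -
  have "n \<in> half_modes t \<union> uminus ` half_modes t" if "n \<in> low_modes t" for n
  proof (rule ccontr)
    assume a: "n \<notin> half_modes t \<union> uminus ` half_modes t"
    then have "n \<notin> half_modes t" "- n \<notin> half_modes t" by (auto simp: image_iff)
    then have "n $ 1 = 0 \<and> n $ 2 = 0" using that by (auto simp: half_modes_def)
    then have "n = 0" by (simp add: vec_eq_iff forall_2)
    then show False using that by simp
  qed
  then have "low_modes t = half_modes t \<union> uminus ` half_modes t"
    by (auto simp: half_modes_def)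
  then have "(\<Sum>n\<in>low_modes t. g n) = (\<Sum>n\<in>half_modes t. g n) + (\<Sum>n\<in>uminus ` half_modes t. g n)"
    using half_modes_disjoint finite_half_modes by (simp add: sum.union_disjoint)
  also have "(\<Sum>n\<in>uminus ` half_modes t. g n) = (\<Sum>n\<in>half_modes t. g (- n))"
    by (subst sum.reindex) (auto simp: inj_on_def)
  finally show ?thesis by (simp add: sum.distrib)
qed

section \<open>Brownian increments on Wiener space\<close>

locale wiener_space =
  fixes \<alpha> :: real and P :: "path measure"
  assumes wiener: "wiener_measure \<alpha> P"
begin

abbreviation M :: "path measure" where "M \<equiv> completion P"
abbreviation F :: "real \<Rightarrow> path measure" where "F \<equiv> wiener_filtration P"

sublocale P: prob_space P using wiener by (simp add: wiener_measure_def)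
sublocale M: prob_space M by (rule P.prob_space_completion)

lemma space_P: "space P = path_space \<alpha>"
proof -
  have "space P = space (path_borel \<alpha>)"
    using wiener sets_eq_imp_space_eq by (auto simp: wiener_measure_def)
  then show ?thesis by (simp add: path_borel_def space_measure_of_conv)
qed

lemma path_uminus: "\<omega> \<in> space P \<Longrightarrow> 0 \<le> t \<Longrightarrow> \<omega> t (- n) = cnj (\<omega> t n)"
  unfolding space_P path_space_def H_dot_def real_distribution_def by auto

lemma path_0: "\<omega> \<in> space P \<Longrightarrow> 0 \<le> t \<Longrightarrow> \<omega> t 0 = 0"
  unfolding space_P path_space_def H_dot_def by auto

text \<open>Measurability of the modes is hidden in the independence hypothesis, which is applied to
  the single mode \<open>n\<close>; this requires \<open>- n \<noteq> n\<close>.\<close>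

lemma coordinate_measurable:
  assumes t: "0 \<le> t" shows "(\<lambda>\<omega>. \<omega> t n) \<in> borel_measurable P"
proof (cases "n = 0")
  case True
  have "(\<lambda>\<omega>. \<omega> t n) \<in> borel_measurable P \<longleftrightarrow> (\<lambda>\<omega>. 0 :: complex) \<in> borel_measurable P"
    using path_0 t True by (intro measurable_cong) auto
  then show ?thesis by simp
next
  case False
  have "- n \<noteq> n"
  proof
    assume e: "- n = n"
    have "n $ i = 0" for i using arg_cong[OF e, of "\<lambda>n. n $ i"] by simp
    then show False using False by (simp add: vec_eq_iff)
  qed
  then have "P.indep_vars (\<lambda>_. Pi\<^sub>M {0..} (\<lambda>_. borel)) (\<lambda>n \<omega>. \<lambda>t\<in>{0..}. \<omega> t n) {n}"
    using wiener False by (auto simp: wiener_measure_def)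
  then have m: "(\<lambda>\<omega>. \<lambda>t\<in>{0..}. \<omega> t n) \<in> measurable P (Pi\<^sub>M {0..} (\<lambda>_. borel))"
    by (auto simp: P.indep_vars_def)
  from measurable_compose[OF m measurable_component_singleton[of t "{0..}"]] t
  show ?thesis by simp
qed

text \<open>The null sets of the completion belong to every sigma algebra of the filtration, which
  is therefore considered inside \<open>M\<close> and not inside \<open>P\<close>.\<close>

lemma filtered: "filtered_prob_space M F"
proof
  let ?G = "\<lambda>t. {(\<lambda>\<omega>. \<omega> s n) -` A \<inter> space P |s n A. 0 \<le> s \<and> s \<le> t \<and> A \<in> sets borel} \<union> null_sets M"
  have sub: "?G t \<subseteq> sets M" for t
    using measurable_sets[OF measurable_completion[OF coordinate_measurable]] by auto
  have Pow: "?G t \<subseteq> Pow (space P)" for t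
    using sub[of t] sets.sets_into_space[of _ M] unfolding space_completion by blast
  have sp: "space (F t) = space P" for t
    by (simp add: wiener_filtration_def space_measure_of_conv)
  have se: "sets (F t) = sigma_sets (space P) (?G t)" for t
    unfolding wiener_filtration_def using Pow[of t] by (rule sets_measure_of)
  show "subalgebra M (F t)" if "0 \<le> t" for t
    unfolding subalgebra_def sp se using sets.sigma_sets_subset[OF sub[of t]] by simp
  show "subalgebra (F t) (F s)" if "0 \<le> s" "s \<le> t" for s t
  proof -
    have "?G s \<subseteq> ?G t"
      using that(2) by (intro Un_mono subset_refl Collect_mono) (blast intro: order_trans)
    then show ?thesis unfolding subalgebra_def sp se by (intro conjI refl sigma_sets_mono')
  qed
qed

sublocale filtered_prob_space M F by (rule filtered)

lemma brownian_increment: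
  assumes n: "n \<noteq> 0" and st: "0 \<le> s" "s < t"
  shows "centred_gaussian P (\<lambda>\<omega>. a * Re (\<omega> t n - \<omega> s n) + b * Im (\<omega> t n - \<omega> s n)) ((a\<^sup>2 + b\<^sup>2) * ((t - s) / 2))"
proof -
  have "complex_brownian_motion P (\<lambda>t \<omega>. \<omega> t n)" using wiener n by (simp add: wiener_measure_def)
  then have re: "distributed P lborel (\<lambda>\<omega>. Re (\<omega> t n - \<omega> s n)) (normal_density 0 (sqrt ((t - s) / 2)))"
    and im: "distributed P lborel (\<lambda>\<omega>. Im (\<omega> t n - \<omega> s n)) (normal_density 0 (sqrt ((t - s) / 2)))"
    and ind: "P.indep_var borel (\<lambda>\<omega>. Re (\<omega> t n - \<omega> s n)) borel (\<lambda>\<omega>. Im (\<omega> t n - \<omega> s n))"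
    using st unfolding complex_brownian_motion_def by blast+
  have pos: "0 < sqrt ((t - s) / 2)" and sq: "(sqrt ((t - s) / 2))\<^sup>2 = (t - s) / 2" using st by auto
  have ind': "P.indep_var borel (\<lambda>\<omega>. a * Re (\<omega> t n - \<omega> s n)) borel (\<lambda>\<omega>. b * Im (\<omega> t n - \<omega> s n))"
    using P.indep_var_compose[OF ind, of "\<lambda>x. a * x" borel "\<lambda>x. b * x" borel] by (simp add: o_def)
  from P.centred_gaussian_add[OF ind' centred_gaussian_cmult[OF P.centred_gaussian_normal[OF re pos]]
      centred_gaussian_cmult[OF P.centred_gaussian_normal[OF im pos]]]
  show ?thesis unfolding sq by (simp add: distrib_right add_divide_distrib)
qed

text \<open>The time points increase strictly because the normal density in the hypothesis on
  increments is only available for positive duration.\<close>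

lemma brownian_functional:
  assumes n: "n \<noteq> 0" and r: "mono_on {..m} r" "0 \<le> r 0" "\<And>i. i < m \<Longrightarrow> r i < r (Suc i)"
  shows "centred_gaussian P (\<lambda>\<omega>. \<Sum>i<m. a i * Re (\<omega> (r (Suc i)) n - \<omega> (r i) n) + b i * Im (\<omega> (r (Suc i)) n - \<omega> (r i) n))
     (\<Sum>i<m. ((a i)\<^sup>2 + (b i)\<^sup>2) * ((r (Suc i) - r i) / 2))"
proof (rule P.centred_gaussian_sum)
  have "complex_brownian_motion P (\<lambda>t \<omega>. \<omega> t n)" using wiener n by (simp add: wiener_measure_def)
  then have ind: "P.indep_vars (\<lambda>_. borel) (\<lambda>i \<omega>. \<omega> (r (Suc i)) n - \<omega> (r i) n) {..<m}"
    using r(1,2) unfolding complex_brownian_motion_def by blast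
  show "P.indep_vars (\<lambda>_. borel) (\<lambda>i \<omega>. a i * Re (\<omega> (r (Suc i)) n - \<omega> (r i) n) + b i * Im (\<omega> (r (Suc i)) n - \<omega> (r i) n)) {..<m}"
    by (rule P.indep_vars_compose2[OF ind, where Y="\<lambda>i z. a i * Re z + b i * Im z"]) auto
  fix i assume i: "i \<in> {..<m}"
  have "r 0 \<le> r i" using r(1) i by (auto simp: mono_on_def)
  then show "centred_gaussian P (\<lambda>\<omega>. a i * Re (\<omega> (r (Suc i)) n - \<omega> (r i) n) + b i * Im (\<omega> (r (Suc i)) n - \<omega> (r i) n))
      (((a i)\<^sup>2 + (b i)\<^sup>2) * ((r (Suc i) - r i) / 2))"
    using r i by (intro brownian_increment n) auto
qed

end

section \<open>The field as a finite Fourier sum and its covariance\<close>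

locale gaussian_field = wiener_space +
  fixes \<zeta> :: "real \<Rightarrow> real" and W :: "int^2 \<Rightarrow> real \<Rightarrow> path \<Rightarrow> complex" and q :: paths2
  assumes \<zeta>: "cutoff \<zeta>"
    and Y_coeff: "\<And>n. n \<noteq> 0 \<Longrightarrow> Y_coefficient \<zeta> P n (W n)"
    and qv: "\<And>i j x. quadratic_covariation M F (dY W i x) (dY W j x) (\<lambda>t \<omega>. q i j t)"
begin

lemma ito_W:
  assumes "n \<noteq> 0" "h \<in> {Re, Im}"
  shows "ito_integral M F (\<lambda>t \<omega>. h (\<omega> t n)) (\<lambda>t \<omega>. t / 2)
    (\<lambda>s \<omega>. J_symbol \<zeta> s (rvec n)) (\<lambda>t \<omega>. h (W n t \<omega>))"
  using Y_coeff[OF assms(1)] assms(2) by (auto simp: Y_coefficient_def)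

lemma mart_W:
  assumes "n \<noteq> 0" "h \<in> {Re, Im}" shows "martingale_det_qv M F (\<lambda>t \<omega>. h (\<omega> t n)) (\<lambda>t. t / 2)"
  using ito_W[OF assms]
  by (auto simp: ito_integral_def intro!: martingale_det_qv.intro filtered martingale_det_qv_axioms.intro)

lemma mart_dY: "martingale_det_qv M F (dY W i x) (q i i)"
  using qv by (intro martingale_det_qv.intro filtered martingale_det_qv_axioms.intro)

lemma W_measurable:
  assumes "n \<noteq> 0" "0 \<le> t" shows "W n t \<in> borel_measurable M"
proof -
  have "(\<lambda>\<omega>. h (W n t \<omega>)) \<in> borel_measurable M" if h: "h \<in> {Re, Im}" for h
    by (rule martingale_det_qv.ito_measurable[OF mart_W[OF assms(1) h] ito_W[OF assms(1) h] assms(2)])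
  then show ?thesis by (subst borel_measurable_complex_iff) simp
qed

text \<open>The integrand vanishes up to time \<open>t\<close>, so the second moment bound for Ito
  integrals is 0.\<close>

lemma W_high_mode:
  assumes n: "n \<noteq> 0" "n \<notin> low_modes t" and t: "0 \<le> t"
  shows "AE \<omega> in M. W n t \<omega> = 0"
proof -
  have J: "(\<integral>\<^sup>+s\<in>{0..t}. msq M (\<lambda>\<omega>. J_symbol \<zeta> s (rvec n)) \<partial>\<mu>) = 0" for \<mu>
  proof -
    have z: "(msq M (\<lambda>\<omega>. J_symbol \<zeta> s (rvec n))) * indicator {0..t} s = 0" for s
      using J_symbol_eq_0_high[OF \<zeta> _ n(2), of s] by (cases "s \<le> t") (simp_all add: indicator_def)
    show ?thesis unfolding z by simp
  qed
  have "AE \<omega> in M. h (W n t \<omega>) = 0" if h: "h \<in> {Re, Im}" for h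
  proof -
    have "msq M (\<lambda>\<omega>. h (W n t \<omega>)) = 0"
      using martingale_det_qv.ito_second_moment[OF mart_W[OF n(1) h] ito_W[OF n(1) h] t] by (simp only: J) simp
    then show ?thesis
      using W_measurable[OF n(1) t] h by (subst (asm) nn_integral_0_iff_AE) auto
  qed
  from this[of Re] this[of Im] have "AE \<omega> in M. Re (W n t \<omega>) = 0" "AE \<omega> in M. Im (W n t \<omega>) = 0" by simp_all
  then show ?thesis by eventually_elim (simp add: complex_eq_iff)
qed

text \<open>Each coefficient of high frequency vanishes off a null set, and there are countably many
  of them. The exceptional set depends on \<open>t\<close>, which does no harm since only fixed
  times are used.\<close>

lemma Y_field_eq:
  assumes t: "0 \<le> t"
  shows "AE \<omega> in M. Y_field W t \<omega> = trig_poly (low_modes t) (\<lambda>n. W n t \<omega>)"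
proof -
  have "AE \<omega> in M. n \<noteq> 0 \<longrightarrow> n \<notin> low_modes t \<longrightarrow> W n t \<omega> = 0" for n
    using W_high_mode[OF _ _ t] by (cases "n \<noteq> 0 \<and> n \<notin> low_modes t") auto
  then have "AE \<omega> in M. \<forall>n. n \<noteq> 0 \<longrightarrow> n \<notin> low_modes t \<longrightarrow> W n t \<omega> = 0"
    by (simp add: AE_all_countable)
  then show ?thesis
  proof eventually_elim
    case (elim \<omega>)
    have "(\<Sum>\<^sub>\<infinity>n\<in>UNIV - {0}. W n t \<omega> * mode n x) = (\<Sum>\<^sub>\<infinity>n\<in>low_modes t. W n t \<omega> * mode n x)" for x
      using elim by (intro infsum_cong_neutral) (auto simp: low_modes_def)
    then show ?case
      by (auto simp: Y_field_def trig_poly_def finite_low_modes fun_eq_iff)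
  qed
qed

lemma dY_eq:
  assumes t: "0 \<le> t"
  shows "AE \<omega> in M. \<forall>i x. dY W i x t \<omega> = trig_poly (low_modes t) (\<lambda>n. \<i> * of_int (n $ i) * W n t \<omega>) x"
  using Y_field_eq[OF t] by eventually_elim (simp add: dY_def grad_trig_poly)

lemma dY_0: "AE \<omega> in M. dY W i x 0 \<omega> = 0"
proof -
  have "low_modes 0 = {}" by (auto simp: low_modes_def not_le intro: add_pos_nonneg)
  then show ?thesis using dY_eq[of 0] by (auto simp: trig_poly_def)
qed

lemma dY_sq_int: "0 \<le> t \<Longrightarrow> sq_int M (dY W i x t)"
  by (rule martingale_det_qv.N_sq_int[OF mart_dY])

text \<open>The product minus the covariation is a martingale starting at 0, so its mean stays 0. In
  particular the covariance does not depend on \<open>x\<close>.\<close>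

lemma dY_covariance:
  assumes t: "0 \<le> t"
  shows "(\<integral>\<omega>. dY W i x t \<omega> * dY W j x t \<omega> \<partial>M) = q i j t"
proof -
  have m: "martingale M F (\<lambda>t \<omega>. dY W i x t \<omega> * dY W j x t \<omega> - q i j t)"
    and q0: "q i j 0 = 0"
    using qv[of i x j] by (auto simp: quadratic_covariation_def)
  have int: "integrable M (\<lambda>\<omega>. dY W i x s \<omega> * dY W j x s \<omega>)" if "0 \<le> s" for s
    by (intro sq_int_mult_integrable dY_sq_int that)
  have "(\<integral>\<omega>. 1 * (dY W i x t \<omega> * dY W j x t \<omega> - q i j t) \<partial>M) = (\<integral>\<omega>. 1 * (dY W i x 0 \<omega> * dY W j x 0 \<omega> - q i j 0) \<partial>M)"
    using t int[OF t] by (intro martingale_integral_mult[OF m]) auto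
  also have "\<dots> = 0"
  proof -
    have "(\<integral>\<omega>. 1 * (dY W i x 0 \<omega> * dY W j x 0 \<omega> - q i j 0) \<partial>M) = (\<integral>\<omega>. 0 \<partial>M)"
    proof (rule integral_cong_AE)
      show "AE \<omega> in M. 1 * (dY W i x 0 \<omega> * dY W j x 0 \<omega> - q i j 0) = 0"
        using dY_0[of i x] by eventually_elim (simp add: q0)
    qed (use int[of 0] in auto)
    then show ?thesis by simp
  qed
  finally show ?thesis using int[OF t] by (simp add: P.prob_space)
qed

lemma q_sym: "0 \<le> t \<Longrightarrow> q i j t = q j i t"
  using dY_covariance[of t i 0 j] dY_covariance[of t j 0 i] by (simp add: mult.commute)

section \<open>Riemann sums and the Gaussian law of the gradient\<close>

definition grid :: "real \<Rightarrow> nat \<Rightarrow> nat \<Rightarrow> real" where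
  "grid t m i = real i * t / real (Suc m)"

text \<open>Values at left endpoints on \<open>Suc m\<close> intervals, so that the mesh is also
  defined for \<open>m = 0\<close>. The coefficients are deterministic, hence the integrals are
  linear in Brownian increments.\<close>

definition J_step :: "real \<Rightarrow> int^2 \<Rightarrow> nat \<Rightarrow> path simple" where
  "J_step t n m = (Suc m, grid t m, \<lambda>i \<omega>. J_symbol \<zeta> (grid t m i) (rvec n))"

lemma grid_mono: "0 \<le> t \<Longrightarrow> i \<le> j \<Longrightarrow> grid t m i \<le> grid t m j"
  by (auto simp: grid_def intro!: divide_right_mono mult_right_mono)

lemma grid_less: "0 < t \<Longrightarrow> grid t m i < grid t m (Suc i)"
  by (auto simp: grid_def intro!: divide_strict_right_mono)

lemma grid_0 [simp]: "grid t m 0 = 0"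
  and grid_last [simp]: "grid t m (Suc m) = t"
  by (simp_all add: grid_def)

lemma grid_Suc: "grid t m (Suc i) - grid t m i = t / real (Suc m)"
  by (simp add: grid_def diff_divide_distrib[symmetric] distrib_right del: of_nat_Suc) (simp add: distrib_right)

lemma grid_nonneg: "0 \<le> t \<Longrightarrow> 0 \<le> grid t m i"
  by (simp add: grid_def)

lemma grid_le: "0 \<le> t \<Longrightarrow> i \<le> Suc m \<Longrightarrow> grid t m i \<le> t"
  using grid_mono[of t i "Suc m" m] by simp

lemma J_step_simple: "0 \<le> t \<Longrightarrow> simple_process M F (J_step t n m)"
  unfolding simple_process_def J_step_def prod.case
  by (auto intro!: mono_onI grid_mono)

lemma J_step_value:
  assumes t: "0 < t" and s: "0 \<le> s" "s \<le> t"
  shows "\<exists>r\<in>{0..t}. \<bar>r - s\<bar> \<le> t / real (Suc m) \<and> simple_value (J_step t n m) s \<omega> = J_symbol \<zeta> r (rvec n)"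
proof (cases "s = 0")
  \<comment> \<open>No half-open interval contains 0, so the step process is 0 there; this is still
    a value of the symbol, as \<open>J_symbol\<close> vanishes at time 0.\<close>
  case True
  have "\<not> grid t m i < 0" for i using t grid_nonneg by (simp add: not_less)
  then have "simple_value (J_step t n m) s \<omega> = 0"
    using True by (simp add: simple_value_def J_step_def indicator_def)
  moreover have "J_symbol \<zeta> 0 (rvec n) = 0"
    by (rule J_symbol_eq_0[OF \<zeta>]) (simp add: add_pos_nonneg)
  ultimately show ?thesis using True t by (intro bexI[of _ 0]) auto
next
  case False
  define k where "k = (LEAST i. s \<le> grid t m i)"
  have ex: "s \<le> grid t m (Suc m)" using s by simp
  have k1: "s \<le> grid t m k" unfolding k_def using ex by (rule LeastI)
  have k2: "k \<le> Suc m" unfolding k_def using ex by (rule Least_le)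
  have "k \<noteq> 0" using k1 False s by (metis grid_0 order_antisym)
  then obtain l where l: "k = Suc l" by (cases k) auto
  have l1: "grid t m l < s" using not_less_Least[of l "\<lambda>i. s \<le> grid t m i"] l unfolding k_def by auto
  have iff: "grid t m i < s \<and> s \<le> grid t m (Suc i) \<longleftrightarrow> i = l" for i
  proof
    assume a: "grid t m i < s \<and> s \<le> grid t m (Suc i)"
    show "i = l"
    proof (rule ccontr)
      assume "i \<noteq> l"
      then consider "Suc i \<le> l" | "Suc l \<le> i" by linarith
      then show False
        using grid_mono[of t "Suc i" l m] grid_mono[of t "Suc l" i m] a l1 k1 l t by cases auto
    qed
  qed (use l1 k1 l in auto)
  have "simple_value (J_step t n m) s \<omega> = (\<Sum>i<Suc m. if i = l then J_symbol \<zeta> (grid t m i) (rvec n) else 0)"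
    unfolding simple_value_def J_step_def prod.case
    by (intro sum.cong refl) (simp add: indicator_def iff)
  also have "\<dots> = J_symbol \<zeta> (grid t m l) (rvec n)" using k2 l by (subst sum.delta) auto
  finally have "simple_value (J_step t n m) s \<omega> = J_symbol \<zeta> (grid t m l) (rvec n)" .
  moreover have "\<bar>grid t m l - s\<bar> \<le> t / real (Suc m)" using l1 k1 l grid_Suc[of t m l] by auto
  ultimately show ?thesis using grid_nonneg[of t m l] l1 s t by (intro bexI[of _ "grid t m l"]) auto
qed

lemma J_step_approx:
  assumes t: "0 < t" and mart: "martingale_det_qv M F N (\<lambda>t. t / 2)"
  shows "(\<lambda>m. \<integral>\<^sup>+\<omega>. (\<integral>\<^sup>+s\<in>{0..t}. ennreal ((simple_value (J_step t n m) s \<omega> - J_symbol \<zeta> s (rvec n))\<^sup>2)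
     \<partial>stieltjes_measure (\<lambda>t. t / 2)) \<partial>M) \<longlonglongrightarrow> 0"
proof -
  interpret N: martingale_det_qv M F N "\<lambda>t. t / 2" by (rule mart)
  have "uniformly_continuous_on {0..t} (\<lambda>s. J_symbol \<zeta> s (rvec n))"
    by (intro compact_uniformly_continuous continuous_J_symbol \<zeta>) auto
  then have uc: "\<exists>d>0. \<forall>r\<in>{0..t}. \<forall>s\<in>{0..t}. \<bar>r - s\<bar> < d \<longrightarrow> \<bar>J_symbol \<zeta> r (rvec n) - J_symbol \<zeta> s (rvec n)\<bar> < e" if "0 < e" for e
    using that unfolding uniformly_continuous_on_def dist_real_def by (metis abs_minus_commute)
  show ?thesis
  proof (rule order_tendstoI)
    fix a :: ennreal assume a: "0 < a"
    \<comment> \<open>The given bound may be infinite; cutting it at 1 yields a positive real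
      one.\<close>
    define b where "b = enn2real (min a 1)"
    have m: "min a 1 < top" by (simp add: min_less_iff_disj)
    have b: "0 < b" "ennreal b \<le> a" using a m
      by (simp_all add: b_def enn2real_positive_iff)
    \<comment> \<open>The measure of \<open>{0..t}\<close> is \<open>t / 2\<close>, so an error of
      at most \<open>e\<close> costs \<open>e\<^sup>2 * t / 2 = b / 2\<close>.\<close>
    define e where "e = sqrt (b / t)"
    have e: "0 < e" "e\<^sup>2 * t / 2 < b" using b t by (auto simp: e_def)
    obtain d where d: "0 < d" "\<And>r s. r \<in> {0..t} \<Longrightarrow> s \<in> {0..t} \<Longrightarrow> \<bar>r - s\<bar> < d \<Longrightarrow> \<bar>J_symbol \<zeta> r (rvec n) - J_symbol \<zeta> s (rvec n)\<bar> < e"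
      using uc[OF e(1)] by blast
    have "(\<lambda>m. t / real (Suc m)) \<longlonglongrightarrow> 0"
      using LIMSEQ_Suc[OF lim_const_over_n[of t]] by simp
    then have "eventually (\<lambda>m. t / real (Suc m) < d) sequentially" using d(1) by (rule order_tendstoD)
    then show "eventually (\<lambda>m. (\<integral>\<^sup>+\<omega>. (\<integral>\<^sup>+s\<in>{0..t}. ennreal ((simple_value (J_step t n m) s \<omega> - J_symbol \<zeta> s (rvec n))\<^sup>2)
     \<partial>stieltjes_measure (\<lambda>t. t / 2)) \<partial>M) < a) sequentially"
    proof eventually_elim
      case (elim m)
      have le: "ennreal ((simple_value (J_step t n m) s \<omega> - J_symbol \<zeta> s (rvec n))\<^sup>2) * indicator {0..t} s
         \<le> ennreal (e\<^sup>2) * indicator {0..t} s" for s \<omega>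
      proof (cases "s \<in> {0..t}")
        case True
        obtain r where r: "r \<in> {0..t}" "\<bar>r - s\<bar> \<le> t / real (Suc m)" "simple_value (J_step t n m) s \<omega> = J_symbol \<zeta> r (rvec n)"
          using J_step_value[OF t, of s m n \<omega>] True by auto
        have "\<bar>J_symbol \<zeta> r (rvec n) - J_symbol \<zeta> s (rvec n)\<bar> \<le> e"
          using d(2)[OF r(1) True] r(2) elim by simp
        then have "(J_symbol \<zeta> r (rvec n) - J_symbol \<zeta> s (rvec n))\<^sup>2 \<le> e\<^sup>2"
          by (rule abs_le_square_iff[THEN iffD1, of _ e, OF order_trans[OF _ abs_ge_self]])
        then show ?thesis using r(3) True by (simp add: ennreal_leI)
      qed simp
      have "(\<integral>\<^sup>+\<omega>. (\<integral>\<^sup>+s\<in>{0..t}. ennreal ((simple_value (J_step t n m) s \<omega> - J_symbol \<zeta> s (rvec n))\<^sup>2)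
          \<partial>stieltjes_measure (\<lambda>t. t / 2)) \<partial>M) \<le> (\<integral>\<^sup>+\<omega>. (\<integral>\<^sup>+s. ennreal (e\<^sup>2) * indicator {0..t} s \<partial>stieltjes_measure (\<lambda>t. t / 2)) \<partial>M)"
        by (intro nn_integral_mono le)
      also have "\<dots> = ennreal (e\<^sup>2) * ennreal (t / 2)"
        using N.emeasure_\<mu>_Icc[of t] t by (simp add: nn_integral_cmult_indicator P.emeasure_space_1)
      also have "\<dots> = ennreal (e\<^sup>2 * t / 2)" using t by (simp add: ennreal_mult[symmetric])
      also have "\<dots> < ennreal b" using e by (intro ennreal_lessI) (auto intro: b)
      also have "\<dots> \<le> a" by (rule b)
      finally show ?case .
    qed
  qed simp
qed

lemma L2_conv_W:
  assumes t: "0 < t" and n: "n \<noteq> 0" "h \<in> {Re, Im}"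
  shows "L2_conv M (\<lambda>m. simple_integral (J_step t n m) (\<lambda>t \<omega>. h (\<omega> t n)) t) (\<lambda>\<omega>. h (W n t \<omega>))"
proof -
  have t': "0 \<le> t" using t by simp
  note J = J_step_simple[OF t', of n] and W = mart_W[OF n] ito_W[OF n]
  show ?thesis
    unfolding L2_conv_def
    using martingale_det_qv.ito_approximation[OF W t' J J_step_approx[OF t W(1)]]
      martingale_det_qv.simple_integral_sq_int[OF W(1) J t', THEN sq_intD(1)]
      martingale_det_qv.ito_measurable[OF W t'] by auto
qed

lemma J_step_integral:
  "0 \<le> t \<Longrightarrow> simple_integral (J_step t n m) N t \<omega>
     = (\<Sum>i<Suc m. J_symbol \<zeta> (grid t m i) (rvec n) * (N (grid t m (Suc i)) \<omega> - N (grid t m i) \<omega>))"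
  unfolding simple_integral_def J_step_def prod.case
  using grid_le by (intro sum.cong refl) (simp add: min_absorb1)

text \<open>The variance of \<eta> times the gradient of the grid approximation of Y at a point. It
  does not involve that point, and it depends on the frequencies only through
  \<open>\<eta> \<bullet> rvec n\<close> and the radial symbol.\<close>

definition step_variance :: "real \<Rightarrow> real^2 \<Rightarrow> nat \<Rightarrow> real" where
  "step_variance t \<eta> m = (\<Sum>n\<in>low_modes t. (\<eta> \<bullet> rvec n)\<^sup>2 *
     (\<Sum>i<Suc m. (J_symbol \<zeta> (grid t m i) (rvec n))\<^sup>2 * (t / real (Suc m))))"

lemma dY_gaussian:
  fixes \<eta> x :: "real^2"
  assumes t: "0 < t"
  defines "X \<equiv> \<lambda>\<omega>. \<Sum>i\<in>UNIV. \<eta> $ i * dY W i x t \<omega>"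
  shows "step_variance t \<eta> \<longlonglongrightarrow> (\<integral>\<omega>. (X \<omega>)\<^sup>2 \<partial>M)" "centred_gaussian M X (\<integral>\<omega>. (X \<omega>)\<^sup>2 \<partial>M)"
proof -
  have t': "0 \<le> t" using t by simp
  define IR where "IR n m = simple_integral (J_step t n m) (\<lambda>t \<omega>. Re (\<omega> t n)) t" for n m
  define II where "II n m = simple_integral (J_step t n m) (\<lambda>t \<omega>. Im (\<omega> t n)) t" for n m
  \<comment> \<open>The coefficients of \<open>Re (W n t \<omega>)\<close> and
    \<open>Im (W n t \<omega>)\<close> in the real part of
    \<open>\<i> * (\<eta> \<bullet> rvec n) * W n t \<omega> * mode n x\<close>.\<close>
  let ?a = "\<lambda>n. - (\<eta> \<bullet> rvec n) * sin (rvec n \<bullet> x)" and ?b = "\<lambda>n. - (\<eta> \<bullet> rvec n) * cos (rvec n \<bullet> x)"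
  define A where "A m \<omega> = (\<Sum>n\<in>low_modes t. ?a n * IR n m \<omega> + ?b n * II n m \<omega>)" for m \<omega>
  have conv: "L2_conv M A (\<lambda>\<omega>. \<Sum>n\<in>low_modes t. ?a n * Re (W n t \<omega>) + ?b n * Im (W n t \<omega>))"
    unfolding A_def[abs_def] IR_def II_def using t
    by (intro L2_conv_sum L2_conv_add L2_conv_cmult L2_conv_W) auto
  have X: "AE \<omega> in M. X \<omega> = (\<Sum>n\<in>low_modes t. ?a n * Re (W n t \<omega>) + ?b n * Im (W n t \<omega>))"
    using dY_eq[OF t']
  proof eventually_elim
    case (elim \<omega>)
    have "X \<omega> = (\<Sum>n\<in>low_modes t. \<eta> $ 1 * Re (\<i> * of_int (n $ 1) * W n t \<omega> * mode n x)
         + \<eta> $ 2 * Re (\<i> * of_int (n $ 2) * W n t \<omega> * mode n x))"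
      by (simp add: X_def sum_2 elim trig_poly_def sum.distrib sum_distrib_left)
    also have "\<dots> = (\<Sum>n\<in>low_modes t. ?a n * Re (W n t \<omega>) + ?b n * Im (W n t \<omega>))"
      by (intro sum.cong refl) (simp add: mode_def inner_vec_def sum_2 algebra_simps)
    finally show ?case .
  qed
  have sX: "sq_int M X" unfolding X_def by (intro sq_int_sum sq_int_cmult dY_sq_int t')
  have lim: "(\<lambda>m. msq M (\<lambda>\<omega>. A m \<omega> - X \<omega>)) \<longlonglongrightarrow> 0"
  proof -
    have "msq M (\<lambda>\<omega>. A m \<omega> - X \<omega>) = msq M (\<lambda>\<omega>. A m \<omega> -
        (\<Sum>n\<in>low_modes t. ?a n * Re (W n t \<omega>) + ?b n * Im (W n t \<omega>)))" for m
      using X by (intro nn_integral_cong_AE, eventually_elim) simp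
    then show ?thesis using conv by (simp add: L2_conv_def)
  qed
  have cg: "centred_gaussian P (A m) (step_variance t \<eta> m)" for m
  proof -
    define c where "c n i = J_symbol \<zeta> (grid t m i) (rvec n)" for n i
    have cu: "c (- n) i = c n i" for n i unfolding c_def by (rule J_symbol_cong_norm) simp
    \<comment> \<open>The joint contribution of \<open>n\<close> and \<open>- n\<close>, as a
      functional of the path of mode \<open>n\<close> alone, so that independence of these paths
      carries over. The factor 2 arises because \<open>?a\<close> and \<open>IR\<close> are even in
      \<open>n\<close> while \<open>?b\<close> and \<open>II\<close> are odd.\<close>
    define \<Phi> where "\<Phi> n \<phi> = (\<Sum>i<Suc m. (2 * ?a n * c n i) * Re (\<phi> (grid t m (Suc i)) - \<phi> (grid t m i))
       + (2 * ?b n * c n i) * Im (\<phi> (grid t m (Suc i)) - \<phi> (grid t m i)))" for n and \<phi> :: "real \<Rightarrow> complex"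
    have AH: "A m \<omega> = (\<Sum>n\<in>half_modes t. \<Phi> n (\<lambda>s\<in>{0..}. \<omega> s n))" if w: "\<omega> \<in> space P" for \<omega>
    proof -
      have "A m \<omega> = (\<Sum>n\<in>half_modes t. (?a n * IR n m \<omega> + ?b n * II n m \<omega>) + (?a (- n) * IR (- n) m \<omega> + ?b (- n) * II (- n) m \<omega>))"
        unfolding A_def by (rule sum_half_modes)
      also have "\<dots> = (\<Sum>n\<in>half_modes t. \<Phi> n (\<lambda>s\<in>{0..}. \<omega> s n))"
      proof (intro sum.cong refl)
        fix n
        have r: "IR (- n) m \<omega> = IR n m \<omega>" "II (- n) m \<omega> = - II n m \<omega>"
          unfolding IR_def II_def J_step_integral[OF t'] c_def[symmetric] cu sum_negf[symmetric]
          by (intro sum.cong refl; simp add: path_uminus[OF w] grid_nonneg[OF t'] algebra_simps)+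
        have "\<Phi> n (\<lambda>s\<in>{0..}. \<omega> s n) = 2 * ?a n * IR n m \<omega> + 2 * ?b n * II n m \<omega>"
          unfolding IR_def II_def J_step_integral[OF t'] c_def[symmetric] \<Phi>_def sum_distrib_left sum.distrib[symmetric]
          by (intro sum.cong refl) (simp add: grid_nonneg[OF t'] mult.assoc)
        then show "(?a n * IR n m \<omega> + ?b n * II n m \<omega>) + (?a (- n) * IR (- n) m \<omega> + ?b (- n) * II (- n) m \<omega>) = \<Phi> n (\<lambda>s\<in>{0..}. \<omega> s n)"
          by (simp add: r)
      qed
      finally show ?thesis .
    qed
    let ?v = "\<lambda>n. \<Sum>i<Suc m. ((2 * ?a n * c n i)\<^sup>2 + (2 * ?b n * c n i)\<^sup>2) * ((grid t m (Suc i) - grid t m i) / 2)"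
    have "centred_gaussian P (\<lambda>\<omega>. \<Sum>n\<in>half_modes t. \<Phi> n (\<lambda>s\<in>{0..}. \<omega> s n)) (\<Sum>n\<in>half_modes t. ?v n)"
    proof (rule P.centred_gaussian_sum)
      have ind: "P.indep_vars (\<lambda>_. Pi\<^sub>M {0..} (\<lambda>_. borel)) (\<lambda>n \<omega>. \<lambda>t\<in>{0..}. \<omega> t n) (half_modes t)"
        using wiener half_modes_disjoint half_modes_nonzero by (auto simp: wiener_measure_def)
      have "\<Phi> n \<in> measurable (Pi\<^sub>M {0..} (\<lambda>_. borel)) borel" for n
        unfolding \<Phi>_def[abs_def] using grid_nonneg[OF t']
        by (intro borel_measurable_sum borel_measurable_add borel_measurable_times borel_measurable_const
            borel_measurable_Re[THEN measurable_compose[rotated]] borel_measurable_Im[THEN measurable_compose[rotated]]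
            borel_measurable_diff measurable_component_singleton) auto
      then show "P.indep_vars (\<lambda>_. borel) (\<lambda>n \<omega>. \<Phi> n (\<lambda>s\<in>{0..}. \<omega> s n)) (half_modes t)"
        by (intro P.indep_vars_compose2[OF ind]) auto
      fix n assume "n \<in> half_modes t"
      then have n: "n \<noteq> 0" using half_modes_nonzero by auto
      have "centred_gaussian P (\<lambda>\<omega>. \<Sum>i<Suc m. (2 * ?a n * c n i) * Re (\<omega> (grid t m (Suc i)) n - \<omega> (grid t m i) n)
       + (2 * ?b n * c n i) * Im (\<omega> (grid t m (Suc i)) n - \<omega> (grid t m i) n)) (?v n)"
        using grid_mono[OF t'] grid_less[OF t] by (intro brownian_functional n) (auto intro: mono_onI)
      then show "centred_gaussian P (\<lambda>\<omega>. \<Phi> n (\<lambda>s\<in>{0..}. \<omega> s n)) (?v n)"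
        unfolding \<Phi>_def using grid_nonneg[OF t'] by simp
    qed
    moreover have "(\<Sum>n\<in>half_modes t. ?v n) = step_variance t \<eta> m"
    proof -
      \<comment> \<open>Doubling the coefficients multiplies the variance by 4 and each real
        component contributes half the time step; the resulting 2 is shared out equally between
        \<open>n\<close> and \<open>- n\<close>.\<close>
      have "?v n = (\<eta> \<bullet> rvec n)\<^sup>2 * (\<Sum>i<Suc m. (c n i)\<^sup>2 * (t / real (Suc m)))
         + (\<eta> \<bullet> rvec (- n))\<^sup>2 * (\<Sum>i<Suc m. (c (- n) i)\<^sup>2 * (t / real (Suc m)))" for n
      proof -
        have sc: "(- (\<eta> \<bullet> rvec n) * sin (rvec n \<bullet> x))\<^sup>2 + (- (\<eta> \<bullet> rvec n) * cos (rvec n \<bullet> x))\<^sup>2 = (\<eta> \<bullet> rvec n)\<^sup>2"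
          by (simp add: power_mult_distrib distrib_left[symmetric])
        have "((2 * ?a n * c n i)\<^sup>2 + (2 * ?b n * c n i)\<^sup>2) * ((grid t m (Suc i) - grid t m i) / 2)
           = 2 * ((\<eta> \<bullet> rvec n)\<^sup>2 * ((c n i)\<^sup>2 * (t / real (Suc m))))" for i
        proof -
          have "(2 * ?a n * c n i)\<^sup>2 + (2 * ?b n * c n i)\<^sup>2 = 4 * (c n i)\<^sup>2 * ((?a n)\<^sup>2 + (?b n)\<^sup>2)"
            by (simp add: power_mult_distrib distrib_left mult.assoc mult.left_commute)
          also have "\<dots> = 4 * (c n i)\<^sup>2 * (\<eta> \<bullet> rvec n)\<^sup>2" unfolding sc ..
          finally have e: "(2 * ?a n * c n i)\<^sup>2 + (2 * ?b n * c n i)\<^sup>2 = 4 * (c n i)\<^sup>2 * (\<eta> \<bullet> rvec n)\<^sup>2" .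
          show ?thesis unfolding e grid_Suc by (simp del: of_nat_Suc)
        qed
        then have "?v n = (\<Sum>i<Suc m. 2 * ((\<eta> \<bullet> rvec n)\<^sup>2 * ((c n i)\<^sup>2 * (t / real (Suc m)))))"
          by (rule sum.cong[OF refl])
        also have "\<dots> = 2 * ((\<eta> \<bullet> rvec n)\<^sup>2 * (\<Sum>i<Suc m. (c n i)\<^sup>2 * (t / real (Suc m))))"
          by (simp only: sum_distrib_left)
        also have "\<dots> = (\<eta> \<bullet> rvec n)\<^sup>2 * (\<Sum>i<Suc m. (c n i)\<^sup>2 * (t / real (Suc m)))
           + (\<eta> \<bullet> rvec (- n))\<^sup>2 * (\<Sum>i<Suc m. (c (- n) i)\<^sup>2 * (t / real (Suc m)))"
          by (simp add: cu del: sum.lessThan_Suc of_nat_Suc)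
        finally show ?thesis .
      qed
      then show ?thesis unfolding step_variance_def c_def[symmetric] by (subst sum_half_modes) simp
    qed
    ultimately have "centred_gaussian P (\<lambda>\<omega>. \<Sum>n\<in>half_modes t. \<Phi> n (\<lambda>s\<in>{0..}. \<omega> s n)) (step_variance t \<eta> m)" by simp
    then show ?thesis
      unfolding centred_gaussian_def using AH
      by (simp cong: measurable_cong Bochner_Integration.integral_cong)
  qed
  note lims = M.centred_gaussian_limit[OF centred_gaussian_completion[OF cg] sX lim]
  show "step_variance t \<eta> \<longlonglongrightarrow> (\<integral>\<omega>. (X \<omega>)\<^sup>2 \<partial>M)" "centred_gaussian M X (\<integral>\<omega>. (X \<omega>)\<^sup>2 \<partial>M)"
    using lims by auto
qed

end

section \<open>Stieltjes integrals against monotone integrators\<close>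

text \<open>For monotone \<open>Q\<close> every variation sum telescopes, and the partition
  consisting of 0 and \<open>s\<close> attains the supremum.\<close>

lemma Sup_variation_sums_mono:
  assumes Q: "mono_on {0..} Q" and s: "0 \<le> s"
  shows "Sup (variation_sums Q s) = Q s - Q 0"
proof (rule cSup_eq_maximum)
  have "(\<Sum>i<(1::nat). \<bar>Q ((if Suc i = 0 then 0 else s)) - Q ((if i = 0 then 0 else s))\<bar>) = Q s - Q 0"
    using mono_onD[OF Q, of 0 s] s by simp
  then show "Q s - Q 0 \<in> variation_sums Q s"
    unfolding variation_sums_def using s
    by (intro CollectI exI[of _ 1] exI[of _ "\<lambda>i. if i = 0 then 0 else s"]) (auto simp: mono_on_def)
next
  fix a assume "a \<in> variation_sums Q s"
  then obtain k r where a: "a = (\<Sum>i<k. \<bar>Q (r (Suc i)) - Q (r i)\<bar>)" and r: "mono_on {..k} r" "r ` {..k} \<subseteq> {0..s}"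
    by (auto simp: variation_sums_def)
  have r0: "0 \<le> r i \<and> r i \<le> s" if "i \<le> k" for i using r(2) that by auto
  have "a = (\<Sum>i<k. Q (r (Suc i)) - Q (r i))"
    unfolding a
  proof (intro sum.cong refl)
    fix i assume "i \<in> {..<k}"
    then have "r i \<le> r (Suc i)" "0 \<le> r i" using r(1) r0[of i] by (auto simp: mono_on_def)
    then show "\<bar>Q (r (Suc i)) - Q (r i)\<bar> = Q (r (Suc i)) - Q (r i)"
      using mono_onD[OF Q, of "r i" "r (Suc i)"] by simp
  qed
  also have "\<dots> = Q (r k) - Q (r 0)" by (rule sum_lessThan_telescope)
  also have "\<dots> \<le> Q s - Q 0"
    using mono_onD[OF Q, of "r k" s] mono_onD[OF Q, of 0 "r 0"] r0[of k] r0[of 0] s by simp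
  finally show "a \<le> Q s - Q 0" .
qed

lemma interval_measure_0: "(LINT r:A|interval_measure (\<lambda>_. 0). g r) = (0::real)"
proof -
  let ?m = "interval_measure (\<lambda>_. 0)"
  have "emeasure ?m {real_of_int (- int n)<..real n} = 0" for n
    by (subst emeasure_interval_measure_Ioc) auto
  then have "(\<Union>n. {real_of_int (- int n)<..real n}) \<in> null_sets ?m"
    by (intro null_sets_UN) (auto simp: null_sets_def)
  moreover have "(\<Union>n. {real_of_int (- int n)<..real n}) = UNIV"
  proof (intro set_eqI iffI UNIV_I)
    fix x :: real
    obtain n where "\<bar>x\<bar> < real n" using reals_Archimedean2 by blast
    then have "- real n < x" "x \<le> real n" by linarith+
    then have "x \<in> {real_of_int (- int n)<..real n}" by simp
    then show "x \<in> (\<Union>n. {real_of_int (- int n)<..real n})" by blast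
  qed
  ultimately have N: "UNIV \<in> null_sets ?m" by simp
  have "AE x in ?m. indicator A x *\<^sub>R g x = 0" using AE_not_in[OF N] by eventually_elim simp
  then have "(\<integral>x. indicator A x *\<^sub>R g x \<partial>?m) = 0" by (rule integral_eq_zero_AE)
  then show ?thesis by (simp add: set_lebesgue_integral_def)
qed

text \<open>The total variation is \<open>Q\<close> itself, so the second measure in the
  decomposition comes from the constant 0 and is null.\<close>

lemma stieltjes_integral_mono:
  assumes Q: "mono_on {0..} Q" and Q0: "Q 0 = 0"
  shows "stieltjes_integral g Q t = (LINT r:{0..t}|stieltjes_measure Q. g r)"
proof -
  have V: "Sup (variation_sums Q (max 0 s)) = Q (max 0 s)" for s
    using Sup_variation_sums_mono[OF Q, of "max 0 s"] Q0 by simp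
  show ?thesis unfolding stieltjes_integral_def stieltjes_measure_def V
    by (simp add: interval_measure_0)
qed

lemma stieltjes_integral_zero:
  assumes "\<And>s. 0 \<le> s \<Longrightarrow> Q s = 0"
  shows "stieltjes_integral g Q t = 0"
proof -
  have "stieltjes_integral g Q t = (LINT r:{0..t}|stieltjes_measure Q. g r)"
    using assms by (intro stieltjes_integral_mono) (auto simp: mono_on_def)
  also have "stieltjes_measure Q = interval_measure (\<lambda>_. 0)"
    unfolding stieltjes_measure_def using assms by simp
  finally show ?thesis by (simp add: interval_measure_0)
qed

text \<open>Cauchy-Schwarz without integrability of \<open>g\<close>. If the square has infinite
  integral, the right side is infinite unless \<open>A\<close> is null; that case comes first
  because 0 times infinity is 0, and then the left side is 0 as well.\<close>

lemma set_integral_sq_le: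
  assumes A: "A \<in> sets \<mu>" "emeasure \<mu> A < \<infinity>" and g: "g \<in> borel_measurable \<mu>"
  shows "ennreal ((LINT r:A|\<mu>. g r)\<^sup>2) \<le> emeasure \<mu> A * (\<integral>\<^sup>+r\<in>A. ennreal ((g r)\<^sup>2) \<partial>\<mu>)"
proof -
  have e: "ennreal ((g r)\<^sup>2) * indicator A r = ennreal ((indicator A r * g r)\<^sup>2)"
    and isq: "(indicator A r)\<^sup>2 = (indicator A r :: real)" for r
    by (simp_all add: indicator_def)
  consider "emeasure \<mu> A = 0" | "emeasure \<mu> A \<noteq> 0" "(\<integral>\<^sup>+r\<in>A. ennreal ((g r)\<^sup>2) \<partial>\<mu>) = \<infinity>"
    | "(\<integral>\<^sup>+r\<in>A. ennreal ((g r)\<^sup>2) \<partial>\<mu>) < \<infinity>"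
    unfolding infinity_ennreal_def less_top[symmetric] by blast
  then show ?thesis
  proof cases
    case 1
    then have "AE r in \<mu>. r \<notin> A" using A by (intro AE_not_in) (auto simp: null_sets_def)
    then have "(\<integral>r. indicator A r *\<^sub>R g r \<partial>\<mu>) = 0" by (intro integral_eq_zero_AE) auto
    then show ?thesis by (simp add: set_lebesgue_integral_def)
  next
    case 2
    then show ?thesis by (simp add: ennreal_mult_eq_top_iff)
  next
    case 3
    then have 1: "sq_int \<mu> (\<lambda>r. indicator A r * g r)"
      using A g unfolding e sq_int_def by (intro conjI integrableI_nonneg) auto
    have 2: "sq_int \<mu> (indicator A)"
      using A by (auto simp: sq_int_def isq intro!: integrable_real_indicator)
    have "(LINT r:A|\<mu>. g r)\<^sup>2 = (\<integral>r. (indicator A r * g r) * indicator A r \<partial>\<mu>)\<^sup>2"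
      by (simp add: set_lebesgue_integral_def mult.assoc indicator_inter_arith[symmetric] mult.commute mult.left_commute)
    also have "\<dots> \<le> (\<integral>r. (indicator A r * g r)\<^sup>2 \<partial>\<mu>) * (\<integral>r. (indicator A r)\<^sup>2 \<partial>\<mu>)"
      by (rule Cauchy_Schwarz_integral[OF 1 2])
    finally have "ennreal ((LINT r:A|\<mu>. g r)\<^sup>2) \<le> ennreal (\<integral>r. (indicator A r * g r)\<^sup>2 \<partial>\<mu>) * ennreal (\<integral>r. (indicator A r)\<^sup>2 \<partial>\<mu>)"
      by (simp add: ennreal_mult[symmetric] ennreal_leI)
    also have "ennreal (\<integral>r. (indicator A r * g r)\<^sup>2 \<partial>\<mu>) = (\<integral>\<^sup>+r\<in>A. ennreal ((g r)\<^sup>2) \<partial>\<mu>)"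
      unfolding e using sq_intD(2)[OF 1] by (intro nn_integral_eq_integral[symmetric]) auto
    also have "ennreal (\<integral>r. (indicator A r)\<^sup>2 \<partial>\<mu>) = emeasure \<mu> A"
      using A by (simp add: isq emeasure_eq_ennreal_measure less_top)
    finally show ?thesis by (simp add: mult.commute)
  qed
qed

section \<open>Moments of the gradient\<close>

context gaussian_field
begin

text \<open>The reflection \<open>\<rho>\<close> preserves \<open>norm (rvec n)\<close>, hence the
  symbol and the set of modes, and exchanges the two directions up to a sign that the square
  removes.\<close>

lemma step_variance_reflect: "step_variance t (vector [1, 1]) m = step_variance t (vector [1, -1]) m"
proof -
  define \<rho> :: "int^2 \<Rightarrow> int^2" where "\<rho> n = vector [- n $ 1, n $ 2]" for n
  have \<rho>1: "\<rho> (\<rho> n) = n" for n by (simp add: \<rho>_def vec_eq_iff forall_2)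
  have \<rho>2: "norm (rvec (\<rho> n)) = norm (rvec n)" for n by (simp add: \<rho>_def norm_vec_def L2_set_def sum_2)
  have \<rho>4: "\<rho> n = 0 \<longleftrightarrow> n = 0" for n by (auto simp: \<rho>_def vec_eq_iff forall_2)
  have \<rho>5: "(vector [1, 1] \<bullet> rvec (\<rho> n))\<^sup>2 = (vector [1, -1] \<bullet> rvec n)\<^sup>2" for n
    by (simp add: \<rho>_def inner_vec_def sum_2 power2_commute)
  have \<rho>6: "J_symbol \<zeta> s (rvec (\<rho> n)) = J_symbol \<zeta> s (rvec n)" for s n
    by (rule J_symbol_cong_norm[OF \<rho>2])
  have \<rho>7: "\<rho> n \<in> low_modes t \<longleftrightarrow> n \<in> low_modes t" for n by (simp add: low_modes_def \<rho>2 \<rho>4)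
  show ?thesis
    unfolding step_variance_def
    by (rule sum.reindex_bij_witness[of _ \<rho> \<rho>]) (simp_all add: \<rho>1 \<rho>7 \<rho>6, simp add: \<rho>5[of "\<rho> _", unfolded \<rho>1])
qed

text \<open>By polarisation: the sum and the difference of the two partial derivatives have equal
  second moments, being limits of the same sequence, so the mixed moment is zero.\<close>

lemma q_offdiag_12:
  assumes t: "0 \<le> t" shows "q 1 2 t = 0"
proof (cases "t = 0")
  case True
  then show ?thesis using qv[of 1 0 2] by (auto simp: quadratic_covariation_def)
next
  case False
  then have t': "0 < t" using t by simp
  let ?y = "\<lambda>i. dY W i 0 t"
  note s = sq_intD(2)[OF dY_sq_int[OF t]] sq_int_mult_integrable[OF dY_sq_int[OF t] dY_sq_int[OF t]]
  have "(\<integral>\<omega>. (?y 1 \<omega> + ?y 2 \<omega>)\<^sup>2 \<partial>M) = (\<integral>\<omega>. (?y 1 \<omega> - ?y 2 \<omega>)\<^sup>2 \<partial>M)"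
  proof -
    have "step_variance t (vector [1, 1]) = step_variance t (vector [1, -1])"
      using step_variance_reflect by blast
    from LIMSEQ_unique[OF dY_gaussian(1)[OF t', of "vector [1, 1]" 0]
      dY_gaussian(1)[OF t', of "vector [1, -1]" 0, folded this]]
    show ?thesis by (simp add: sum_2)
  qed
  moreover have "(\<integral>\<omega>. (?y 1 \<omega> + ?y 2 \<omega>)\<^sup>2 \<partial>M) = (\<integral>\<omega>. (?y 1 \<omega>)\<^sup>2 \<partial>M) + (\<integral>\<omega>. (?y 2 \<omega>)\<^sup>2 \<partial>M) + 2 * (\<integral>\<omega>. ?y 1 \<omega> * ?y 2 \<omega> \<partial>M)"
    unfolding power2_sum using s by (simp add: mult.assoc)
  moreover have "(\<integral>\<omega>. (?y 1 \<omega> - ?y 2 \<omega>)\<^sup>2 \<partial>M) = (\<integral>\<omega>. (?y 1 \<omega>)\<^sup>2 \<partial>M) + (\<integral>\<omega>. (?y 2 \<omega>)\<^sup>2 \<partial>M) - 2 * (\<integral>\<omega>. ?y 1 \<omega> * ?y 2 \<omega> \<partial>M)"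
    unfolding power2_diff using s by (simp add: mult.assoc)
  ultimately show ?thesis using dY_covariance[OF t, of 1 0 2] by simp
qed

lemma q_offdiag: "0 \<le> t \<Longrightarrow> i \<noteq> j \<Longrightarrow> q i j t = 0"
  using q_offdiag_12 q_sym[of t 2 1] exhaust_2[of i] exhaust_2[of j] by auto

lemma dY_second_moment:
  assumes "0 \<le> t"
  shows "(\<integral>\<omega>. (dY W i x t \<omega>)\<^sup>2 \<partial>M) = q i i t"
  using dY_covariance[OF assms, of i x i] by (simp add: power2_eq_square)

text \<open>The fourth moment is obtained by polarisation,
  \<open>(a\<^sup>2 + b\<^sup>2)\<^sup>2 = 2/3 (a\<^sup>4 + b\<^sup>4) + 1/6 ((a + b)\<^sup>4 + (a - b)\<^sup>4)\<close>, so that only Gaussian variables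
  on the real line occur.\<close>

lemma dY_fourth_moment:
  assumes t: "0 < t"
  shows "integrable M (\<lambda>\<omega>. ((dY W 1 x t \<omega>)\<^sup>2 + (dY W 2 x t \<omega>)\<^sup>2)\<^sup>2)"
    "(\<integral>\<omega>. ((dY W 1 x t \<omega>)\<^sup>2 + (dY W 2 x t \<omega>)\<^sup>2)\<^sup>2 \<partial>M)
       = 3 * (q 1 1 t)\<^sup>2 + 3 * (q 2 2 t)\<^sup>2 + 2 * q 1 1 t * q 2 2 t"
proof -
  have t': "0 \<le> t" using t by simp
  let ?y = "\<lambda>i. dY W i x t"
  note s = sq_intD(2)[OF dY_sq_int[OF t']] sq_int_mult_integrable[OF dY_sq_int[OF t'] dY_sq_int[OF t']]
  have I: "integrable M (\<lambda>\<omega>. (a * ?y 1 \<omega> + b * ?y 2 \<omega>) ^ 4)"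
    and E: "(\<integral>\<omega>. (a * ?y 1 \<omega> + b * ?y 2 \<omega>) ^ 4 \<partial>M) = 3 * (a\<^sup>2 * q 1 1 t + b\<^sup>2 * q 2 2 t)\<^sup>2" for a b
  proof -
    let ?X = "\<lambda>\<omega>. a * ?y 1 \<omega> + b * ?y 2 \<omega>"
    have g: "centred_gaussian M ?X (\<integral>\<omega>. (?X \<omega>)\<^sup>2 \<partial>M)"
      using dY_gaussian(2)[OF t, of "vector [a, b]" x] by (simp add: sum_2)
    show "integrable M (\<lambda>\<omega>. (?X \<omega>) ^ 4)" by (rule M.centred_gaussian_moments[OF g])
    have "(\<integral>\<omega>. (?X \<omega>)\<^sup>2 \<partial>M) = (\<integral>\<omega>. a\<^sup>2 * (?y 1 \<omega>)\<^sup>2 + b\<^sup>2 * (?y 2 \<omega>)\<^sup>2 + (2 * a * b) * (?y 1 \<omega> * ?y 2 \<omega>) \<partial>M)"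
      by (intro Bochner_Integration.integral_cong) (auto simp: power2_eq_square algebra_simps)
    also have "\<dots> = a\<^sup>2 * q 1 1 t + b\<^sup>2 * q 2 2 t"
      using s dY_second_moment[OF t'] dY_covariance[OF t', of 1 x 2] q_offdiag[OF t', of 1 2] by simp
    finally show "(\<integral>\<omega>. (?X \<omega>) ^ 4 \<partial>M) = 3 * (a\<^sup>2 * q 1 1 t + b\<^sup>2 * q 2 2 t)\<^sup>2"
      using M.centred_gaussian_moments(4)[OF g] by simp
  qed
  have p: "((?y 1 \<omega>)\<^sup>2 + (?y 2 \<omega>)\<^sup>2)\<^sup>2 = 2 / 3 * (1 * ?y 1 \<omega> + 0 * ?y 2 \<omega>) ^ 4 + 2 / 3 * (0 * ?y 1 \<omega> + 1 * ?y 2 \<omega>) ^ 4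
      + 1 / 6 * (1 * ?y 1 \<omega> + 1 * ?y 2 \<omega>) ^ 4 + 1 / 6 * (1 * ?y 1 \<omega> + (- 1) * ?y 2 \<omega>) ^ 4" for \<omega>
    by (simp add: power2_eq_square power4_eq_xxxx algebra_simps)
  show "integrable M (\<lambda>\<omega>. ((?y 1 \<omega>)\<^sup>2 + (?y 2 \<omega>)\<^sup>2)\<^sup>2)"
    unfolding p by (intro Bochner_Integration.integrable_add integrable_mult_right I)
  have "(\<integral>\<omega>. ((?y 1 \<omega>)\<^sup>2 + (?y 2 \<omega>)\<^sup>2)\<^sup>2 \<partial>M)
     = 2 / 3 * (3 * (1\<^sup>2 * q 1 1 t + 0\<^sup>2 * q 2 2 t)\<^sup>2) + 2 / 3 * (3 * (0\<^sup>2 * q 1 1 t + 1\<^sup>2 * q 2 2 t)\<^sup>2)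
      + 1 / 6 * (3 * (1\<^sup>2 * q 1 1 t + 1\<^sup>2 * q 2 2 t)\<^sup>2) + 1 / 6 * (3 * (1\<^sup>2 * q 1 1 t + (- 1)\<^sup>2 * q 2 2 t)\<^sup>2)"
    unfolding p E[symmetric]
    by (subst Bochner_Integration.integral_add | intro Bochner_Integration.integrable_add integrable_mult_right I | subst integral_mult_right_zero)+ (rule refl)
  then show "(\<integral>\<omega>. ((?y 1 \<omega>)\<^sup>2 + (?y 2 \<omega>)\<^sup>2)\<^sup>2 \<partial>M)
       = 3 * (q 1 1 t)\<^sup>2 + 3 * (q 2 2 t)\<^sup>2 + 2 * q 1 1 t * q 2 2 t"
    by (simp add: power2_eq_square algebra_simps)
qed

section \<open>Moment bounds uniform in the point of the torus\<close>

lemma q_mono: "0 \<le> s \<Longrightarrow> s \<le> t \<Longrightarrow> q i i s \<le> q i i t"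
  by (rule martingale_det_qv.Q_mono[OF mart_dY])

lemma q_nonneg: "0 \<le> t \<Longrightarrow> 0 \<le> q i i t"
  by (rule martingale_det_qv.Q_nonneg[OF mart_dY])

lemma q_0: "q i i 0 = 0"
  by (rule martingale_det_qv.Q_0[OF mart_dY])

lemma emeasure_stieltjes_q: "0 \<le> t \<Longrightarrow> emeasure (stieltjes_measure (q i i)) {0..t} = ennreal (q i i t)"
  by (rule martingale_det_qv.emeasure_\<mu>_Icc[OF mart_dY])

lemma dY_nn_second_moment: "0 \<le> t \<Longrightarrow> (msq M (\<lambda>\<omega>. dY W i x t \<omega>)) = ennreal (q i i t)"
  using sq_intD(2)[OF dY_sq_int] dY_second_moment by (subst nn_integral_eq_integral) auto

lemma nn_integral_stieltjes_le:
  assumes "0 \<le> t" "\<And>s. 0 \<le> s \<Longrightarrow> s \<le> t \<Longrightarrow> h s \<le> c"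
  shows "(\<integral>\<^sup>+s\<in>{0..t}. h s \<partial>stieltjes_measure (q i i)) \<le> c * ennreal (q i i t)"
proof -
  have "(\<integral>\<^sup>+s\<in>{0..t}. h s \<partial>stieltjes_measure (q i i)) \<le> (\<integral>\<^sup>+s. c * indicator {0..t} s \<partial>stieltjes_measure (q i i))"
    using assms(2) by (intro nn_integral_mono) (auto simp: indicator_def)
  also have "\<dots> = c * ennreal (q i i t)"
    using emeasure_stieltjes_q[OF assms(1), of i] by (subst nn_integral_cmult_indicator) (auto simp: stieltjes_measure_def)
  finally show ?thesis .
qed

text \<open>The Ito integral \<open>S\<close> guarantees a jointly measurable version of its
  integrand \<open>dY W i x\<close>. Cauchy-Schwarz in time and Fubini then reduce the bound to the
  second moments of that derivative.\<close>

lemma stieltjes_dY_second_moment: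
  assumes S: "ito_integral M F (dY W j x) (\<lambda>t \<omega>. q j j t) (dY W i x) S" and s: "0 \<le> s"
  shows "msq M (\<lambda>\<omega>. stieltjes_integral (\<lambda>r. dY W i x r \<omega>) (q j j) s)
    \<le> ennreal (q j j s) * (ennreal (q i i s) * ennreal (q j j s))"
proof -
  interpret N: martingale_det_qv M F "dY W j x" "q j j" by (rule mart_dY)
  obtain H where H: "(\<lambda>(s, \<omega>). H s \<omega>) \<in> borel_measurable (borel \<Otimes>\<^sub>M M)"
    "AE \<omega> in M. \<forall>t\<ge>0. dY W i x t \<omega> = H t \<omega>"
    using N.ito_predictable_version[OF S] by blast
  interpret \<mu>: sigma_finite_measure N.\<mu> by (rule N.sigma_finite_\<mu>)
  interpret ps: pair_sigma_finite N.\<mu> M ..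
  have Hm[measurable]: "(\<lambda>(s, \<omega>). H s \<omega>) \<in> borel_measurable (N.\<mu> \<Otimes>\<^sub>M M)"
    using H by (simp_all cong: measurable_cong_sets sets_pair_measure_cong)
  have si: "stieltjes_integral g (q j j) s = (LINT r:{0..s}|N.\<mu>. g r)" for g
    using q_mono q_0 by (intro stieltjes_integral_mono) (auto simp: mono_on_def)
  have "msq M (\<lambda>\<omega>. stieltjes_integral (\<lambda>r. dY W i x r \<omega>) (q j j) s)
     \<le> (\<integral>\<^sup>+\<omega>. ennreal (q j j s) * (\<integral>\<^sup>+r\<in>{0..s}. ennreal ((H r \<omega>)\<^sup>2) \<partial>N.\<mu>) \<partial>M)"
  proof (rule nn_integral_mono_AE)
    show "AE \<omega> in M. ennreal ((stieltjes_integral (\<lambda>r. dY W i x r \<omega>) (q j j) s)\<^sup>2)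
       \<le> ennreal (q j j s) * (\<integral>\<^sup>+r\<in>{0..s}. ennreal ((H r \<omega>)\<^sup>2) \<partial>N.\<mu>)"
      using H(2) AE_space
    proof eventually_elim
      case (elim \<omega>)
      have "stieltjes_integral (\<lambda>r. dY W i x r \<omega>) (q j j) s = (LINT r:{0..s}|N.\<mu>. H r \<omega>)"
        unfolding si set_lebesgue_integral_def using elim(1)
        by (intro Bochner_Integration.integral_cong refl) (auto simp: indicator_def)
      moreover have "(\<lambda>r. H r \<omega>) \<in> borel_measurable N.\<mu>"
        using measurable_compose[OF measurable_Pair2'[OF elim(2), of N.\<mu>] Hm] by simp
      ultimately show ?case
        using set_integral_sq_le[of "{0..s}" N.\<mu> "\<lambda>r. H r \<omega>"] N.emeasure_\<mu>_Icc[OF s] by simp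
    qed
  qed
  also have "\<dots> = ennreal (q j j s) * (\<integral>\<^sup>+\<omega>. (\<integral>\<^sup>+r\<in>{0..s}. ennreal ((H r \<omega>)\<^sup>2) \<partial>N.\<mu>) \<partial>M)"
    by (intro nn_integral_cmult) measurable
  also have "(\<integral>\<^sup>+\<omega>. (\<integral>\<^sup>+r\<in>{0..s}. ennreal ((H r \<omega>)\<^sup>2) \<partial>N.\<mu>) \<partial>M)
     = (\<integral>\<^sup>+r\<in>{0..s}. msq M (\<lambda>\<omega>. dY W i x r \<omega>) \<partial>N.\<mu>)"
    by (rule N.predictable_Fubini[OF H])
  also have "\<dots> \<le> ennreal (q i i s) * ennreal (q j j s)"
    using s q_mono by (intro nn_integral_stieltjes_le) (auto simp: dY_nn_second_moment intro!: ennreal_leI)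
  finally show ?thesis by (simp add: mult_left_mono)
qed

lemma ito_dY_second_moment:
  assumes I: "ito_integral M F (dY W i x) (\<lambda>t \<omega>. q i i t) H I" and t: "0 \<le> t"
    and c: "\<And>s. 0 \<le> s \<Longrightarrow> s \<le> t \<Longrightarrow> (msq M (\<lambda>\<omega>. H s \<omega>)) \<le> ennreal c" and c0: "0 \<le> c"
  shows "msq M (\<lambda>\<omega>. I t \<omega>) \<le> ennreal (4 * c * q i i t)"
proof -
  have "msq M (\<lambda>\<omega>. I t \<omega>) \<le> 4 * (\<integral>\<^sup>+s\<in>{0..t}. msq M (\<lambda>\<omega>. H s \<omega>) \<partial>stieltjes_measure (q i i))"
    by (rule martingale_det_qv.ito_second_moment[OF mart_dY I t])
  also have "\<dots> \<le> 4 * (ennreal c * ennreal (q i i t))"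
    using nn_integral_stieltjes_le[OF t c] by (intro mult_left_mono) auto
  also have "\<dots> = ennreal (4 * c * q i i t)"
    using c0 q_nonneg[OF t] by (simp add: ennreal_mult mult.assoc)
  finally show ?thesis .
qed

text \<open>The first moment is estimated by \<open>\<bar>a\<bar> \<le> 1 + a\<^sup>2\<close>, which
  keeps the bound independent of \<open>x\<close>.\<close>

lemma ito_dY_mean:
  assumes I: "ito_integral M F (dY W i x) (\<lambda>t \<omega>. q i i t) H I" and t: "0 \<le> t"
    and c: "msq M (\<lambda>\<omega>. I t \<omega>) \<le> ennreal c" and c0: "0 \<le> c"
  shows "integrable M (I t)" "(\<integral>\<omega>. I t \<omega> \<partial>M) = 0" "(\<integral>\<omega>. \<bar>I t \<omega>\<bar> \<partial>M) \<le> 1 + c"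
proof -
  have m: "I t \<in> borel_measurable M" by (rule martingale_det_qv.ito_measurable[OF mart_dY I t])
  have "(msq M (\<lambda>\<omega>. I t \<omega>)) < \<infinity>" using c by (auto simp: less_top[symmetric] top_unique)
  then have i2: "integrable M (\<lambda>\<omega>. (I t \<omega>)\<^sup>2)" using m by (intro integrableI_nonneg) auto
  then have s: "sq_int M (I t)" using m by (simp add: sq_int_def)
  show i: "integrable M (I t)" by (rule M.sq_int_integrable[OF s])
  show "(\<integral>\<omega>. I t \<omega> \<partial>M) = 0" by (rule martingale_det_qv.ito_mean[OF mart_dY I t s])
  have "(\<integral>\<omega>. (I t \<omega>)\<^sup>2 \<partial>M) \<le> c"
    using c c0 i2 by (subst (asm) nn_integral_eq_integral) auto
  moreover have "(\<integral>\<omega>. \<bar>I t \<omega>\<bar> \<partial>M) \<le> (\<integral>\<omega>. 1 + (I t \<omega>)\<^sup>2 \<partial>M)"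
  proof (rule integral_mono)
    fix \<omega>
    have "0 \<le> (\<bar>I t \<omega>\<bar> - 1)\<^sup>2" by simp
    then have "2 * \<bar>I t \<omega>\<bar> \<le> 1 + (I t \<omega>)\<^sup>2" by (simp add: power2_diff)
    then show "\<bar>I t \<omega>\<bar> \<le> 1 + (I t \<omega>)\<^sup>2" by linarith
  qed (use i i2 in auto)
  ultimately show "(\<integral>\<omega>. \<bar>I t \<omega>\<bar> \<partial>M) \<le> 1 + c" using i2 P.prob_space by simp
qed

end

section \<open>Extended expectations\<close>

lemma expectation_ext_cong_AE:
  assumes "AE \<omega> in M. X \<omega> = Y \<omega>" shows "expectation_ext M X = expectation_ext M Y"
  unfolding expectation_ext_def using assms
  by (intro arg_cong2[where f="(-)"] arg_cong[where f=enn2ereal] nn_integral_cong_AE) (auto elim: AE_mp)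

text \<open>Measurability of \<open>X\<close> cannot be dropped: the integrals of the positive and of the negative part are
  lower integrals.\<close>

lemma expectation_ext_add_mean_zero:
  assumes X[measurable]: "X \<in> borel_measurable M" and w: "integrable M w" "(\<integral>\<omega>. w \<omega> \<partial>M) = 0"
  shows "expectation_ext M (\<lambda>\<omega>. X \<omega> + w \<omega>) = expectation_ext M X"
proof -
  have [measurable]: "w \<in> borel_measurable M" using w(1) by (rule borel_measurable_integrable)
  let ?p = "\<lambda>g. \<integral>\<^sup>+\<omega>. ennreal (g \<omega>) \<partial>M" and ?n = "\<lambda>g. \<integral>\<^sup>+\<omega>. ennreal (- g \<omega>) \<partial>M"
  define s where "s \<omega> = X \<omega> + w \<omega>" for \<omega>
  have [measurable]: "s \<in> borel_measurable M" unfolding s_def by measurable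
  obtain c where c: "?p w = ennreal c" "?n w = ennreal c"
  proof -
    have f: "?p w < top" "?n w < top"
      using w(1) unfolding real_integrable_def less_top infinity_ennreal_def by blast+
    have "enn2real (?p w) = enn2real (?n w)"
      using w(2) unfolding real_lebesgue_integral_def[OF w(1)] by simp
    then show thesis using that[of "enn2real (?p w)"] f ennreal_enn2real by metis
  qed
  \<comment> \<open>The pointwise identity of positive and negative parts for
    \<open>s = X + w\<close>, arranged as sums so that no infinite values are subtracted. Afterwards
    the finite mass \<open>c\<close> of both parts of \<open>w\<close> is cancelled.\<close>
  have id: "?p s + ?n X + ?n w = ?n s + ?p X + ?p w"
  proof -
    have "?p s + ?n X + ?n w = (\<integral>\<^sup>+\<omega>. ennreal (s \<omega>) + ennreal (- X \<omega>) + ennreal (- w \<omega>) \<partial>M)"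
      by (simp add: nn_integral_add)
    also have "\<dots> = (\<integral>\<^sup>+\<omega>. ennreal (- s \<omega>) + ennreal (X \<omega>) + ennreal (w \<omega>) \<partial>M)"
    proof (intro nn_integral_cong)
      fix \<omega>
      have "ennreal (max a 0) = ennreal a" for a by (simp add: max_def ennreal_neg)
      then have e: "ennreal a + ennreal b + ennreal c = ennreal (max a 0 + max b 0 + max c 0)" for a b c
        by simp
      have "max (s \<omega>) 0 + max (- X \<omega>) 0 + max (- w \<omega>) 0 = max (- s \<omega>) 0 + max (X \<omega>) 0 + max (w \<omega>) 0"
        by (auto simp: s_def max_def)
      then show "ennreal (s \<omega>) + ennreal (- X \<omega>) + ennreal (- w \<omega>) = ennreal (- s \<omega>) + ennreal (X \<omega>) + ennreal (w \<omega>)"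
        unfolding e by (simp only:)
    qed
    also have "\<dots> = ?n s + ?p X + ?p w" by (simp add: nn_integral_add)
    finally show ?thesis .
  qed
  then have id': "?p s + ?n X = ?n s + ?p X"
    unfolding c by (simp add: ennreal_add_eq_top[symmetric] add.commute[of _ "ennreal c"] ennreal_add_left_cancel)
  have le: "?p s \<le> ?p X + ennreal c" "?p X \<le> ?p s + ennreal c"
  proof -
    have l: "ennreal (a + b) \<le> ennreal a + ennreal b" for a b
      by (cases "0 \<le> a"; cases "0 \<le> b") (auto simp: ennreal_plus[symmetric] ennreal_neg intro!: ennreal_leI simp del: ennreal_plus)
    have "?p s \<le> (\<integral>\<^sup>+\<omega>. ennreal (X \<omega>) + ennreal (w \<omega>) \<partial>M)"
      unfolding s_def by (intro nn_integral_mono l)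
    then show "?p s \<le> ?p X + ennreal c" by (simp add: nn_integral_add c)
    have "?p X \<le> (\<integral>\<^sup>+\<omega>. ennreal (s \<omega>) + ennreal (- w \<omega>) \<partial>M)"
      using l[of "s \<omega>" "- w \<omega>" for \<omega>] by (intro nn_integral_mono) (simp add: s_def)
    then show "?p X \<le> ?p s + ennreal c" by (simp add: nn_integral_add c)
  qed
  have "enn2ereal (?p s) - enn2ereal (?n s) = enn2ereal (?p X) - enn2ereal (?n X)"
  proof (cases "?p X = top")
    case True
    then have "?p s = top" using le(2) by (simp add: top_unique)
    \<comment> \<open>In \<open>ereal\<close> infinity minus anything is infinity, so the negative
      parts do not matter.\<close>
    then show ?thesis using True by simp
  next
    case False
    then obtain a where a: "?p X = ennreal a" "0 \<le> a" by (cases "?p X") auto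
    have "?p s \<noteq> top" using le(1) a by (auto simp: top_unique)
    then obtain a' where a': "?p s = ennreal a'" "0 \<le> a'" by (cases "?p s") auto
    show ?thesis
    proof (cases "?n X = top")
      case True
      then have "?n s + ennreal a = top" using id' a by simp
      then have "?n s = top" by (simp add: ennreal_add_eq_top)
      then show ?thesis using True a a' by simp
    next
      case F: False
      then obtain b where b: "?n X = ennreal b" "0 \<le> b" by (cases "?n X") auto
      have "?n s \<noteq> top" using id' a a' b by auto
      then obtain b' where b': "?n s = ennreal b'" "0 \<le> b'" by (cases "?n s") auto
      have "ennreal (a' + b) = ennreal (b' + a)" using id' a a' b b' by simp
      then have "a' + b = b' + a" using a a' b b' by (subst (asm) ennreal_inj) auto
      then show ?thesis using a a' b b' by (simp add: enn2ereal_ennreal)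
    qed
  qed
  then show ?thesis by (simp add: expectation_ext_def s_def)
qed

section \<open>The algebraic identity\<close>

lemma norm_real2_sq: "(norm (v :: real^2))\<^sup>2 = (v $ 1)\<^sup>2 + (v $ 2)\<^sup>2"
  unfolding power2_norm_eq_inner inner_vec_def sum_2 by (simp add: power2_eq_square)

lemma norm_real2_pow4: "norm (v :: real^2) ^ 4 = ((v $ 1)\<^sup>2 + (v $ 2)\<^sup>2)\<^sup>2"
proof -
  have "norm v ^ 4 = ((norm v)\<^sup>2)\<^sup>2" by (simp flip: power_mult)
  then show ?thesis by (simp only: norm_real2_sq)
qed

lemma vector2_eq: "(vector [a, b] :: real^2) = a *\<^sub>R axis 1 1 + b *\<^sub>R axis 2 1"
  by (simp add: vec_eq_iff forall_2 axis_def)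

text \<open>Contracting \<open>y \<otimes> y\<close> and \<open>z \<otimes> z\<close> with the delta
  tensor gives \<open>4 (y \<bullet> z)\<^sup>2 + 2 \<bar>y\<bar>\<^sup>2
  \<bar>z\<bar>\<^sup>2\<close>, the part of the expansion quadratic in both; contracting
  \<open>q\<close> instead of \<open>y \<otimes> y\<close> gives \<open>c_T\<close>, provided
  \<open>q\<close> is symmetric. The term \<open>a_T\<close> stands on both sides and is never
  unfolded.\<close>

lemma renormalised_integrand:
  assumes "q 1 2 T = q 2 1 T"
  shows "norm (y + z) ^ 4 - c_T q T z - 4 * (b_T q T y \<bullet> z) - a_T q T S K R y
    = wick4 q T S K R y + 4 * (wick3 q T y \<bullet> z) + 4 * (y \<bullet> odd_pow z 3) + even_pow z 4 + wick2_term q T y z"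
proof -
  have o: "odd_pow v 3 $ i = ((v $ 1)\<^sup>2 + (v $ 2)\<^sup>2) * v $ i" for v i
    by (simp add: odd_pow_def norm_real2_sq)
  show ?thesis
    unfolding wick4_def even_pow_def norm_real2_pow4 c_T_def wick2_term_def wick2_def delta_def wick3_def
      inner_vec_def sum_2 b_T_def
    by (simp add: o assms power2_eq_square algebra_simps)
qed

section \<open>The drift\<close>

lemma integral_measurable_snd:
  fixes h :: "'a \<Rightarrow> 'b \<Rightarrow> 'c::{banach, second_countable_topology}"
  assumes "sigma_finite_measure A" and "(\<lambda>p. h (fst p) (snd p)) \<in> borel_measurable (A \<Otimes>\<^sub>M B)"
  shows "(\<lambda>y. \<integral>x. h x y \<partial>A) \<in> borel_measurable B"
  using measurable_compose[OF measurable_pair_swap' assms(2)]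
  by (intro sigma_finite_measure.borel_measurable_lebesgue_integral[OF assms(1)]) (simp add: case_prod_beta')

locale drift_field = gaussian_field +
  fixes T :: real and u :: "real \<Rightarrow> path \<Rightarrow> real^2 \<Rightarrow> real"
  assumes T: "0 < T" and u: "u \<in> drifts P"
begin

abbreviation "N \<equiv> low_modes T"

lemma u_measurable: "(\<lambda>(t, \<omega>). u t \<omega>) \<in> predictable_sigma F (space M) \<rightarrow>\<^sub>M L2_dot_borel"
  using u by (simp add: drifts_def)

lemma u_L2_dot: "0 \<le> t \<Longrightarrow> \<omega> \<in> space P \<Longrightarrow> u t \<omega> \<in> L2_dot"
  using measurable_space[OF u_measurable, of "(t, \<omega>)"]
  by (simp add: space_L2_dot_borel predictable_sigma_def space_measure_of_conv)

text \<open>The extension by 0 outside the domain of predictability is what allows the product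
  measure of the whole line with \<open>M\<close>.\<close>

definition u_coeff :: "int^2 \<Rightarrow> real \<Rightarrow> path \<Rightarrow> complex" where
  "u_coeff n t \<omega> = (if (t, \<omega>) \<in> {0..} \<times> space M then fourier_coeff (u t \<omega>) n else 0)"

definition u_norm :: "real \<Rightarrow> path \<Rightarrow> real" where
  "u_norm t \<omega> = (if (t, \<omega>) \<in> {0..} \<times> space M then l2_norm (u t \<omega>) else 0)"

lemma u_coeff_joint [measurable]: "(\<lambda>x. u_coeff n (fst x) (snd x)) \<in> borel_measurable (lborel \<Otimes>\<^sub>M M)"
  using predictable_joint[OF measurable_compose[OF u_measurable fourier_coeff_L2_dot_measurable[of n]]]
  unfolding u_coeff_def case_prod_beta' by (simp cong: measurable_cong_sets sets_pair_measure_cong)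

lemma u_norm_joint [measurable]: "(\<lambda>x. u_norm (fst x) (snd x)) \<in> borel_measurable (lborel \<Otimes>\<^sub>M M)"
  using predictable_joint[OF measurable_compose[OF u_measurable l2_norm_L2_dot_measurable]]
  unfolding u_norm_def case_prod_beta' by (simp cong: measurable_cong_sets sets_pair_measure_cong)

lemma u_coeff_le: "cmod (u_coeff n t \<omega>) \<le> u_norm t \<omega>"
  using cmod_fourier_coeff_le[OF L2_dot_sq_int[OF u_L2_dot]] by (auto simp: u_coeff_def u_norm_def)

definition Z_coeff :: "int^2 \<Rightarrow> path \<Rightarrow> complex" where
  "Z_coeff n \<omega> = (\<integral>t. indicator {0..T} t *\<^sub>R (complex_of_real (J_symbol \<zeta> t (rvec n)) * u_coeff n t \<omega>) \<partial>lborel)"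

lemma J_measurable [measurable]: "(\<lambda>t. J_symbol \<zeta> t \<xi>) \<in> borel_measurable borel"
  by (intro borel_measurable_continuous_onI continuous_J_symbol \<zeta>)

lemma Z_coeff_measurable [measurable]: "Z_coeff n \<in> borel_measurable M"
  unfolding Z_coeff_def by (rule integral_measurable_snd[OF lborel.sigma_finite_measure_axioms]) simp

lemma drift_cost_measurable: "drift_cost u \<in> borel_measurable M"
proof -
  let ?g = "\<lambda>\<omega>. 1 / 2 * (\<integral>t. indicator {0..} t *\<^sub>R (u_norm t \<omega>)\<^sup>2 \<partial>lborel)"
  have "?g \<in> borel_measurable M"
    by (intro borel_measurable_times borel_measurable_const integral_measurable_snd lborel.sigma_finite_measure_axioms) simp
  moreover have "drift_cost u \<omega> = ?g \<omega>" if "\<omega> \<in> space M" for \<omega>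
    unfolding drift_cost_def set_lebesgue_integral_def using that
    by (intro arg_cong2[where f="(*)"] refl Bochner_Integration.integral_cong) (auto simp: u_norm_def indicator_def)
  ultimately show ?thesis using measurable_cong[of M "drift_cost u" ?g borel] by blast
qed

text \<open>On \<open>{0..T}\<close> the symbol is bounded by continuity, and
  \<open>\<bar>a\<bar> \<le> 1 + a\<^sup>2\<close> passes from square integrability of the drift to
  integrability. This justifies exchanging the time integral with the finite Fourier sum.\<close>

lemma u_coeff_integrable:
  "AE \<omega> in M. \<forall>n. integrable lborel (\<lambda>t. indicator {0..T} t *\<^sub>R (complex_of_real (J_symbol \<zeta> t (rvec n)) * u_coeff n t \<omega>))"
proof -
  have "AE \<omega> in M. (\<integral>\<^sup>+t\<in>{0..}. ennreal ((l2_norm (u t \<omega>))\<^sup>2) \<partial>lborel) < \<infinity>"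
    using u by (simp add: drifts_def)
  then show ?thesis using AE_space
  proof (eventually_elim, intro allI)
    fix \<omega> n
    assume fin: "(\<integral>\<^sup>+t\<in>{0..}. ennreal ((l2_norm (u t \<omega>))\<^sup>2) \<partial>lborel) < \<infinity>" and \<omega>: "\<omega> \<in> space M"
    have sec: "(\<lambda>t. (t, \<omega>)) \<in> lborel \<rightarrow>\<^sub>M lborel \<Otimes>\<^sub>M M" using measurable_Pair2'[OF \<omega>] .
    have [measurable]: "(\<lambda>t. u_coeff n t \<omega>) \<in> borel_measurable borel" "(\<lambda>t. u_norm t \<omega>) \<in> borel_measurable borel"
      using measurable_compose[OF sec u_coeff_joint[of n]] measurable_compose[OF sec u_norm_joint] by simp_all
    have "bounded ((\<lambda>t. J_symbol \<zeta> t (rvec n)) ` {0..T})"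
      by (intro compact_imp_bounded compact_continuous_image continuous_J_symbol \<zeta>) auto
    then obtain B where "\<forall>y\<in>(\<lambda>t. J_symbol \<zeta> t (rvec n)) ` {0..T}. norm y \<le> B"
      unfolding bounded_iff by blast
    then have B: "\<bar>J_symbol \<zeta> t (rvec n)\<bar> \<le> B" if "t \<in> {0..T}" for t using that by auto
    have B0: "0 \<le> B" using B[of 0] T by simp
    have e: "ennreal ((u_norm t \<omega>)\<^sup>2) * indicator {0..} t = ennreal ((l2_norm (u t \<omega>))\<^sup>2) * indicator {0..} t" for t
      using \<omega> by (auto simp: u_norm_def indicator_def)
    have "(\<integral>\<^sup>+t. ennreal (indicator {0..T} t * (u_norm t \<omega>)\<^sup>2) \<partial>lborel) \<le> (\<integral>\<^sup>+t\<in>{0..}. ennreal ((u_norm t \<omega>)\<^sup>2) \<partial>lborel)"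
      by (intro nn_integral_mono) (auto simp: indicator_def)
    then have "integrable lborel (\<lambda>t. indicator {0..T} t * (u_norm t \<omega>)\<^sup>2)"
      using fin unfolding e by (intro integrableI_nonneg) auto
    moreover have "integrable lborel (indicator {0..T} :: real \<Rightarrow> real)"
      using T by (intro integrable_real_indicator) auto
    ultimately have i: "integrable lborel (\<lambda>t. B * (indicator {0..T} t + indicator {0..T} t * (u_norm t \<omega>)\<^sup>2))"
      by (intro integrable_mult_right Bochner_Integration.integrable_add)
    show "integrable lborel (\<lambda>t. indicator {0..T} t *\<^sub>R (complex_of_real (J_symbol \<zeta> t (rvec n)) * u_coeff n t \<omega>))"
    proof (rule Bochner_Integration.integrable_bound[OF i])
      show "(\<lambda>t. indicator {0..T} t *\<^sub>R (complex_of_real (J_symbol \<zeta> t (rvec n)) * u_coeff n t \<omega>)) \<in> borel_measurable lborel"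
        by simp
      show "AE t in lborel. norm (indicator {0..T} t *\<^sub>R (complex_of_real (J_symbol \<zeta> t (rvec n)) * u_coeff n t \<omega>))
          \<le> norm (B * (indicator {0..T} t + indicator {0..T} t * (u_norm t \<omega>)\<^sup>2))"
      proof (rule AE_I2)
        fix t
        show "norm (indicator {0..T} t *\<^sub>R (complex_of_real (J_symbol \<zeta> t (rvec n)) * u_coeff n t \<omega>))
          \<le> norm (B * (indicator {0..T} t + indicator {0..T} t * (u_norm t \<omega>)\<^sup>2))"
        proof (cases "t \<in> {0..T}")
          case True
          have "0 \<le> (u_norm t \<omega> - 1)\<^sup>2" by simp
          then have "2 * u_norm t \<omega> \<le> 1 + (u_norm t \<omega>)\<^sup>2" by (simp add: power2_diff)
          moreover have "0 \<le> u_norm t \<omega>" by (simp add: u_norm_def)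
          ultimately have "cmod (u_coeff n t \<omega>) \<le> 1 + (u_norm t \<omega>)\<^sup>2"
            using u_coeff_le[of n t \<omega>] by linarith
          then have "\<bar>J_symbol \<zeta> t (rvec n)\<bar> * cmod (u_coeff n t \<omega>) \<le> B * (1 + (u_norm t \<omega>)\<^sup>2)"
            using B[OF True] B0 by (intro mult_mono) auto
          then show ?thesis using True B0 by (simp add: norm_mult)
        qed simp
      qed
    qed
  qed
qed

text \<open>Up to time \<open>T\<close> the multiplier kills all but finitely many modes, so its
  Fourier series raises no question of convergence.\<close>

lemma Z_shift_eq: "AE \<omega> in M. Z_shift \<zeta> T u \<omega> = trig_poly N (\<lambda>n. Z_coeff n \<omega>)"
  using u_coeff_integrable AE_space
proof eventually_elim
  case (elim \<omega>)
  show ?case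
  proof
    fix x
    let ?g = "\<lambda>n t. indicator {0..T} t *\<^sub>R (complex_of_real (J_symbol \<zeta> t (rvec n)) * u_coeff n t \<omega>)"
    have "Z_shift \<zeta> T u \<omega> x = (\<integral>t. Re (\<Sum>n\<in>N. ?g n t * mode n x) \<partial>lborel)"
      unfolding Z_shift_def set_lebesgue_integral_def
    proof (intro Bochner_Integration.integral_cong refl)
      fix t :: real
      show "indicator {0..T} t *\<^sub>R fourier_multiplier (J_symbol \<zeta> t) (u t \<omega>) x = Re (\<Sum>n\<in>N. ?g n t * mode n x)"
      proof (cases "t \<in> {0..T}")
        case True
        have "(\<Sum>\<^sub>\<infinity>n. complex_of_real (J_symbol \<zeta> t (rvec n)) * fourier_coeff (u t \<omega>) n * mode n x)
           = (\<Sum>\<^sub>\<infinity>n\<in>N. complex_of_real (J_symbol \<zeta> t (rvec n)) * fourier_coeff (u t \<omega>) n * mode n x)"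
          using J_symbol_eq_0_high[OF \<zeta>, of t T] True by (intro infsum_cong_neutral) auto
        also have "\<dots> = (\<Sum>n\<in>N. ?g n t * mode n x)"
          using True elim(2) by (simp add: finite_low_modes u_coeff_def)
        finally show ?thesis using True by (simp add: fourier_multiplier_def)
      qed simp
    qed
    also have "\<dots> = Re (\<integral>t. (\<Sum>n\<in>N. ?g n t * mode n x) \<partial>lborel)"
      using elim(1) by (intro integral_Re Bochner_Integration.integrable_sum integrable_mult_left) auto
    also have "(\<integral>t. (\<Sum>n\<in>N. ?g n t * mode n x) \<partial>lborel) = (\<Sum>n\<in>N. \<integral>t. ?g n t * mode n x \<partial>lborel)"
      by (intro Bochner_Integration.integral_sum integrable_mult_left) (use elim(1) in blast)
    also have "\<dots> = (\<Sum>n\<in>N. Z_coeff n \<omega> * mode n x)"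
      unfolding Z_coeff_def by (intro sum.cong refl integral_mult_left_zero)
    finally show "Z_shift \<zeta> T u \<omega> x = trig_poly N (\<lambda>n. Z_coeff n \<omega>) x" by (simp add: trig_poly_def)
  qed
qed

end

section \<open>The Wick power of order four\<close>

lemma trig_poly_joint:
  assumes "\<And>n. n \<in> N \<Longrightarrow> (\<lambda>\<omega>. c n \<omega>) \<in> borel_measurable M"
  shows "(\<lambda>p. trig_poly N (\<lambda>n. c n (snd p)) (fst p)) \<in> borel_measurable (torus \<Otimes>\<^sub>M M)"
proof -
  have [measurable]: "mode n \<in> borel_measurable torus" for n by simp
  show ?thesis unfolding trig_poly_def
    by (intro borel_measurable_Re[THEN measurable_compose[rotated]] borel_measurable_sum borel_measurable_times
        measurable_compose[OF measurable_snd assms] measurable_compose[OF measurable_fst]) auto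
qed

lemma grad_trig_poly_joint:
  assumes "\<And>n. n \<in> N \<Longrightarrow> (\<lambda>\<omega>. c n \<omega>) \<in> borel_measurable M"
  shows "(\<lambda>p. grad (trig_poly N (\<lambda>n. c n (snd p))) (fst p)) \<in> borel_measurable (torus \<Otimes>\<^sub>M M)"
proof -
  have "(\<lambda>p. grad (trig_poly N (\<lambda>n. c n (snd p))) (fst p) $ i) \<in> borel_measurable (torus \<Otimes>\<^sub>M M)" for i
    unfolding grad_trig_poly using assms by (intro trig_poly_joint) auto
  then show ?thesis
    by (subst borel_measurable_euclidean_space) (auto simp: Basis_vec_def inner_axis)
qed

locale wick_setting = gaussian_field +
  fixes T :: real and S K L R :: "path \<Rightarrow> real^2 \<Rightarrow> paths2"
  assumes T: "0 < T"
    and iterated: "iterated_integrals P W q S K L R"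
    and K_joint: "jointly_measurable P K" and R_joint: "jointly_measurable P R"
begin

text \<open>A trigonometric polynomial for every path, hence jointly measurable; the gradient of
  \<open>Y_field\<close> coincides with it only almost surely.\<close>

definition gradY :: "path \<Rightarrow> real^2 \<Rightarrow> real^2" where
  "gradY \<omega> x = grad (trig_poly (low_modes T) (\<lambda>n. W n T \<omega>)) x"

definition Y4 :: "path \<Rightarrow> real^2 \<Rightarrow> real" where
  "Y4 \<omega> x = wick4 q T (S \<omega> x) (K \<omega> x) (R \<omega> x) (gradY \<omega> x)"

lemma gradY_eq: "AE \<omega> in M. \<forall>i x. gradY \<omega> x $ i = dY W i x T \<omega>"
  using Y_field_eq[of T] T by (simp add: dY_def gradY_def eventually_mono)

text \<open>The two integrals against \<open>q 1 2\<close> are Stieltjes integrals with respect to a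
  vanishing integrator.\<close>

lemma Y4_eq: "Y4 \<omega> x = ((gradY \<omega> x $ 1)\<^sup>2 + (gradY \<omega> x $ 2)\<^sup>2)\<^sup>2
   - ((6 * q 1 1 T + 2 * q 2 2 T) * (gradY \<omega> x $ 1)\<^sup>2 + (6 * q 2 2 T + 2 * q 1 1 T) * (gradY \<omega> x $ 2)\<^sup>2
     - 3 * (q 1 1 T)\<^sup>2 - 3 * (q 2 2 T)\<^sup>2 - 2 * q 1 1 T * q 2 2 T
     + 8 * K \<omega> x 1 2 T + 8 * R \<omega> x 1 2 T + 8 * K \<omega> x 2 1 T + 8 * R \<omega> x 2 1 T)"
proof -
  have "stieltjes_integral g (q 1 2) T = 0" for g
    by (rule stieltjes_integral_zero[OF q_offdiag_12])
  moreover have "q 1 2 T = 0" using q_offdiag_12 T by simp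
  ultimately show ?thesis
    unfolding Y4_def wick4_def a_T_def even_pow_def norm_real2_pow4 by (simp add: algebra_simps)
qed

text \<open>The Ito integrals at time \<open>T\<close> have mean zero once their second moments are
  finite; the bounds on the first absolute moments do not depend on \<open>x\<close>, as Fubini on
  the torus will require.\<close>

lemma KR_moments:
  assumes "i \<noteq> j"
  shows "integrable M (\<lambda>\<omega>. K \<omega> x i j T)" "(\<integral>\<omega>. K \<omega> x i j T \<partial>M) = 0"
    "(\<integral>\<omega>. \<bar>K \<omega> x i j T\<bar> \<partial>M) \<le> 1 + 4 * (q j j T * (q i i T * q j j T)) * q i i T"
    "integrable M (\<lambda>\<omega>. R \<omega> x i j T)" "(\<integral>\<omega>. R \<omega> x i j T \<partial>M) = 0"
    "(\<integral>\<omega>. \<bar>R \<omega> x i j T\<bar> \<partial>M) \<le> 1 + 4 * (4 * (q j j T)\<^sup>2 * q i i T) * q i i T"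
proof -
  have T': "0 \<le> T" using T by simp
  have S: "ito_integral M F (dY W j x) (\<lambda>t \<omega>. q j j t) (dY W i x) (\<lambda>t \<omega>. S \<omega> x i j t)"
    and K: "ito_integral M F (dY W i x) (\<lambda>t \<omega>. q i i t)
          (\<lambda>s \<omega>. stieltjes_integral (\<lambda>r. dY W i x r \<omega>) (q j j) s) (\<lambda>t \<omega>. K \<omega> x i j t)"
    and L: "ito_integral M F (dY W i x) (\<lambda>t \<omega>. q i i t) (\<lambda>s \<omega>. q j j s) (\<lambda>t \<omega>. L \<omega> x i j t)"
    and R: "ito_integral M F (dY W i x) (\<lambda>t \<omega>. q i i t) (\<lambda>s \<omega>. L \<omega> x i j s) (\<lambda>t \<omega>. R \<omega> x i j t)"
    using iterated assms by (auto simp: iterated_integrals_def Let_def)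
  \<comment> \<open>Bounds on the second moments of the inner integrals. Since \<open>L\<close> is
    itself an Ito integral, \<open>?l\<close> already carries one factor 4.\<close>
  let ?k = "q j j T * (q i i T * q j j T)" and ?l = "4 * (q j j T)\<^sup>2 * q i i T"
  have nn: "0 \<le> ?k" "0 \<le> ?l" using q_nonneg[OF T'] by auto
  have kb: "msq M (\<lambda>\<omega>. stieltjes_integral (\<lambda>r. dY W i x r \<omega>) (q j j) s) \<le> ennreal ?k"
    if "0 \<le> s" "s \<le> T" for s
  proof -
    have "msq M (\<lambda>\<omega>. stieltjes_integral (\<lambda>r. dY W i x r \<omega>) (q j j) s)
      \<le> ennreal (q j j s) * (ennreal (q i i s) * ennreal (q j j s))"
      by (rule stieltjes_dY_second_moment[OF S that(1)])
    also have "\<dots> \<le> ennreal (q j j T) * (ennreal (q i i T) * ennreal (q j j T))"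
      using that by (intro mult_mono ennreal_leI q_mono) auto
    also have "\<dots> = ennreal ?k" using q_nonneg[OF T'] by (simp add: ennreal_mult)
    finally show ?thesis .
  qed
  have lb: "msq M (\<lambda>\<omega>. L \<omega> x i j s) \<le> ennreal ?l" if s: "0 \<le> s" "s \<le> T" for s
  proof -
    have "msq M (\<lambda>\<omega>. L \<omega> x i j s) \<le> ennreal (4 * (q j j T)\<^sup>2 * q i i s)"
    proof (rule ito_dY_second_moment[OF L s(1)])
      fix r assume r: "0 \<le> r" "r \<le> s"
      have "(q j j r)\<^sup>2 \<le> (q j j T)\<^sup>2" using r s q_nonneg[of r j] by (intro power_mono q_mono) auto
      then show "msq M (\<lambda>\<omega>. q j j r) \<le> ennreal ((q j j T)\<^sup>2)"
        using P.emeasure_space_1 by (simp add: ennreal_leI)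
    qed simp
    also have "\<dots> \<le> ennreal ?l" using s by (intro ennreal_leI mult_left_mono q_mono) auto
    finally show ?thesis .
  qed
  note k2 = ito_dY_second_moment[OF K T' kb nn(1)]
  note r2 = ito_dY_second_moment[OF R T' lb nn(2)]
  have nn2: "0 \<le> 4 * ?k * q i i T" "0 \<le> 4 * ?l * q i i T" using nn q_nonneg[OF T'] by auto
  show "integrable M (\<lambda>\<omega>. K \<omega> x i j T)" "(\<integral>\<omega>. K \<omega> x i j T \<partial>M) = 0"
    "(\<integral>\<omega>. \<bar>K \<omega> x i j T\<bar> \<partial>M) \<le> 1 + 4 * ?k * q i i T"
    using ito_dY_mean[OF K T' k2 nn2(1)] by auto
  show "integrable M (\<lambda>\<omega>. R \<omega> x i j T)" "(\<integral>\<omega>. R \<omega> x i j T \<partial>M) = 0"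
    "(\<integral>\<omega>. \<bar>R \<omega> x i j T\<bar> \<partial>M) \<le> 1 + 4 * ?l * q i i T"
    using ito_dY_mean[OF R T' r2 nn2(2)] by auto
qed

lemma W_measurable_low: "n \<in> low_modes T \<Longrightarrow> W n T \<in> borel_measurable M"
  using T low_modes_simps(1) by (intro W_measurable) auto

lemma Y4_joint: "(\<lambda>p. Y4 (snd p) (fst p)) \<in> borel_measurable (torus \<Otimes>\<^sub>M M)"
proof -
  have Y[measurable]: "(\<lambda>p. gradY (snd p) (fst p) $ i) \<in> borel_measurable (torus \<Otimes>\<^sub>M M)" for i
    unfolding gradY_def grad_trig_poly using W_measurable_low by (intro trig_poly_joint) auto
  have K: "(\<lambda>p. K (snd p) (fst p) i j T) \<in> borel_measurable (torus \<Otimes>\<^sub>M M)"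
    and R: "(\<lambda>p. R (snd p) (fst p) i j T) \<in> borel_measurable (torus \<Otimes>\<^sub>M M)" if "i \<noteq> j" for i j
    using K_joint R_joint that T unfolding jointly_measurable_def
    by (simp_all add: case_prod_beta' cong: measurable_cong_sets sets_pair_measure_cong)
  have [measurable]: "(\<lambda>p. K (snd p) (fst p) 1 2 T) \<in> borel_measurable (torus \<Otimes>\<^sub>M M)"
    "(\<lambda>p. K (snd p) (fst p) 2 1 T) \<in> borel_measurable (torus \<Otimes>\<^sub>M M)"
    "(\<lambda>p. R (snd p) (fst p) 1 2 T) \<in> borel_measurable (torus \<Otimes>\<^sub>M M)"
    "(\<lambda>p. R (snd p) (fst p) 2 1 T) \<in> borel_measurable (torus \<Otimes>\<^sub>M M)"
    using K R by simp_all
  show ?thesis unfolding Y4_eq by measurable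
qed

text \<open>Where the constants in \<open>a_T\<close> are decided: the mean of the quadratic terms,
  lowered by the constant terms, equals the fourth moment of the gradient. The absolute bound
  estimates each term separately.\<close>

lemma Y4_moments:
  obtains C where "\<And>x. integrable M (\<lambda>\<omega>. Y4 \<omega> x)" "\<And>x. (\<integral>\<omega>. Y4 \<omega> x \<partial>M) = 0" "\<And>x. (\<integral>\<omega>. \<bar>Y4 \<omega> x\<bar> \<partial>M) \<le> C"
proof -
  have T': "0 \<le> T" using T by simp
  let ?a = "6 * q 1 1 T + 2 * q 2 2 T" and ?b = "6 * q 2 2 T + 2 * q 1 1 T"
  let ?c = "3 * (q 1 1 T)\<^sup>2 + 3 * (q 2 2 T)\<^sup>2 + 2 * q 1 1 T * q 2 2 T"
  let ?kb = "\<lambda>i j. 1 + 4 * (q j j T * (q i i T * q j j T)) * q i i T"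
  let ?rb = "\<lambda>i j. 1 + 4 * (4 * (q j j T)\<^sup>2 * q i i T) * q i i T"
  have ne: "(1::2) \<noteq> 2" "(2::2) \<noteq> 1" by simp_all
  have ab: "0 \<le> ?a" "0 \<le> ?b" "0 \<le> ?c" using q_nonneg[OF T'] by auto
  define C where "C = ?c + ?a * q 1 1 T + ?b * q 2 2 T + ?c + 8 * ?kb 1 2 + 8 * ?rb 1 2 + 8 * ?kb 2 1 + 8 * ?rb 2 1"
  have "integrable M (\<lambda>\<omega>. Y4 \<omega> x) \<and> (\<integral>\<omega>. Y4 \<omega> x \<partial>M) = 0 \<and> (\<integral>\<omega>. \<bar>Y4 \<omega> x\<bar> \<partial>M) \<le> C" for x
  proof -
    let ?y = "\<lambda>i \<omega>. dY W i x T \<omega>"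
    define U where "U \<omega> = ((?y 1 \<omega>)\<^sup>2 + (?y 2 \<omega>)\<^sup>2)\<^sup>2 - ?a * (?y 1 \<omega>)\<^sup>2 - ?b * (?y 2 \<omega>)\<^sup>2 + ?c
       - 8 * K \<omega> x 1 2 T - 8 * R \<omega> x 1 2 T - 8 * K \<omega> x 2 1 T - 8 * R \<omega> x 2 1 T" for \<omega>
    define U' where "U' \<omega> = ((?y 1 \<omega>)\<^sup>2 + (?y 2 \<omega>)\<^sup>2)\<^sup>2 + ?a * (?y 1 \<omega>)\<^sup>2 + ?b * (?y 2 \<omega>)\<^sup>2 + ?c
       + 8 * \<bar>K \<omega> x 1 2 T\<bar> + 8 * \<bar>R \<omega> x 1 2 T\<bar> + 8 * \<bar>K \<omega> x 2 1 T\<bar> + 8 * \<bar>R \<omega> x 2 1 T\<bar>" for \<omega>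
    note ints = dY_fourth_moment(1)[OF T, of x] sq_intD(2)[OF dY_sq_int[OF T']]
      KR_moments(1)[OF ne(1)] KR_moments(1)[OF ne(2)] KR_moments(4)[OF ne(1)] KR_moments(4)[OF ne(2)]
    have UV: "AE \<omega> in M. Y4 \<omega> x = U \<omega>"
      using gradY_eq by eventually_elim (simp add: Y4_eq U_def)
    have Ui: "integrable M U" unfolding U_def using ints by simp
    have U'i: "integrable M U'" unfolding U'_def using ints by simp
    have "(\<integral>\<omega>. U \<omega> \<partial>M) = ?c - ?a * q 1 1 T - ?b * q 2 2 T + ?c"
      unfolding U_def using ints dY_fourth_moment(2)[OF T, of x] dY_second_moment[OF T']
        KR_moments(2)[OF ne(1)] KR_moments(2)[OF ne(2)] KR_moments(5)[OF ne(1)] KR_moments(5)[OF ne(2)] P.prob_space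
      by simp
    \<comment> \<open>Both \<open>?c\<close> and the two quadratic terms count:
      \<open>?a * q 1 1 T + ?b * q 2 2 T\<close> is twice \<open>?c\<close>.\<close>
    also have "\<dots> = 0" by (simp add: power2_eq_square algebra_simps)
    finally have Ue: "(\<integral>\<omega>. U \<omega> \<partial>M) = 0" .
    have "(\<integral>\<omega>. \<bar>U \<omega>\<bar> \<partial>M) \<le> (\<integral>\<omega>. U' \<omega> \<partial>M)"
    proof (rule integral_mono[OF integrable_abs[OF Ui] U'i])
      fix \<omega>
      have "0 \<le> ?a * (?y 1 \<omega>)\<^sup>2" "0 \<le> ?b * (?y 2 \<omega>)\<^sup>2" "0 \<le> ((?y 1 \<omega>)\<^sup>2 + (?y 2 \<omega>)\<^sup>2)\<^sup>2"
        using ab by (auto intro!: mult_nonneg_nonneg)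
      then show "\<bar>U \<omega>\<bar> \<le> U' \<omega>" unfolding U_def U'_def using ab(3) by linarith
    qed
    also have "(\<integral>\<omega>. U' \<omega> \<partial>M) = ?c + ?a * q 1 1 T + ?b * q 2 2 T + ?c
        + 8 * (\<integral>\<omega>. \<bar>K \<omega> x 1 2 T\<bar> \<partial>M) + 8 * (\<integral>\<omega>. \<bar>R \<omega> x 1 2 T\<bar> \<partial>M)
        + 8 * (\<integral>\<omega>. \<bar>K \<omega> x 2 1 T\<bar> \<partial>M) + 8 * (\<integral>\<omega>. \<bar>R \<omega> x 2 1 T\<bar> \<partial>M)"
      unfolding U'_def using ints dY_fourth_moment(2)[OF T, of x] dY_second_moment[OF T'] P.prob_space by simp
    also have "\<dots> \<le> C"
      unfolding C_def by (intro add_mono mult_left_mono KR_moments(3) KR_moments(6) ne order_refl) simp_all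
    finally have Ub: "(\<integral>\<omega>. \<bar>U \<omega>\<bar> \<partial>M) \<le> C" .
    have Um: "U \<in> borel_measurable M" using Ui by simp
    have Vm: "(\<lambda>\<omega>. Y4 \<omega> x) \<in> borel_measurable M"
      using measurable_compose[OF measurable_Pair1'[of x torus M] Y4_joint] by simp
    have "AE \<omega> in M. \<bar>Y4 \<omega> x\<bar> = \<bar>U \<omega>\<bar>" using UV by eventually_elim simp
    then have "(\<integral>\<omega>. \<bar>Y4 \<omega> x\<bar> \<partial>M) = (\<integral>\<omega>. \<bar>U \<omega>\<bar> \<partial>M)"
      using Um Vm by (intro integral_cong_AE) auto
    then show ?thesis
      using Ui Ue Ub integrable_cong_AE[OF Vm Um UV] integral_cong_AE[OF Vm Um UV] by simp
  qed
  then show thesis using that by blast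
qed

text \<open>Fubini on the product of the torus with \<open>M\<close>, whose hypothesis holds because
  the absolute moments are bounded uniformly in the point and the torus has mass 1.\<close>

lemma Y4_torus_integral:
  shows "AE \<omega> in M. integrable torus (Y4 \<omega>)" "integrable M (\<lambda>\<omega>. \<integral>x. Y4 \<omega> x \<partial>torus)"
    "(\<integral>\<omega>. (\<integral>x. Y4 \<omega> x \<partial>torus) \<partial>M) = 0"
proof -
  interpret ps: pair_sigma_finite torus M ..
  obtain C where C: "\<And>x. integrable M (\<lambda>\<omega>. Y4 \<omega> x)" "\<And>x. (\<integral>\<omega>. Y4 \<omega> x \<partial>M) = 0" "\<And>x. (\<integral>\<omega>. \<bar>Y4 \<omega> x\<bar> \<partial>M) \<le> C"
    using Y4_moments by blast
  note [measurable] = Y4_joint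
  have V: "integrable (torus \<Otimes>\<^sub>M M) (\<lambda>(x, \<omega>). Y4 \<omega> x)"
  proof (rule ps.Fubini_integrable)
    show "(\<lambda>(x, \<omega>). Y4 \<omega> x) \<in> borel_measurable (torus \<Otimes>\<^sub>M M)" using Y4_joint by (simp add: case_prod_beta')
    have "(\<lambda>x. \<integral>\<omega>. \<bar>Y4 \<omega> x\<bar> \<partial>M) \<in> borel_measurable torus"
      by (intro M.borel_measurable_lebesgue_integral) (simp add: case_prod_beta')
    moreover have "0 \<le> (\<integral>\<omega>. \<bar>Y4 \<omega> x\<bar> \<partial>M)" for x by simp
    ultimately show "integrable torus (\<lambda>x. \<integral>\<omega>. norm (case (x, \<omega>) of (x, \<omega>) \<Rightarrow> Y4 \<omega> x) \<partial>M)"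
      using C(3) by (intro torus.integrable_const_bound[where B=C]) auto
    show "AE x in torus. integrable M (\<lambda>\<omega>. case (x, \<omega>) of (x, \<omega>) \<Rightarrow> Y4 \<omega> x)" using C(1) by simp
  qed
  show "AE \<omega> in M. integrable torus (Y4 \<omega>)" using ps.AE_integrable_snd[OF V] by simp
  show "integrable M (\<lambda>\<omega>. \<integral>x. Y4 \<omega> x \<partial>torus)" using ps.integrable_snd[OF V] by simp
  have "(\<integral>\<omega>. (\<integral>x. Y4 \<omega> x \<partial>torus) \<partial>M) = (\<integral>x. (\<integral>\<omega>. Y4 \<omega> x \<partial>M) \<partial>torus)"
    by (rule ps.Fubini_integral[OF V])
  then show "(\<integral>\<omega>. (\<integral>x. Y4 \<omega> x \<partial>torus) \<partial>M) = 0" by (simp add: C(2))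
qed

end

section \<open>Assembly of the two representations\<close>

definition phi_integrand :: "paths2 \<Rightarrow> real \<Rightarrow> real^2 \<Rightarrow> real^2 \<Rightarrow> real" where
  "phi_integrand q T y z = 4 * (y \<bullet> odd_pow z 3) + 4 * (wick3 q T y \<bullet> z) + wick2_term q T y z"

lemma continuous_phi_integrand:
  "continuous_on UNIV (\<lambda>p. phi_integrand q T (fst p) (snd p))"
  unfolding phi_integrand_def odd_pow_def wick3_def b_T_def vector2_eq wick2_term_def wick2_def
  by (intro continuous_intros)

lemma trig_poly_cong: "(\<And>n. n \<in> N \<Longrightarrow> c n = d n) \<Longrightarrow> trig_poly N c = trig_poly N d"
  by (simp add: trig_poly_def fun_eq_iff)

theorem theorem3p3:
  fixes \<alpha> \<kappa> T :: real
    and \<zeta> \<theta> :: "real \<Rightarrow> real"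
    and P :: "path measure"
    and f :: "distribution \<Rightarrow> real"
    and W :: "int^2 \<Rightarrow> real \<Rightarrow> path \<Rightarrow> complex"
    and q :: paths2
    and S K L R :: "path \<Rightarrow> real^2 \<Rightarrow> paths2"
    and u :: "real \<Rightarrow> path \<Rightarrow> real^2 \<Rightarrow> real"
  assumes "\<alpha> < -1" and "wiener_measure \<alpha> P"
    and "cutoff \<zeta>"
    and "\<And>n. n \<noteq> 0 \<Longrightarrow> Y_coefficient \<zeta> P n (W n)"
    and "\<And>i j x. quadratic_covariation (completion P) (wiener_filtration P)
                   (dY W i x) (dY W j x) (\<lambda>t \<omega>. q i j t)"
    and "iterated_integrals P W q S K L R"
    and "jointly_measurable P S" and "jointly_measurable P K" and "jointly_measurable P R"
    and "\<kappa> > 0" and "cutoff \<theta>"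
    and "continuous_functional \<theta> (1 - \<kappa>) f" and "linear_growth \<theta> (1 - \<kappa>) f"
    and "T > 0" and "u \<in> drifts P"
  shows
    "(AE \<omega> in completion P.
       (\<integral>x. norm (grad (Y_field W T \<omega>) x + grad (Z_shift \<zeta> T u \<omega>) x) ^ 4
            - c_T q T (grad (Z_shift \<zeta> T u \<omega>) x)
            - 4 * (b_T q T (grad (Y_field W T \<omega>) x) \<bullet> grad (Z_shift \<zeta> T u \<omega>) x)
            - a_T q T (S \<omega> x) (K \<omega> x) (R \<omega> x) (grad (Y_field W T \<omega>) x) \<partial>torus)
     = (\<integral>x. wick4 q T (S \<omega> x) (K \<omega> x) (R \<omega> x) (grad (Y_field W T \<omega>) x)
            + 4 * (wick3 q T (grad (Y_field W T \<omega>) x) \<bullet> grad (Z_shift \<zeta> T u \<omega>) x)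
            + 4 * (grad (Y_field W T \<omega>) x \<bullet> odd_pow (grad (Z_shift \<zeta> T u \<omega>) x) 3)
            + even_pow (grad (Z_shift \<zeta> T u \<omega>) x) 4
            + wick2_term q T (grad (Y_field W T \<omega>) x) (grad (Z_shift \<zeta> T u \<omega>) x) \<partial>torus))
     \<and>
     F_T \<zeta> P f W q S K R T u = expectation_ext (completion P) (\<lambda>\<omega>.
       f (fourier_coeff (\<lambda>x. Y_field W T \<omega> x + Z_shift \<zeta> T u \<omega> x))
       + Phi_T q T (Y_field W T \<omega>) (Z_shift \<zeta> T u \<omega>)
       + (\<integral>x. norm (grad (Z_shift \<zeta> T u \<omega>) x) ^ 4 \<partial>torus)
       + drift_cost u \<omega>)"
proof -
  interpret gf: gaussian_field \<alpha> P \<zeta> W q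
    using assms(2-5) by unfold_locales
  interpret V: wick_setting \<alpha> P \<zeta> W q T S K L R
    using assms(6,8,9,14) by unfold_locales
  interpret d: drift_field \<alpha> P \<zeta> W q T u
    using assms(14,15) by unfold_locales
  let ?M = "completion P" and ?N = "low_modes T"
  have q: "q 1 2 T = q 2 1 T" using gf.q_sym assms(14) by simp
  define Y where "Y \<omega> = trig_poly ?N (\<lambda>n. W n T \<omega>)" for \<omega>
  define Z where "Z \<omega> = trig_poly ?N (\<lambda>n. d.Z_coeff n \<omega>)" for \<omega>
  \<comment> \<open>The coefficients are cut off outside the low modes: measurability of the whole
    family is checked in every coordinate, and nothing is known about \<open>W 0\<close>.\<close>
  define c where "c \<omega> n = (if n \<in> ?N then W n T \<omega> + d.Z_coeff n \<omega> else 0)" for \<omega> n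
  define w where "w \<omega> = (\<integral>x. V.Y4 \<omega> x \<partial>torus)" for \<omega>
  \<comment> \<open>The second integrand with both fields replaced by their trigonometric
    polynomials, which makes it measurable; the replacement changes it on a null set only.\<close>
  define X where "X \<omega> = f (fourier_coeff (trig_poly ?N (c \<omega>))) + Phi_T q T (Y \<omega>) (Z \<omega>)
     + (\<integral>x. norm (grad (Z \<omega>) x) ^ 4 \<partial>torus) + drift_cost u \<omega>" for \<omega>
  have YZ: "AE \<omega> in ?M. Y_field W T \<omega> = Y \<omega> \<and> Z_shift \<zeta> T u \<omega> = Z \<omega>"
    using gf.Y_field_eq[of T] d.Z_shift_eq assms(14) by (auto simp: Y_def Z_def)
  have sum: "(\<lambda>x. Y \<omega> x + Z \<omega> x) = trig_poly ?N (c \<omega>)" for \<omega>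
    unfolding Y_def Z_def trig_poly_add by (rule trig_poly_cong) (simp add: c_def)
  have Phi: "Phi_T q T (Y \<omega>) (Z \<omega>) = (\<integral>x. phi_integrand q T (grad (Y \<omega>) x) (grad (Z \<omega>) x) \<partial>torus)" for \<omega>
    by (simp add: Phi_T_def phi_integrand_def)

  have W_m: "W n T \<in> borel_measurable ?M" if "n \<in> ?N" for n
    using V.W_measurable_low[OF that] .
  have X_m: "X \<in> borel_measurable ?M"
  proof -
    have gY: "(\<lambda>p. grad (Y (snd p)) (fst p)) \<in> borel_measurable (torus \<Otimes>\<^sub>M ?M)"
      unfolding Y_def by (intro grad_trig_poly_joint W_m)
    have gZ: "(\<lambda>p. grad (Z (snd p)) (fst p)) \<in> borel_measurable (torus \<Otimes>\<^sub>M ?M)"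
      unfolding Z_def by (intro grad_trig_poly_joint d.Z_coeff_measurable)
    have phi: "(\<lambda>p. phi_integrand q T (fst p) (snd p)) \<in> borel_measurable (borel \<Otimes>\<^sub>M borel)"
      using borel_measurable_continuous_onI[OF continuous_phi_integrand] by (simp add: borel_prod)
    have "(\<lambda>\<omega>. Phi_T q T (Y \<omega>) (Z \<omega>)) \<in> borel_measurable ?M"
      unfolding Phi
      using measurable_compose[OF measurable_Pair[OF gY gZ] phi] by (intro integral_measurable_snd torus.sigma_finite_measure_axioms) simp
    moreover have "(\<lambda>\<omega>. \<integral>x. norm (grad (Z \<omega>) x) ^ 4 \<partial>torus) \<in> borel_measurable ?M"
      using gZ by (intro integral_measurable_snd torus.sigma_finite_measure_axioms) simp
    moreover have "(\<lambda>\<omega>. c \<omega>) \<in> borel_measurable ?M"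
    proof (rule measurable_coordinatewise_then_product)
      fix n
      show "(\<lambda>\<omega>. c \<omega> n) \<in> borel_measurable ?M"
        unfolding c_def using W_m d.Z_coeff_measurable by (cases "n \<in> ?N") auto
    qed
    then have "(\<lambda>\<omega>. f (fourier_coeff (trig_poly ?N (c \<omega>)))) \<in> borel_measurable ?M"
      using measurable_compose continuous_functional_measurable[OF assms(12,11) finite_low_modes[of T]] by blast
    ultimately show ?thesis unfolding X_def using d.drift_cost_measurable by simp
  qed

  \<comment> \<open>Splitting the integral needs integrability of each part: two parts are
    continuous in \<open>x\<close>, and the Wick power is integrable for almost every path.\<close>
  have energy: "renormalised_energy q T (S \<omega>) (K \<omega>) (R \<omega>) (Y \<omega>) (Z \<omega>)
      = Phi_T q T (Y \<omega>) (Z \<omega>) + (\<integral>x. norm (grad (Z \<omega>) x) ^ 4 \<partial>torus) + w \<omega>"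
    if V: "integrable torus (V.Y4 \<omega>)" for \<omega>
  proof -
    have g: "continuous_on UNIV (grad (Y \<omega>))" "continuous_on UNIV (grad (Z \<omega>))"
      unfolding Y_def Z_def by (intro continuous_intros)+
    have "continuous_on UNIV (\<lambda>x. phi_integrand q T (grad (Y \<omega>) x) (grad (Z \<omega>) x))"
      using continuous_on_compose2[OF continuous_phi_integrand continuous_on_Pair[OF g]] by simp
    then have 1: "integrable torus (\<lambda>x. phi_integrand q T (grad (Y \<omega>) x) (grad (Z \<omega>) x))"
      by (rule torus_integrable_continuous)
    have 2: "integrable torus (\<lambda>x. norm (grad (Z \<omega>) x) ^ 4)"
      using g by (intro torus_integrable_continuous continuous_intros)
    have "renormalised_energy q T (S \<omega>) (K \<omega>) (R \<omega>) (Y \<omega>) (Z \<omega>)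
      = (\<integral>x. phi_integrand q T (grad (Y \<omega>) x) (grad (Z \<omega>) x) + norm (grad (Z \<omega>) x) ^ 4 + V.Y4 \<omega> x \<partial>torus)"
      unfolding renormalised_energy_def renormalised_integrand[of q T, OF q]
      by (simp add: phi_integrand_def V.Y4_def V.gradY_def Y_def even_pow_def algebra_simps)
    also have "\<dots> = Phi_T q T (Y \<omega>) (Z \<omega>) + (\<integral>x. norm (grad (Z \<omega>) x) ^ 4 \<partial>torus) + w \<omega>"
      unfolding Phi w_def using 1 2 V by simp
    finally show ?thesis .
  qed

  have "F_T \<zeta> P f W q S K R T u = expectation_ext ?M (\<lambda>\<omega>. X \<omega> + w \<omega>)"
    unfolding F_T_def
    using YZ V.Y4_torus_integral(1) by (intro expectation_ext_cong_AE, eventually_elim) (simp add: sum energy X_def)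
  also have "\<dots> = expectation_ext ?M X"
    unfolding w_def using V.Y4_torus_integral(2,3) by (intro expectation_ext_add_mean_zero X_m)
  also have "\<dots> = expectation_ext ?M (\<lambda>\<omega>.
       f (fourier_coeff (\<lambda>x. Y_field W T \<omega> x + Z_shift \<zeta> T u \<omega> x))
       + Phi_T q T (Y_field W T \<omega>) (Z_shift \<zeta> T u \<omega>)
       + (\<integral>x. norm (grad (Z_shift \<zeta> T u \<omega>) x) ^ 4 \<partial>torus)
       + drift_cost u \<omega>)"
    using YZ by (intro expectation_ext_cong_AE, eventually_elim) (simp add: sum X_def)
  \<comment> \<open>In the first claim the integrands agree at every point, so the integrals agree
    without any integrability.\<close>
  finally show ?thesis by (simp only: renormalised_integrand[of q T, OF q]) simp
qed

end
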